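(* Let $\beta_1\in(0,1-\ln2)$, $\beta_2>\omega_*(\omega^{-1}(\beta_1))$, and let $w=(v_0,v)\in\operatorname{dom}\varphi$ and $u=(x,y,s)\in\mathcal{F}_p\times\mathcal{F}_d$ satisfy $\Omega(u,w)\le\beta_1$. Let $w_+=w+\alpha_p\Delta w$ be the result of one predictor step from $(u,w)$ with the greedy direction $\Delta w=-w$. Then $$\mu^*(w_+)\;\le\;\frac{1}{1+\gamma}\,\mu^*(w)\;\le\;e^{-\gamma/(1+\gamma)}\,\mu^*(w),\qquad \gamma=\frac{\sigma}{(\nu+1)^{1/2}},$$ where $\sigma=(1-\omega^{-1}(\beta_1))^2\big[\omega_*^{-1}(\beta_2)-\omega^{-1}(\beta_1)\big]$ and $\mu^*(w)=\dfrac{v_0^2}{v_0-\|v\|_\nu^2}$ for $w=(v_0,v)$.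
   Context: Scalar functions: $\omega(\tau)=\tau-\ln(1+\tau)$ and $\omega_*(\tau)=-\tau-\ln(1-\tau)$ for $\tau\in[0,1)$; $\omega^{-1},\omega_*^{-1}$ are their inverses. Barriers. For a finite-dimensional real space $\mathbb{E}$ with dual $\mathbb{E}^*$ and pairing $\langle s,x\rangle$: a closed convex $f$, $C^3$ on its open domain, is self-concordant if $D^3f(x)[h]^3\le2(D^2f(x)[h]^2)^{3/2}$ for all $x\in\operatorname{dom} f$ and all $h$. A $\nu$-normal barrier for a closed convex pointed cone $K$ with nonempty interior is a self-concordant $F$ with domain $\operatorname{int}K$, $\langle\nabla F(x),h\rangle^2\le\nu\langle\nabla^2F(x)h,h\rangle$ for all $x \in \operatorname{int} K$ and all $h$ (with $\nu\ge1$), and $F(\tau x)=F(x)-\nu\ln\tau$ for $\tau>0$. $K^*$ is the dual cone, $F_*(s)=\max_{x\in\operatorname{int}K}[-\langle s,x\rangle-F(x)]$ for $s \in \operatorname{int} K^*$. $F$ is $\nu$-self-scaled if moreover $\nabla^2F(w)x\in\operatorname{int}K^*$ and $F_*(\nabla^2F(w)x)=F(x)-2F(w)-\nu$ for all $x,w\in\operatorname{int}K$. A cone is symmetric iff it admits a self-scaled barrier. Multiconic problem. $\mathbb{E}=\mathbb{E}_1\times\dots\times\mathbb{E}_n$, $K=K_1\times\dots\times K_n$, where each $K_i\subset\mathbb{E}_i$ is a symmetric cone with $\nu_i$-self-scaled barrier $F^i$ satisfying: for all $x\in\operatorname{int}K_i$, $h\in\mathbb{E}_i$, $\alpha,\beta\in\mathbb{R}$,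 the functional $-3D^3F^i(x)[\alpha x+\beta h]^2\,\langle\nabla^2F^i(x)h,h\rangle^{1/2}-D^4F^i(x)[h][\alpha x+\beta h]^2$ belongs to $K_i^*$ (here $D^3F(x)[q]^2$ and $D^4F(x)[h][q]^2$ are the functionals $p\mapsto D^3F(x)[q,q,p]$ and $p\mapsto D^4F(x)[h,q,q,p]$). Let $b\in\mathbb{R}^m$, $c\in\mathbb{E}^*$, $A_i:\mathbb{E}_i\to\mathbb{R}^m$ linear of full column rank, $A(x)=\sum_iA_i(x_i)$ of full row rank, $A^*(y)=(A_1^*(y),\dots,A_n^*(y))$. $\mathcal{F}_p=\{x\in\operatorname{int}K:A(x)=b\}$, $\mathcal{F}_d=\{(y,s)\in\mathbb{R}^m\times\operatorname{int}K^*:s+A^*(y)=c\}$; both are assumed nonempty. $\nu=\sum_i\nu_i$, $\|v\|_\nu^2=\sum_i\nu_i(v^{(i)})^2$ for $v\in\mathbb{R}^n$. Potential. For $w=(v_0,v)\in\mathbb{R}^{n+1}$ and $u=(x,y,s)$, $$\hat F(u,w)=\sum_{i=1}^n\Phi_i(x_i,s_i,v^{(i)})-\ln(v_0-\langle c,x\rangle+\langle b,y\rangle),$$ $$\Phi_i(x_i,s_i,v^{(i)})=F^i_*\big(s_i+(v^{(i)})^2\nabla F^i(x_i)\big)+F^i(x_i),$$ defined when $x_i\in\operatorname{int}K_i$, $s_i\in\operatorname{int}K_i^*$, $s_i+(v^{(i)})^2\nabla F^i(x_i)\in\operatorname{int}K_i^*$ for all $i$ and $v_0>\langle c,x\rangle-\langle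 b,y\rangle$ (otherwise the value is $+\infty$). $\varphi(w)=\min\{\hat F(u,w):u\in\mathcal{F}_p\times\mathcal{F}_d,\ (u,w)\in\operatorname{dom}\hat F\}$; one has $\operatorname{dom}\varphi=\{(v_0,v):v_0>\|v\|_\nu^2\}$ and $\varphi(w)=-(\nu+1)\ln\frac{v_0-\|v\|_\nu^2}{\nu+1}-\nu$. The functional proximity measure is $\Omega(u,w)=\hat F(u,w)-\varphi(w)$. Predictor step. Put $\tilde u=(x,y)$ and $\tilde F(\tilde u,w)=\hat F\big((x,y,c-A^*(y)),w\big)$. Given $\Delta w$, let $\Delta_p\tilde u=(\Delta_px,\Delta_py)$, together with a multiplier $\lambda\in\mathbb{R}^m$, solve $$\nabla^2_{\tilde u\tilde u}\tilde F(\tilde u,w)\Delta_p\tilde u+\nabla^2_{\tilde uw}\tilde F(\tilde u,w)\Delta w+(A^*\lambda,0)=0,\qquad A\,\Delta_px=0,$$ and set $\Delta_ps=-A^*(\Delta_py)$, $\Delta_pu=(\Delta_px,\Delta_py,\Delta_ps)$. The step size is $\alpha_p=\max\{\alpha\in[0,1]:\Omega(u+\alpha\Delta_pu,\,w+\alpha\Delta w)\le\beta_2\}$, and the new point is $(u+\alpha_p\Delta_pu,\ w+\alpha_p\Delta w)$. *)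

theory Defs
  imports "HOL-Analysis.Analysis"
begin

text \<open>
  The blocks $\mathbb{E}_1,\dots,\mathbb{E}_n$ may have different dimensions, so each of them is a
  linear subspace \<open>E i\<close> of one ambient Euclidean space; every finite family of
  finite-dimensional spaces arises in this way.  All notions below (interior, derivatives,
  gradients, dual cones, adjoints) are relative to such a subspace and see nothing outside it.
  The dual of a subspace \<open>E\<close> is represented by \<open>E\<close> itself, with the
  inner product as the pairing.
\<close>

subsection \<open>Scalar functions\<close>

definition omega :: "real \<Rightarrow> real" where
  "omega t = t - ln (1 + t)"

definition omega_star :: "real \<Rightarrow> real" where
  "omega_star t = - t - ln (1 - t)"

definition omega_inv :: "real \<Rightarrow> real" where
  "omega_inv = the_inv_into {0..} omega"

definition omega_star_inv :: "real \<Rightarrow> real" where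
  "omega_star_inv = the_inv_into {0..<1} omega_star"


subsection \<open>Calculus in a subspace\<close>

definition int_in :: "'a::euclidean_space set \<Rightarrow> 'a set \<Rightarrow> 'a set" where
  "int_in E S = top_of_set E interior_of S"

text \<open>The element of \<open>E\<close> that represents a linear functional on \<open>E\<close>.\<close>

definition riesz :: "'a::euclidean_space set \<Rightarrow> ('a \<Rightarrow> real) \<Rightarrow> 'a" where
  "riesz E l = (THE g. g \<in> E \<and> (\<forall>h\<in>E. g \<bullet> h = l h))"

definition dirderiv :: "('a::euclidean_space \<Rightarrow> real) \<Rightarrow> 'a \<Rightarrow> 'a \<Rightarrow> real" where
  "dirderiv f h x = deriv (\<lambda>t. f (x + t *\<^sub>R h)) 0"

text \<open>\<open>DD f [h1, \<dots>, hk] x\<close> is $D^kf(x)[h_1,\dots,h_k]$.\<close>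

primrec DD :: "('a::euclidean_space \<Rightarrow> real) \<Rightarrow> 'a list \<Rightarrow> 'a \<Rightarrow> real" where
  "DD f [] = f"
| "DD f (h # hs) = dirderiv (DD f hs) h"

text \<open>Class $C^k$ on a relatively open subset \<open>U\<close> of the subspace \<open>E\<close>.\<close>

primrec C_k_on :: "nat \<Rightarrow> 'a::euclidean_space set \<Rightarrow> 'a set \<Rightarrow> ('a \<Rightarrow> real) \<Rightarrow> bool" where
  "C_k_on 0 E U f \<longleftrightarrow> continuous_on U f"
| "C_k_on (Suc k) E U f \<longleftrightarrow>
     f differentiable_on U \<and> (\<forall>h\<in>E. C_k_on k E U (dirderiv f h))"

definition grad :: "'a::euclidean_space set \<Rightarrow> ('a \<Rightarrow> real) \<Rightarrow> 'a \<Rightarrow> 'a" where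
  "grad E f x = riesz E (\<lambda>h. DD f [h] x)"

definition hess :: "'a::euclidean_space set \<Rightarrow> ('a \<Rightarrow> real) \<Rightarrow> 'a \<Rightarrow> 'a \<Rightarrow> 'a" where
  "hess E f x h = riesz E (\<lambda>p. DD f [h, p] x)"


subsection \<open>Self-scaled barriers\<close>

definition self_concordant ::
  "'a::euclidean_space set \<Rightarrow> 'a set \<Rightarrow> ('a \<Rightarrow> real) \<Rightarrow> bool" where
  "self_concordant E Q f \<longleftrightarrow>
     openin (top_of_set E) Q \<and> convex_on Q f \<and> closed (epigraph Q f) \<and> C_k_on 3 E Q f \<and>
     (\<forall>x\<in>Q. \<forall>h\<in>E. DD f [h, h, h] x \<le> 2 * (DD f [h, h] x) powr (3/2))"

definition proper_cone :: "'a::euclidean_space set \<Rightarrow> 'a set \<Rightarrow> bool" where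
  "proper_cone E K \<longleftrightarrow>
     K \<subseteq> E \<and> closed K \<and> convex K \<and> cone K \<and> K \<inter> uminus ` K = {0} \<and> int_in E K \<noteq> {}"

definition dual_cone :: "'a::euclidean_space set \<Rightarrow> 'a set \<Rightarrow> 'a set" where
  "dual_cone E K = {s \<in> E. \<forall>x\<in>K. 0 \<le> s \<bullet> x}"

definition normal_barrier ::
  "'a::euclidean_space set \<Rightarrow> 'a set \<Rightarrow> real \<Rightarrow> ('a \<Rightarrow> real) \<Rightarrow> bool" where
  "normal_barrier E K \<nu> F \<longleftrightarrow>
     proper_cone E K \<and> \<nu> \<ge> 1 \<and> self_concordant E (int_in E K) F \<and>
     (\<forall>x\<in>int_in E K. \<forall>h\<in>E. (grad E F x \<bullet> h)\<^sup>2 \<le> \<nu> * (hess E F x h \<bullet> h)) \<and>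
     (\<forall>x\<in>int_in E K. \<forall>t>0. F (t *\<^sub>R x) = F x - \<nu> * ln t)"

text \<open>
  $F_*$; the supremum is attained for \<open>s\<close> in the interior of the dual cone, and only such
  \<open>s\<close> matter.
\<close>

definition conj_barrier ::
  "'a::euclidean_space set \<Rightarrow> 'a set \<Rightarrow> ('a \<Rightarrow> real) \<Rightarrow> 'a \<Rightarrow> real" where
  "conj_barrier E K F s = (SUP x\<in>int_in E K. - (s \<bullet> x) - F x)"

definition self_scaled ::
  "'a::euclidean_space set \<Rightarrow> 'a set \<Rightarrow> real \<Rightarrow> ('a \<Rightarrow> real) \<Rightarrow> bool" where
  "self_scaled E K \<nu> F \<longleftrightarrow>
     normal_barrier E K \<nu> F \<and>
     (\<forall>x\<in>int_in E K. \<forall>w\<in>int_in E K.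
        hess E F w x \<in> int_in E (dual_cone E K) \<and>
        conj_barrier E K F (hess E F w x) = F x - 2 * F w - \<nu>)"

text \<open>
  The extra condition on the fourth derivative.  It presupposes that the derivative exists;
  since \<open>deriv\<close> is total, this is spelled out.
\<close>

definition fourth_order_condition ::
  "'a::euclidean_space set \<Rightarrow> 'a set \<Rightarrow> ('a \<Rightarrow> real) \<Rightarrow> bool" where
  "fourth_order_condition E K F \<longleftrightarrow>
     C_k_on 4 E (int_in E K) F \<and>
     (\<forall>x\<in>int_in E K. \<forall>h\<in>E. \<forall>\<alpha> \<beta>. let q = \<alpha> *\<^sub>R x + \<beta> *\<^sub>R h in
        riesz E (\<lambda>p. - 3 * DD F [q, q, p] x * sqrt (hess E F x h \<bullet> h) - DD F [h, q, q, p] x)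
          \<in> dual_cone E K)"


subsection \<open>The multiconic problem\<close>

record ('a, 'n, 'm) multiconic =
  Esp :: "'n \<Rightarrow> 'a set"
  Kc :: "'n \<Rightarrow> 'a set"
  Fb :: "'n \<Rightarrow> 'a \<Rightarrow> real"
  nup :: "'n \<Rightarrow> real"
  Aop :: "'n \<Rightarrow> 'a \<Rightarrow> real ^ 'm"
  bvec :: "real ^ 'm"
  cvec :: "'a ^ 'n"

type_synonym ('a, 'n, 'm) pdpoint = "('a ^ 'n) \<times> (real ^ 'm) \<times> ('a ^ 'n)"

type_synonym 'n target = "real \<times> (real ^ 'n)"

definition vprod :: "('n::finite \<Rightarrow> 'a set) \<Rightarrow> ('a ^ 'n) set" where
  "vprod S = {x. \<forall>i. x $ i \<in> S i}"

definition Etot :: "('a::euclidean_space, 'n::finite, 'm::finite) multiconic \<Rightarrow> ('a ^ 'n) set" where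
  "Etot P = vprod (Esp P)"

definition Ktot :: "('a::euclidean_space, 'n::finite, 'm::finite) multiconic \<Rightarrow> ('a ^ 'n) set" where
  "Ktot P = vprod (Kc P)"

definition Atot ::
  "('a::euclidean_space, 'n::finite, 'm::finite) multiconic \<Rightarrow> 'a ^ 'n \<Rightarrow> real ^ 'm" where
  "Atot P x = (\<Sum>i\<in>UNIV. Aop P i (x $ i))"

definition Astar ::
  "('a::euclidean_space, 'n::finite, 'm::finite) multiconic \<Rightarrow> real ^ 'm \<Rightarrow> 'a ^ 'n" where
  "Astar P y = (\<chi> i. riesz (Esp P i) (\<lambda>h. y \<bullet> Aop P i h))"

definition Fprimal :: "('a::euclidean_space, 'n::finite, 'm::finite) multiconic \<Rightarrow> ('a ^ 'n) set" where
  "Fprimal P = {x \<in> int_in (Etot P) (Ktot P). Atot P x = bvec P}"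

definition Fdual ::
  "('a::euclidean_space, 'n::finite, 'm::finite) multiconic \<Rightarrow> ((real ^ 'm) \<times> ('a ^ 'n)) set" where
  "Fdual P = {(y, s). s \<in> int_in (Etot P) (dual_cone (Etot P) (Ktot P)) \<and> s + Astar P y = cvec P}"

definition nu :: "('a::euclidean_space, 'n::finite, 'm::finite) multiconic \<Rightarrow> real" where
  "nu P = (\<Sum>i\<in>UNIV. nup P i)"

text \<open>$\|v\|_\nu^2$\<close>

definition nu_norm2 ::
  "('a::euclidean_space, 'n::finite, 'm::finite) multiconic \<Rightarrow> real ^ 'n \<Rightarrow> real" where
  "nu_norm2 P v = (\<Sum>i\<in>UNIV. nup P i * (v $ i)\<^sup>2)"

text \<open>
  Only the restriction of \<open>Aop P i\<close> to \<open>Esp P i\<close> matters; a linear map on the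
  subspace always extends linearly to the ambient space.
\<close>

definition multiconic_problem ::
  "('a::euclidean_space, 'n::finite, 'm::finite) multiconic \<Rightarrow> bool" where
  "multiconic_problem P \<longleftrightarrow>
     (\<forall>i. subspace (Esp P i) \<and>
          self_scaled (Esp P i) (Kc P i) (nup P i) (Fb P i) \<and>
          fourth_order_condition (Esp P i) (Kc P i) (Fb P i) \<and>
          linear (Aop P i) \<and> inj_on (Aop P i) (Esp P i)) \<and>
     Atot P ` Etot P = UNIV \<and>
     cvec P \<in> Etot P \<and>
     Fprimal P \<noteq> {} \<and> Fdual P \<noteq> {}"


subsection \<open>Potential and proximity measure\<close>

definition feasible ::
  "('a::euclidean_space, 'n::finite, 'm::finite) multiconic \<Rightarrow> ('a, 'n, 'm) pdpoint set" where
  "feasible P = {(x, y, s). x \<in> Fprimal P \<and> (y, s) \<in> Fdual P}"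

definition scaled_slack ::
  "('a::euclidean_space, 'n::finite, 'm::finite) multiconic \<Rightarrow> 'n \<Rightarrow> 'a \<Rightarrow> 'a \<Rightarrow> real \<Rightarrow> 'a" where
  "scaled_slack P i x s t = s + t\<^sup>2 *\<^sub>R grad (Esp P i) (Fb P i) x"

definition Phi ::
  "('a::euclidean_space, 'n::finite, 'm::finite) multiconic \<Rightarrow> 'n \<Rightarrow> 'a \<Rightarrow> 'a \<Rightarrow> real \<Rightarrow> real" where
  "Phi P i x s t = conj_barrier (Esp P i) (Kc P i) (Fb P i) (scaled_slack P i x s t) + Fb P i x"

definition dom_Fhat ::
  "('a::euclidean_space, 'n::finite, 'm::finite) multiconic
    \<Rightarrow> (('a, 'n, 'm) pdpoint \<times> 'n target) set" where
  "dom_Fhat P = {((x, y, s), (v0, v)).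
     (\<forall>i. x $ i \<in> int_in (Esp P i) (Kc P i) \<and>
          s $ i \<in> int_in (Esp P i) (dual_cone (Esp P i) (Kc P i)) \<and>
          scaled_slack P i (x $ i) (s $ i) (v $ i)
            \<in> int_in (Esp P i) (dual_cone (Esp P i) (Kc P i))) \<and>
     v0 > cvec P \<bullet> x - bvec P \<bullet> y}"

text \<open>\<open>Fhat_fin\<close> is the formula for the potential, meaningful on \<open>dom_Fhat\<close>.\<close>

definition Fhat_fin ::
  "('a::euclidean_space, 'n::finite, 'm::finite) multiconic
    \<Rightarrow> ('a, 'n, 'm) pdpoint \<Rightarrow> 'n target \<Rightarrow> real" where
  "Fhat_fin P = (\<lambda>(x, y, s) (v0, v).
     (\<Sum>i\<in>UNIV. Phi P i (x $ i) (s $ i) (v $ i)) - ln (v0 - cvec P \<bullet> x + bvec P \<bullet> y))"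

definition Fhat ::
  "('a::euclidean_space, 'n::finite, 'm::finite) multiconic
    \<Rightarrow> ('a, 'n, 'm) pdpoint \<Rightarrow> 'n target \<Rightarrow> ereal" where
  "Fhat P u w = (if (u, w) \<in> dom_Fhat P then ereal (Fhat_fin P u w) else \<infinity>)"

definition phi ::
  "('a::euclidean_space, 'n::finite, 'm::finite) multiconic \<Rightarrow> 'n target \<Rightarrow> ereal" where
  "phi P w = (INF u\<in>feasible P. Fhat P u w)"

definition dom_phi ::
  "('a::euclidean_space, 'n::finite, 'm::finite) multiconic \<Rightarrow> 'n target set" where
  "dom_phi P = {w. phi P w < \<infinity>}"

text \<open>
  The functional proximity measure; outside \<open>dom_Fhat\<close> it is \<open>\<infinity>\<close>, also when
  \<open>phi P w = \<infinity>\<close>, because \<open>\<infinity> - \<infinity> = \<infinity>\<close> in \<open>ereal\<close>.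
\<close>

definition Prox ::
  "('a::euclidean_space, 'n::finite, 'm::finite) multiconic
    \<Rightarrow> ('a, 'n, 'm) pdpoint \<Rightarrow> 'n target \<Rightarrow> ereal" where
  "Prox P u w = Fhat P u w - phi P w"


subsection \<open>Predictor step\<close>

definition Ftilde ::
  "('a::euclidean_space, 'n::finite, 'm::finite) multiconic
    \<Rightarrow> (('a ^ 'n) \<times> (real ^ 'm)) \<times> 'n target \<Rightarrow> real" where
  "Ftilde P = (\<lambda>((x, y), w). Fhat_fin P (x, y, cvec P - Astar P y) w)"

definition hess_uu ::
  "('a::euclidean_space, 'n::finite, 'm::finite) multiconic
    \<Rightarrow> ('a ^ 'n) \<times> (real ^ 'm) \<Rightarrow> 'n target
    \<Rightarrow> ('a ^ 'n) \<times> (real ^ 'm) \<Rightarrow> ('a ^ 'n) \<times> (real ^ 'm)" where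
  "hess_uu P z w dz =
     riesz (Etot P \<times> UNIV) (\<lambda>p. DD (Ftilde P) [(p, 0), (dz, 0)] (z, w))"

definition hess_uw ::
  "('a::euclidean_space, 'n::finite, 'm::finite) multiconic
    \<Rightarrow> ('a ^ 'n) \<times> (real ^ 'm) \<Rightarrow> 'n target \<Rightarrow> 'n target \<Rightarrow> ('a ^ 'n) \<times> (real ^ 'm)" where
  "hess_uw P z w dw =
     riesz (Etot P \<times> UNIV) (\<lambda>p. DD (Ftilde P) [(p, 0), (0, dw)] (z, w))"

definition predictor_direction ::
  "('a::euclidean_space, 'n::finite, 'm::finite) multiconic
    \<Rightarrow> ('a, 'n, 'm) pdpoint \<Rightarrow> 'n target \<Rightarrow> 'n target \<Rightarrow> ('a, 'n, 'm) pdpoint \<Rightarrow> bool" where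
  "predictor_direction P u w dw du \<longleftrightarrow>
     (case (u, du) of ((x, y, s), (dx, dy, ds)) \<Rightarrow>
        dx \<in> Etot P \<and>
        (\<exists>l. hess_uu P (x, y) w (dx, dy) + hess_uw P (x, y) w dw + (Astar P l, 0) = 0) \<and>
        Atot P dx = 0 \<and>
        ds = - Astar P dy)"

text \<open>
  The maximal step in $[0,1]$ within the \<open>\<beta>2\<close>-level set of the proximity measure;
  \<open>Sup\<close> is the maximum whenever a maximum exists.  With \<open>dw = - w\<close> none exists if all
  \<open>\<alpha> < 1\<close> are admissible, because \<open>\<alpha> = 1\<close> leads to \<open>w = 0\<close>, which is outside the domain.
\<close>

definition predictor_stepsize ::
  "('a::euclidean_space, 'n::finite, 'm::finite) multiconic \<Rightarrow> real
    \<Rightarrow> ('a, 'n, 'm) pdpoint \<Rightarrow> 'n target \<Rightarrow> ('a, 'n, 'm) pdpoint \<Rightarrow> 'n target \<Rightarrow> real" where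
  "predictor_stepsize P \<beta>2 u w du dw =
     Sup {\<alpha> \<in> {0..1}. Prox P (u + \<alpha> *\<^sub>R du) (w + \<alpha> *\<^sub>R dw) \<le> ereal \<beta>2}"

definition predictor_step ::
  "('a::euclidean_space, 'n::finite, 'm::finite) multiconic \<Rightarrow> real
    \<Rightarrow> ('a, 'n, 'm) pdpoint \<Rightarrow> 'n target \<Rightarrow> 'n target
    \<Rightarrow> ('a, 'n, 'm) pdpoint \<Rightarrow> 'n target \<Rightarrow> bool" where
  "predictor_step P \<beta>2 u w dw u' w' \<longleftrightarrow>
     (\<exists>du. predictor_direction P u w dw du \<and>
        (let \<alpha> = predictor_stepsize P \<beta>2 u w du dw
         in u' = u + \<alpha> *\<^sub>R du \<and> w' = w + \<alpha> *\<^sub>R dw))"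


definition mu_star ::
  "('a::euclidean_space, 'n::finite, 'm::finite) multiconic \<Rightarrow> 'n target \<Rightarrow> real" where
  "mu_star P = (\<lambda>(v0, v). v0\<^sup>2 / (v0 - nu_norm2 P v))"

end

theory Submission
  imports Defs
begin

text \<open>
  The potential, as a function \<open>f\<close> of \<open>(x, y, w)\<close>, is self-concordant: since \<open>F\<close> is self-scaled, \<open>F\<^sub>*\<close> is \<open>F\<close>
  composed with a linear bijection, and the fourth order condition says that \<open>v\<^sup>2 \<nabla>F(x)\<close> is a concave map
  whose third derivative is controlled by its second one, so the composition with \<open>F\<^sub>*\<close> stays self-concordant
  after adding \<open>F\<close>.  Minimising over \<open>u\<close> gives the explicit function \<open>\<phi>\<close>, attained at a weighted central
  point \<open>u\<^sup>*\<close>.  From \<open>\<Omega>(u, w) \<le> \<beta>\<^sub>1\<close> the point \<open>(u, w)\<close> has distance at most \<open>\<delta> = \<omega>\<^sup>-\<^sup>1(\<beta>\<^sub>1)\<close> from \<open>(u\<^sup>*, w)\<close> in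
  the local norm of \<open>(u\<^sup>*, w)\<close>.  The predictor direction minimises the local norm at \<open>(u, w)\<close>, so two
  comparisons of Hessians bound its norm at \<open>(u\<^sup>*, w)\<close> by \<open>\<phi>''(w)[w, w]\<^bsup>1/2\<^esup> / (1 - \<delta>)\<^sup>2\<close>, and a step \<open>\<alpha>\<close> leads to a point at
  distance at most \<open>\<delta> + \<alpha> \<phi>''(w)[w, w]\<^bsup>1/2\<^esup> / (1 - \<delta>)\<^sup>2\<close> from \<open>(u\<^sup>*, w)\<close>.  There the upper bound of \<open>f\<close> around
  \<open>(u\<^sup>*, w)\<close> and the convexity of \<open>\<phi>\<close> bound the proximity measure by \<open>\<omega>\<^sub>*\<close> of this distance.
\<close>

subsection \<open>Directional derivatives and smooth functions on open sets\<close>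

text \<open>The data of a block are controlled only inside its subspace, while the calculus below
  lives on open sets; so each barrier is composed with the orthogonal projection, which keeps its
  derivatives along the subspace. Hessians become degenerate and local norms are only seminorms.
  Smoothness of the conjugate is not derived from duality: the self-scaled identity at one fixed
  point \<open>w0\<close> makes it the barrier composed with the inverse \<open>T\<close> of the
  Hessian at \<open>w0\<close>, up to a constant. The obstacle in the final estimate is the tangent
  of the curve of central points, which would call for implicit differentiation. The predictor
  direction is compared with chords between central points instead. In \<sigma>, the square counts
  the Hessian comparisons, one from the central point to \<open>u\<close> and one back; the bracket
  is what remains of the radius at which \<open>omega_star\<close> reaches \<beta>2. The root in
  \<gamma> comes from bounding the second derivative of \<phi> along \<open>w\<close> by
  \<open>(nu P + 1) * v0\<^sup>2 / (v0 - N v)\<^sup>2\<close>.\<close>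

abbreviation smooth_on :: "nat \<Rightarrow> 'a::euclidean_space set \<Rightarrow> ('a \<Rightarrow> real) \<Rightarrow> bool" where
  "smooth_on k U f \<equiv> C_k_on k UNIV U f"

lemma dirderiv_eq:
  assumes "(f has_derivative f') (at x)"
  shows "dirderiv f h x = f' h"
proof -
  have g: "((\<lambda>t. x + t *\<^sub>R h) has_derivative (\<lambda>t. t *\<^sub>R h)) (at 0)"
    by (auto intro!: derivative_eq_intros)
  have "((\<lambda>t. f (x + t *\<^sub>R h)) has_derivative (\<lambda>t. f' (t *\<^sub>R h))) (at 0)"
    using has_derivative_compose[OF g, of f f'] assms by simp
  moreover have "linear f'" using assms has_derivative_linear by blast
  ultimately have "((\<lambda>t. f (x + t *\<^sub>R h)) has_real_derivative f' h) (at 0)"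
    by (simp add: has_field_derivative_def linear_cmul mult_commute_abs)
  then show ?thesis by (simp add: dirderiv_def DERIV_imp_deriv)
qed

lemma has_derivative_dirderiv:
  assumes "f differentiable (at x)"
  shows "(f has_derivative (\<lambda>h. dirderiv f h x)) (at x)"
proof -
  obtain f' where f': "(f has_derivative f') (at x)" using assms by (auto simp: differentiable_def)
  then have "(\<lambda>h. dirderiv f h x) = f'" using dirderiv_eq by blast
  then show ?thesis using f' by simp
qed

lemma linear_dirderiv:
  assumes "f differentiable (at x)"
  shows "linear (\<lambda>h. dirderiv f h x)"
  using has_derivative_dirderiv[OF assms] has_derivative_linear by blast

lemma line_dirderiv:
  assumes "f differentiable (at (x + t *\<^sub>R h))"
  shows "((\<lambda>s. f (x + s *\<^sub>R h)) has_real_derivative dirderiv f h (x + t *\<^sub>R h)) (at t)"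
proof -
  have g: "((\<lambda>s. x + s *\<^sub>R h) has_derivative (\<lambda>s. s *\<^sub>R h)) (at t)"
    by (auto intro!: derivative_eq_intros)
  have "((\<lambda>s. f (x + s *\<^sub>R h)) has_derivative (\<lambda>s. dirderiv f (s *\<^sub>R h) (x + t *\<^sub>R h))) (at t)"
    using has_derivative_compose[OF g has_derivative_dirderiv[OF assms]] by simp
  moreover have "dirderiv f (s *\<^sub>R h) (x + t *\<^sub>R h) = s * dirderiv f h (x + t *\<^sub>R h)" for s
    using linear_cmul[OF linear_dirderiv[OF assms], of s h] by simp
  ultimately show ?thesis
    by (simp add: has_field_derivative_def mult_commute_abs)
qed

lemma dirderiv_cong:
  assumes "open U" "x \<in> U" "\<And>y. y \<in> U \<Longrightarrow> f y = g y"
  shows "dirderiv f h x = dirderiv g h x"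
proof -
  have "((\<lambda>t::real. x + t *\<^sub>R h) \<longlongrightarrow> x + 0 *\<^sub>R h) (nhds 0)"
    by (intro tendsto_intros filterlim_ident)
  then have "\<forall>\<^sub>F t in nhds (0::real). x + t *\<^sub>R h \<in> U"
    by (rule topological_tendstoD) (use assms in simp_all)
  then have "\<forall>\<^sub>F t in nhds (0::real). f (x + t *\<^sub>R h) = g (x + t *\<^sub>R h)"
    by (rule eventually_mono) (use assms in auto)
  then show ?thesis unfolding dirderiv_def by (intro deriv_cong_ev) auto
qed

lemma smooth_on_Suc:
  assumes "open U"
  shows "smooth_on (Suc k) U f \<longleftrightarrow>
    (\<forall>x\<in>U. f differentiable (at x)) \<and> (\<forall>h. smooth_on k U (dirderiv f h))"
  using differentiable_on_eq_differentiable_at[OF assms, of f] by simp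

declare C_k_on.simps(2) [simp del]

lemma smooth_on_cong:
  assumes "open U" "\<And>y. y \<in> U \<Longrightarrow> f y = g y"
  shows "smooth_on k U f = smooth_on k U g"
  using assms(2)
proof (induction k arbitrary: f g)
  case 0
  then show ?case by (simp cong: continuous_on_cong)
next
  case (Suc k)
  have "f differentiable (at x) \<longleftrightarrow> g differentiable (at x)" if "x \<in> U" for x
    using Suc.prems assms(1) that
    by (metis differentiable_def has_derivative_transform_within_open)
  moreover have "smooth_on k U (dirderiv f h) = smooth_on k U (dirderiv g h)" for h
    using Suc.prems assms(1) by (intro Suc.IH dirderiv_cong[where U=U]) auto
  ultimately show ?case using assms(1) by (simp add: smooth_on_Suc)
qed

lemma smooth_on_SucD:
  assumes "open U" "smooth_on (Suc k) U f"
  shows "smooth_on k U f"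
  using assms(2)
proof (induction k arbitrary: f)
  case 0
  then show ?case using assms(1)
    by (auto simp: smooth_on_Suc intro!: continuous_at_imp_continuous_on differentiable_imp_continuous_within)
next
  case (Suc k)
  then show ?case using assms(1) by (simp add: smooth_on_Suc[where k="Suc k"] smooth_on_Suc[where k=k])
qed

lemma smooth_on_mono:
  assumes "open U" "smooth_on k U f" "j \<le> k"
  shows "smooth_on j U f"
  using assms(3,2) by (induction rule: dec_induct) (auto dest: smooth_on_SucD[OF assms(1)])

lemma smooth_on_subset:
  assumes "open U" "open V" "V \<subseteq> U" "smooth_on k U f"
  shows "smooth_on k V f"
  using assms(4)
proof (induction k arbitrary: f)
  case 0 then show ?case using assms by (auto intro: continuous_on_subset)
next
  case (Suc k) then show ?case using assms by (auto simp: smooth_on_Suc)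
qed

lemma smooth_on_differentiable:
  assumes "open U" "smooth_on k U f" "0 < k" "x \<in> U"
  shows "f differentiable (at x)"
  using assms by (cases k) (auto simp: smooth_on_Suc)

lemma smooth_on_continuous:
  assumes "open U" "smooth_on k U f" 
  shows "continuous_on U f"
  using smooth_on_mono[OF assms, of 0] by simp

lemma smooth_on_const: "open U \<Longrightarrow> smooth_on k U (\<lambda>x. c)"
proof (induction k arbitrary: c)
  case 0 then show ?case by simp
next
  case (Suc k)
  have "dirderiv (\<lambda>x::'a. c) h = (\<lambda>x. 0)" for h :: 'a
    by (simp add: dirderiv_def fun_eq_iff)
  then show ?case using Suc by (simp add: smooth_on_Suc)
qed

lemma smooth_on_linear:
  assumes "open U" "linear f"
  shows "smooth_on k U f"
proof (cases k)
  case 0 then show ?thesis using assms by (simp add: linear_continuous_on linear_conv_bounded_linear)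
next
  case (Suc j)
  have d: "(f has_derivative f) (at x)" for x
    using assms(2) by (simp add: bounded_linear_imp_has_derivative linear_conv_bounded_linear)
  then have "dirderiv f h = (\<lambda>x. f h)" for h by (simp add: dirderiv_eq fun_eq_iff)
  then show ?thesis using Suc assms(1) d
    by (auto simp: smooth_on_Suc smooth_on_const differentiable_def)
qed

lemma smooth_on_add:
  assumes "open U" "smooth_on k U f" "smooth_on k U g"
  shows "smooth_on k U (\<lambda>x. f x + g x)"
  using assms(2,3)
proof (induction k arbitrary: f g)
  case 0 then show ?case by (auto intro: continuous_intros)
next
  case (Suc k)
  have df: "f differentiable (at x)" "g differentiable (at x)" if "x \<in> U" for x
    using Suc.prems that assms(1) by (auto simp: smooth_on_Suc)
  have "dirderiv (\<lambda>x. f x + g x) h x = dirderiv f h x + dirderiv g h x" if "x \<in> U" for h x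
    by (rule dirderiv_eq) (auto intro!: derivative_eq_intros has_derivative_dirderiv df that)
  then have "smooth_on k U (dirderiv (\<lambda>x. f x + g x) h)" for h
    using Suc assms(1) smooth_on_cong[OF assms(1), of "dirderiv (\<lambda>x. f x + g x) h" "\<lambda>x. dirderiv f h x + dirderiv g h x" k]
    by (auto simp: smooth_on_Suc)
  then show ?case using assms(1) df by (auto simp: smooth_on_Suc intro!: derivative_intros)
qed

lemma smooth_on_mult:
  assumes "open U" "smooth_on k U f" "smooth_on k U g"
  shows "smooth_on k U (\<lambda>x. f x * g x)"
  using assms(2,3)
proof (induction k arbitrary: f g)
  case 0 then show ?case by (auto intro: continuous_intros)
next
  case (Suc k)
  have df: "f differentiable (at x)" "g differentiable (at x)" if "x \<in> U" for x
    using Suc.prems that assms(1) by (auto simp: smooth_on_Suc)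
  have "dirderiv (\<lambda>x. f x * g x) h x = f x * dirderiv g h x + dirderiv f h x * g x" if "x \<in> U" for h x
    by (rule dirderiv_eq) (auto intro!: derivative_eq_intros has_derivative_dirderiv df that)
  moreover have "smooth_on k U (\<lambda>x. f x * dirderiv g h x + dirderiv f h x * g x)" for h
    using Suc.prems[THEN smooth_on_SucD[OF assms(1)]] Suc.prems
    by (intro smooth_on_add[OF assms(1)] Suc.IH) (simp_all add: smooth_on_Suc[OF assms(1)])
  ultimately have "smooth_on k U (dirderiv (\<lambda>x. f x * g x) h)" for h
    using smooth_on_cong[OF assms(1), of "dirderiv (\<lambda>x. f x * g x) h" "\<lambda>x. f x * dirderiv g h x + dirderiv f h x * g x" k]
    by auto
  then show ?case using assms(1) df by (auto simp: smooth_on_Suc intro!: derivative_intros)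
qed

lemma smooth_on_sum:
  assumes "open U" "finite I" "\<And>i. i \<in> I \<Longrightarrow> smooth_on k U (f i)"
  shows "smooth_on k U (\<lambda>x. \<Sum>i\<in>I. f i x)"
  using assms(2,3)
proof (induction I rule: finite_induct)
  case empty then show ?case by (simp add: smooth_on_const assms(1))
next
  case (insert i I)
  then show ?case using smooth_on_add[OF assms(1), of k "f i" "\<lambda>x. \<Sum>i\<in>I. f i x"] by simp
qed

text \<open>\<open>C_k_on\<close> speaks of scalar functions, so the regularity of \<open>g\<close>
  is stated for its coordinates. By the chain rule a derivative of the composition is a sum of
  products, whose factors are covered by the induction hypothesis for \<open>f\<close> and by the
  regularity of the coordinates.\<close>

lemma smooth_on_compose:
  fixes g :: "'a::euclidean_space \<Rightarrow> 'b::euclidean_space"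
  assumes "open U" "open V" "g ` U \<subseteq> V"
    and "smooth_on k V f" "\<And>b. b \<in> Basis \<Longrightarrow> smooth_on k U (\<lambda>x. g x \<bullet> b)"
  shows "smooth_on k U (\<lambda>x. f (g x))"
  using assms(4,5)
proof (induction k arbitrary: f)
  case 0
  then have "continuous_on U g" by (subst continuous_on_componentwise) auto
  then show ?case using 0 assms(3) by (auto intro: continuous_on_compose2)
next
  case (Suc k)
  have df: "f differentiable (at x)" if "x \<in> V" for x
    using Suc.prems that assms(2) by (auto simp: smooth_on_Suc)
  have dgb: "(\<lambda>x. g x \<bullet> b) differentiable (at x)" if "x \<in> U" "b \<in> Basis" for x b
    using Suc.prems(2)[OF that(2)] that assms(1) by (auto simp: smooth_on_Suc)
  define g' where "g' x h = (\<Sum>b\<in>Basis. dirderiv (\<lambda>x. g x \<bullet> b) h x *\<^sub>R b)" for x h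
  have dg: "(g has_derivative g' x) (at x)" if "x \<in> U" for x
    unfolding g'_def
    by (subst has_derivative_componentwise_within)
       (use has_derivative_dirderiv[OF dgb[OF that]] in \<open>auto simp: inner_sum_left inner_Basis if_distrib cong: if_cong\<close>)
  have dfg: "((\<lambda>x. f (g x)) has_derivative (\<lambda>h. dirderiv f (g' x h) (g x))) (at x)" if "x \<in> U" for x
    using has_derivative_compose[OF dg[OF that] has_derivative_dirderiv[OF df]] assms(3) that by auto
  have "dirderiv (\<lambda>x. f (g x)) h x = (\<Sum>b\<in>Basis. dirderiv f b (g x) * dirderiv (\<lambda>x. g x \<bullet> b) h x)"
    if "x \<in> U" for x h
  proof -
    have l: "linear (\<lambda>h. dirderiv f h (g x))" using df assms(3) that by (intro linear_dirderiv) auto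
    have "dirderiv f (g' x h) (g x)
        = (\<Sum>b\<in>Basis. dirderiv f (dirderiv (\<lambda>x. g x \<bullet> b) h x *\<^sub>R b) (g x))"
      unfolding g'_def by (rule linear_sum[OF l])
    also have "\<dots> = (\<Sum>b\<in>Basis. dirderiv f b (g x) * dirderiv (\<lambda>x. g x \<bullet> b) h x)"
      by (intro sum.cong refl, subst linear_cmul[OF l]) (simp add: mult.commute)
    finally show ?thesis using dirderiv_eq[OF dfg[OF that]] by simp
  qed
  moreover have "smooth_on k U (\<lambda>x. \<Sum>b\<in>Basis. dirderiv f b (g x) * dirderiv (\<lambda>x. g x \<bullet> b) h x)" for h
  proof (rule smooth_on_sum[OF assms(1) finite_Basis])
    fix b :: 'b assume b: "b \<in> Basis"
    have f: "smooth_on k V (dirderiv f b)" using Suc.prems assms(2) by (simp add: smooth_on_Suc)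
    have g: "smooth_on k U (\<lambda>x. g x \<bullet> b')" if "b' \<in> Basis" for b'
      by (rule smooth_on_SucD[OF assms(1) Suc.prems(2)[OF that]])
    have "smooth_on k U (\<lambda>x. dirderiv f b (g x))"
      by (rule Suc.IH[OF f]) (rule g)
    moreover have "smooth_on k U (dirderiv (\<lambda>x. g x \<bullet> b) h)"
      using Suc.prems(2)[OF b] assms(1) by (simp add: smooth_on_Suc)
    ultimately show "smooth_on k U (\<lambda>x. dirderiv f b (g x) * dirderiv (\<lambda>x. g x \<bullet> b) h x)"
      by (rule smooth_on_mult[OF assms(1)])
  qed
  ultimately have "smooth_on k U (dirderiv (\<lambda>x. f (g x)) h)" for h
    using smooth_on_cong[OF assms(1), of "dirderiv (\<lambda>x. f (g x)) h"
        "\<lambda>x. \<Sum>b\<in>Basis. dirderiv f b (g x) * dirderiv (\<lambda>x. g x \<bullet> b) h x" k] by simp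
  then show ?case using assms(1) dfg by (auto simp: smooth_on_Suc differentiable_def)
qed

lemma smooth_on_affine:
  fixes L :: "'a::euclidean_space \<Rightarrow> 'b::euclidean_space"
  assumes "open U" "open V" "linear L" "smooth_on k V f" "\<And>x. x \<in> U \<Longrightarrow> a + L x \<in> V"
  shows "smooth_on k U (\<lambda>x. f (a + L x))"
proof (rule smooth_on_compose[OF assms(1,2) _ assms(4)])
  fix b :: "'b" assume "b \<in> Basis"
  have "linear (\<lambda>x. L x \<bullet> b)"
    using assms(3) by (auto simp: linear_iff inner_add_left)
  then show "smooth_on k U (\<lambda>x. (a + L x) \<bullet> b)"
    by (simp add: inner_add_left smooth_on_add smooth_on_const smooth_on_linear assms)
qed (use assms in auto)

text \<open>The derivative is a constant times the square of \<open>inverse\<close> itself, so the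
  induction closes under products.\<close>

lemma smooth_on_inverse: "smooth_on k {0<..} (inverse :: real \<Rightarrow> real)"
proof (induction k)
  case 0 then show ?case by (auto intro!: continuous_intros)
next
  case (Suc k)
  have d: "((inverse :: real \<Rightarrow> real) has_derivative (\<lambda>h. - (inverse x * h * inverse x))) (at x)" if "x > 0" for x :: real
    using that by (auto intro!: derivative_eq_intros)
  have "smooth_on k {0<..} (\<lambda>x::real. (- h) * (inverse x * inverse x))" for h
    by (intro smooth_on_mult smooth_on_const Suc) auto
  moreover have "dirderiv inverse h x = (- h) * (inverse x * inverse x)" if "x > 0" for h x :: real
    using dirderiv_eq[OF d[OF that]] by simp
  ultimately have "smooth_on k {0<..} (dirderiv (inverse :: real \<Rightarrow> real) h)" for h
    using smooth_on_cong[of "{0<..}" "dirderiv (inverse :: real \<Rightarrow> real) h"] by auto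
  then show ?case using d by (auto simp: smooth_on_Suc differentiable_def)
qed

lemma smooth_on_ln: "smooth_on k {0<..} (ln :: real \<Rightarrow> real)"
proof (cases k)
  case 0 then show ?thesis by (auto intro!: continuous_intros)
next
  case (Suc j)
  have d: "((ln :: real \<Rightarrow> real) has_derivative (\<lambda>h. h * inverse x)) (at x)" if "x > 0" for x :: real
    using that by (auto intro!: derivative_eq_intros simp: divide_inverse)
  have "smooth_on j {0<..} (\<lambda>x::real. h * inverse x)" for h
    by (intro smooth_on_mult smooth_on_const smooth_on_inverse) auto
  then have "smooth_on j {0<..} (dirderiv (ln :: real \<Rightarrow> real) h)" for h
    using smooth_on_cong[of "{0<..}" "dirderiv (ln :: real \<Rightarrow> real) h" "\<lambda>x. h * inverse x"] dirderiv_eq[OF d] by auto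
  then show ?thesis using d Suc by (auto simp: smooth_on_Suc differentiable_def)
qed

subsection \<open>Iterated derivatives\<close>

lemma DD_cong:
  assumes "open U" "\<And>y. y \<in> U \<Longrightarrow> f y = g y" "x \<in> U"
  shows "DD f hs x = DD g hs x"
  using assms(3)
proof (induction hs arbitrary: x)
  case Nil then show ?case using assms by simp
next
  case (Cons h hs) then show ?case by (auto intro!: dirderiv_cong[OF assms(1)])
qed

lemma smooth_on_DD:
  assumes "open U" "smooth_on (length hs + k) U f"
  shows "smooth_on k U (DD f hs)"
  using assms(2)
proof (induction hs arbitrary: k)
  case Nil then show ?case by simp
next
  case (Cons h hs)
  then have "smooth_on (Suc k) U (DD f hs)" by simp
  then show ?case using assms(1) by (simp add: smooth_on_Suc)
qed

lemma DD_differentiable: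
  assumes "open U" "smooth_on k U f" "length hs < k" "x \<in> U"
  shows "DD f hs differentiable (at x)"
proof -
  have "smooth_on (length hs + 1) U f" using smooth_on_mono[OF assms(1,2)] assms(3) by auto
  then have "smooth_on 1 U (DD f hs)" by (rule smooth_on_DD[OF assms(1)])
  then show ?thesis by (rule smooth_on_differentiable[OF assms(1)]) (use assms in auto)
qed

text \<open>Along every line both sides restrict to the same function of the parameter, so their
  iterated \<open>deriv\<close> agree even where \<open>deriv\<close> is a default value.\<close>

lemma DD_affine:
  assumes "linear L"
  shows "DD (\<lambda>x. f (a + L x)) hs x = DD f (map L hs) (a + L x)"
proof (induction hs arbitrary: x)
  case Nil then show ?case by simp
next
  case (Cons h hs)
  have "DD (\<lambda>x. f (a + L x)) hs (x + t *\<^sub>R h) = DD f (map L hs) ((a + L x) + t *\<^sub>R L h)" for t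
    using Cons assms by (simp add: linear_add linear_cmul add.assoc)
  then show ?case by (simp add: dirderiv_def)
qed

lemma DD_line:
  assumes "open U" "smooth_on k U f" "length hs < k" "x + t *\<^sub>R h \<in> U"
  shows "((\<lambda>s. DD f hs (x + s *\<^sub>R h)) has_real_derivative DD f (h # hs) (x + t *\<^sub>R h)) (at t)"
  using line_dirderiv[OF DD_differentiable[OF assms]] by simp

lemma DD_linear_hd:
  assumes "open U" "smooth_on k U f" "length hs < k" "x \<in> U"
  shows "linear (\<lambda>h. DD f (h # hs) x)"
  using linear_dirderiv[OF DD_differentiable[OF assms]] by simp

lemma DD_add:
  assumes "open U" "smooth_on (length hs) U f" "smooth_on (length hs) U g" "x \<in> U"
  shows "DD (\<lambda>x. f x + g x) hs x = DD f hs x + DD g hs x"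
  using assms(2-4)
proof (induction hs arbitrary: x)
  case Nil then show ?case by simp
next
  case (Cons h hs)
  have "smooth_on (length hs) U f" "smooth_on (length hs) U g"
    using Cons.prems by (auto intro: smooth_on_SucD[OF assms(1)])
  then have "dirderiv (DD (\<lambda>x. f x + g x) hs) h x = dirderiv (\<lambda>x. DD f hs x + DD g hs x) h x"
    using Cons by (intro dirderiv_cong[OF assms(1)]) auto
  also have "\<dots> = dirderiv (DD f hs) h x + dirderiv (DD g hs) h x"
    using Cons.prems
    by (intro dirderiv_eq) (auto intro!: derivative_eq_intros has_derivative_dirderiv DD_differentiable[OF assms(1)])
  finally show ?case by simp
qed

text \<open>The mean value theorem is applied in \<open>h\<close> and then in \<open>k\<close>. The
  second difference itself is symmetric in the two directions, which is the source of the symmetry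
  of second derivatives.\<close>

lemma second_difference:
  assumes U: "open U" "smooth_on 2 U f" and t: "0 < t"
    and sub: "\<And>a b. a \<in> {0..t} \<Longrightarrow> b \<in> {0..t} \<Longrightarrow> x + a *\<^sub>R h + b *\<^sub>R k \<in> U"
  obtains a b where "a \<in> {0..t}" "b \<in> {0..t}"
    "f (x + t *\<^sub>R h + t *\<^sub>R k) - f (x + t *\<^sub>R h) - f (x + t *\<^sub>R k) + f x
      = t\<^sup>2 * DD f [k, h] (x + a *\<^sub>R h + b *\<^sub>R k)"
proof -
  define p where "p a = f (x + a *\<^sub>R h + t *\<^sub>R k) - f (x + a *\<^sub>R h)" for a
  have "(p has_real_derivative DD f [h] (x + a *\<^sub>R h + t *\<^sub>R k) - DD f [h] (x + a *\<^sub>R h)) (at a)"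
    if "0 \<le> a" "a \<le> t" for a
  proof -
    have "((\<lambda>s. DD f [] ((x + t *\<^sub>R k) + s *\<^sub>R h)) has_real_derivative DD f [h] ((x + t *\<^sub>R k) + a *\<^sub>R h)) (at a)"
      using sub[of a t] that t by (intro DD_line[OF U]) (auto simp: algebra_simps)
    moreover have "((\<lambda>s. DD f [] (x + s *\<^sub>R h)) has_real_derivative DD f [h] (x + a *\<^sub>R h)) (at a)"
      using sub[of a 0] that t by (intro DD_line[OF U]) (auto simp: algebra_simps)
    ultimately show ?thesis unfolding p_def by (auto intro!: derivative_eq_intros simp: algebra_simps)
  qed
  from MVT2[OF t this] obtain a where a: "0 < a" "a < t"
    "p t - p 0 = t * (DD f [h] (x + a *\<^sub>R h + t *\<^sub>R k) - DD f [h] (x + a *\<^sub>R h))" by auto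
  have "((\<lambda>s. DD f [h] (x + a *\<^sub>R h + s *\<^sub>R k)) has_real_derivative DD f [k, h] (x + a *\<^sub>R h + b *\<^sub>R k)) (at b)"
    if "0 \<le> b" "b \<le> t" for b
    using sub[of a b] that a by (intro DD_line[OF U]) auto
  from MVT2[OF t this] obtain b where b: "0 < b" "b < t"
    "DD f [h] (x + a *\<^sub>R h + t *\<^sub>R k) - DD f [h] (x + a *\<^sub>R h) = t * DD f [k, h] (x + a *\<^sub>R h + b *\<^sub>R k)"
    by auto
  have "p t - p 0 = t\<^sup>2 * DD f [k, h] (x + a *\<^sub>R h + b *\<^sub>R k)"
    unfolding a(3) b(3) by (simp add: power2_eq_square)
  then show thesis using that[of a b] a b by (simp add: p_def)
qed

lemma DD_commute_2:
  assumes U: "open U" "smooth_on 2 U f" and x: "x \<in> U"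
  shows "DD f [h, k] x = DD f [k, h] x"
proof (rule ccontr)
  assume ne: "DD f [h, k] x \<noteq> DD f [k, h] x"
  define e where "e = \<bar>DD f [h, k] x - DD f [k, h] x\<bar> / 2"
  have e: "0 < e" using ne by (simp add: e_def)
  have c: "continuous_on U (DD f [h, k])" "continuous_on U (DD f [k, h])"
    using smooth_on_DD[OF U(1), of _ 0 f] U by (auto simp del: DD.simps simp: numeral_2_eq_2)
  obtain d0 where d0: "0 < d0" "ball x d0 \<subseteq> U" using U x openE by blast
  obtain d1 where d1: "0 < d1" "\<And>y. y \<in> U \<Longrightarrow> dist y x < d1 \<Longrightarrow> dist (DD f [h, k] y) (DD f [h, k] x) < e"
    using c(1) e x unfolding continuous_on_iff by meson
  obtain d2 where d2: "0 < d2" "\<And>y. y \<in> U \<Longrightarrow> dist y x < d2 \<Longrightarrow> dist (DD f [k, h] y) (DD f [k, h] x) < e"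
    using c(2) e x unfolding continuous_on_iff by meson
  define r where "r = min d0 (min d1 d2)"
  define N where "N = norm h + norm k + 1"
  \<comment> \<open>A parallelogram with this parameter range stays within \<open>r / 2\<close> of
    \<open>x\<close>, where both mixed derivatives deviate by less than \<open>e\<close> from their
    values at \<open>x\<close>.\<close>
  define t where "t = r / 2 / N"
  have r: "0 < r" using d0 d1 d2 by (simp add: r_def)
  have n: "0 < N" by (simp add: N_def add_nonneg_pos)
  have t: "0 < t" using r n by (simp add: t_def)
  have near: "dist (x + a *\<^sub>R h + b *\<^sub>R k) x < r" if "a \<in> {0..t}" "b \<in> {0..t}" for a b
  proof -
    have "dist (x + a *\<^sub>R h + b *\<^sub>R k) x \<le> a * norm h + b * norm k"
      using that norm_triangle_ineq[of "a *\<^sub>R h" "b *\<^sub>R k"] by (simp add: dist_norm add.assoc)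
    also have "\<dots> \<le> t * norm h + t * norm k" using that by (intro add_mono mult_right_mono) auto
    also have "\<dots> \<le> t * N" using t by (simp add: N_def algebra_simps)
    also have "\<dots> = r / 2" using n by (simp add: t_def)
    also have "\<dots> < r" using r by simp
    finally show ?thesis .
  qed
  have sub: "x + a *\<^sub>R h + b *\<^sub>R k \<in> U" if "a \<in> {0..t}" "b \<in> {0..t}" for a b
    using near[OF that] d0 by (auto simp: r_def dist_commute subset_iff)
  obtain a b where 1: "a \<in> {0..t}" "b \<in> {0..t}"
    "f (x + t *\<^sub>R h + t *\<^sub>R k) - f (x + t *\<^sub>R h) - f (x + t *\<^sub>R k) + f x
      = t\<^sup>2 * DD f [k, h] (x + a *\<^sub>R h + b *\<^sub>R k)"
    using second_difference[OF U t sub] by blast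
  have sub': "x + b *\<^sub>R k + a *\<^sub>R h \<in> U" if "a \<in> {0..t}" "b \<in> {0..t}" for a b
    using sub[OF that] by (simp add: algebra_simps)
  obtain a' b' where 2: "a' \<in> {0..t}" "b' \<in> {0..t}"
    "f (x + t *\<^sub>R k + t *\<^sub>R h) - f (x + t *\<^sub>R k) - f (x + t *\<^sub>R h) + f x
      = t\<^sup>2 * DD f [h, k] (x + a' *\<^sub>R k + b' *\<^sub>R h)"
    using second_difference[OF U t sub'] by blast
  have eq: "DD f [k, h] (x + a *\<^sub>R h + b *\<^sub>R k) = DD f [h, k] (x + b' *\<^sub>R h + a' *\<^sub>R k)"
    using 1(3) 2(3) t by (simp add: algebra_simps)
  have "dist (DD f [k, h] (x + a *\<^sub>R h + b *\<^sub>R k)) (DD f [k, h] x) < e"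
    using d2(2)[OF sub[OF 1(1,2)]] near[OF 1(1,2)] by (simp add: r_def)
  moreover have "dist (DD f [h, k] (x + b' *\<^sub>R h + a' *\<^sub>R k)) (DD f [h, k] x) < e"
    using d1(2)[OF sub[OF 2(2,1)]] near[OF 2(2,1)] by (simp add: r_def)
  ultimately have "\<bar>DD f [h, k] x - DD f [k, h] x\<bar> < 2 * e"
    using eq unfolding dist_real_def by linarith
  then show False by (simp add: e_def)
qed

lemma DD_swap:
  assumes "open U" "smooth_on (Suc (Suc (length hs))) U f" "x \<in> U"
  shows "DD f (h # k # hs) x = DD f (k # h # hs) x"
proof -
  have "smooth_on 2 U (DD f hs)"
    using smooth_on_DD[OF assms(1), of hs 2 f] assms(2) by simp
  from DD_commute_2[OF assms(1) this assms(3), of h k] show ?thesis by simp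
qed

lemma DD_Cons_cong:
  assumes "open U" "\<And>y. y \<in> U \<Longrightarrow> DD f hs y = DD f hs' y" "x \<in> U"
  shows "DD f (h # hs) x = DD f (h # hs') x"
  using dirderiv_cong[OF assms(1,3,2)] by simp

lemma DD_move:
  assumes "open U" "smooth_on (Suc (length hs + length ks)) U f" "x \<in> U"
  shows "DD f (hs @ h # ks) x = DD f (h # hs @ ks) x"
  using assms(2,3)
proof (induction hs arbitrary: x)
  case Nil then show ?case by simp
next
  case (Cons a hs)
  have "DD f ((a # hs) @ h # ks) x = DD f (a # h # hs @ ks) x"
    unfolding append_Cons
  proof (rule DD_Cons_cong[OF assms(1) _ Cons.prems(2)])
    fix y assume y: "y \<in> U"
    have "smooth_on (Suc (length hs + length ks)) U f"
      by (rule smooth_on_SucD[OF assms(1)]) (use Cons.prems in simp)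
    from Cons.IH[OF this y] show "DD f (hs @ h # ks) y = DD f (h # hs @ ks) y" .
  qed
  also have "\<dots> = DD f (h # a # hs @ ks) x"
    by (rule DD_swap[OF assms(1) _ Cons.prems(2)]) (use Cons.prems in simp)
  finally show ?case by simp
qed

text \<open>Induction on the first list: its head occurs somewhere in the second list, and
  \<open>DD_move\<close> brings it to the front there.\<close>

lemma DD_perm:
  assumes "open U" "smooth_on (length hs) U f" "x \<in> U" "mset hs = mset ks"
  shows "DD f hs x = DD f ks x"
  using assms(2-4)
proof (induction hs arbitrary: ks x)
  case Nil then show ?case by simp
next
  case (Cons h hs)
  then obtain k1 k2 where ks: "ks = k1 @ h # k2" by (metis list.set_intros(1) set_mset_mset split_list)
  have m: "mset hs = mset (k1 @ k2)" using Cons.prems ks by simp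
  have l: "length hs = length k1 + length k2" using mset_eq_length[OF m] by simp
  have "DD f (h # hs) x = DD f (h # k1 @ k2) x"
    by (rule DD_Cons_cong[OF assms(1) Cons.IH[OF _ _ m]])
       (use Cons.prems in \<open>auto intro: smooth_on_SucD[OF assms(1)]\<close>)
  also have "\<dots> = DD f (k1 @ h # k2) x"
    by (rule DD_move[OF assms(1) _ Cons.prems(2), symmetric]) (use Cons.prems l in simp)
  finally show ?case using ks by simp
qed

lemma DD_linear:
  assumes "open U" "smooth_on (Suc (length hs + length ks)) U f" "x \<in> U"
  shows "linear (\<lambda>h. DD f (hs @ h # ks) x)"
proof -
  have "linear (\<lambda>h. DD f (h # (hs @ ks)) x)"
    by (rule DD_linear_hd[OF assms(1,2) _ assms(3)]) simp
  then show ?thesis unfolding DD_move[OF assms] .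
qed

text \<open>Serves to compute derivatives along a line one order at a time. The formula for the
  lower order is known only at parameters whose point lies in \<open>U\<close>; as \<open>U\<close>
  is open, this determines the next derivative.\<close>

lemma DD_line_unique:
  assumes "open U" "x \<in> U"
    and "\<And>t. x + t *\<^sub>R h \<in> U \<Longrightarrow> DD f hs (x + t *\<^sub>R h) = g t"
    and "\<And>t. x + t *\<^sub>R h \<in> U \<Longrightarrow> (g has_real_derivative g' t) (at t)"
    and "x + t *\<^sub>R h \<in> U"
  shows "DD f (h # hs) (x + t *\<^sub>R h) = g' t"
proof -
  have "DD f (h # hs) (x + t *\<^sub>R h) = deriv (\<lambda>s. DD f hs (x + (t + s) *\<^sub>R h)) 0"
    by (simp add: dirderiv_def scaleR_add_left add.assoc)
  also have "\<dots> = deriv (\<lambda>s. g (t + s)) 0"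
  proof (rule deriv_cong_ev)
    have "((\<lambda>s::real. x + (t + s) *\<^sub>R h) \<longlongrightarrow> x + (t + 0) *\<^sub>R h) (nhds 0)"
      by (intro tendsto_intros filterlim_ident)
    then have "\<forall>\<^sub>F s in nhds (0::real). x + (t + s) *\<^sub>R h \<in> U"
      by (rule topological_tendstoD) (use assms in simp_all)
    then show "\<forall>\<^sub>F s in nhds 0. DD f hs (x + (t + s) *\<^sub>R h) = g (t + s)"
      by (rule eventually_mono) (use assms in auto)
  qed simp
  also have "\<dots> = g' t"
    using assms(4)[OF assms(5)] DERIV_shift[of g "g' t" 0 t]
    by (intro DERIV_imp_deriv) (simp add: add.commute)
  finally show ?thesis .
qed

subsection \<open>The scalar functions\<close>

lemma omega_0 [simp]: "omega 0 = 0" and omega_star_0 [simp]: "omega_star 0 = 0"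
  by (simp_all add: omega_def omega_star_def)

lemma DERIV_omega: "0 \<le> t \<Longrightarrow> (omega has_real_derivative t / (1 + t)) (at t)"
  unfolding omega_def [abs_def] by (auto intro!: derivative_eq_intros simp: field_simps)

lemma DERIV_omega_star: "t < 1 \<Longrightarrow> (omega_star has_real_derivative t / (1 - t)) (at t)"
  unfolding omega_star_def [abs_def] by (auto intro!: derivative_eq_intros simp: field_simps)

lemma omega_strict_mono:
  assumes "0 \<le> s" "s < t"
  shows "omega s < omega t"
proof -
  have "(omega has_real_derivative x / (1 + x)) (at x)" if "s \<le> x" "x \<le> t" for x
    using that assms by (intro DERIV_omega) auto
  from MVT2[OF assms(2) this] obtain z where z: "s < z" "omega t - omega s = (t - s) * (z / (1 + z))"
    by auto
  then show ?thesis using assms by (smt (verit) divide_pos_pos mult_pos_pos)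
qed

lemma omega_star_strict_mono:
  assumes "0 \<le> s" "s < t" "t < 1"
  shows "omega_star s < omega_star t"
proof -
  have "(omega_star has_real_derivative x / (1 - x)) (at x)" if "s \<le> x" "x \<le> t" for x
    using that assms by (intro DERIV_omega_star) auto
  from MVT2[OF assms(2) this] obtain z where z: "s < z" "z < t" "omega_star t - omega_star s = (t - s) * (z / (1 - z))"
    by auto
  then show ?thesis using assms by (smt (verit) divide_pos_pos mult_pos_pos)
qed

lemma omega_le_iff: "0 \<le> s \<Longrightarrow> 0 \<le> t \<Longrightarrow> omega s \<le> omega t \<longleftrightarrow> s \<le> t"
  using omega_strict_mono[of s t] omega_strict_mono[of t s] by (cases s t rule: linorder_cases) auto

lemma omega_star_le_iff: "0 \<le> s \<Longrightarrow> 0 \<le> t \<Longrightarrow> s < 1 \<Longrightarrow> t < 1 \<Longrightarrow> omega_star s \<le> omega_star t \<longleftrightarrow> s \<le> t"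
  using omega_star_strict_mono[of s t] omega_star_strict_mono[of t s] by (cases s t rule: linorder_cases) auto

text \<open>Since \<open>omega 1 = 1 - ln 2\<close>, the upper bound on \<open>b\<close> is exactly
  what keeps the inverse below 1, the radius within which Hessians can be compared.\<close>

lemma omega_inv_props:
  assumes "0 < b" "b < 1 - ln 2"
  shows "0 < omega_inv b" "omega_inv b < 1" "omega (omega_inv b) = b"
proof -
  have "continuous_on {0..1} omega"
    by (intro continuous_at_imp_continuous_on ballI DERIV_isCont[OF DERIV_omega]) auto
  moreover have "omega 0 \<le> b" "b \<le> omega 1" using assms by (simp_all add: omega_def)
  ultimately obtain t where t: "0 \<le> t" "t \<le> 1" "omega t = b"
    using IVT'[of omega 0 b 1] by auto
  have "inj_on omega {0..}"
    by (intro inj_onI) (metis atLeast_iff omega_strict_mono linorder_neqE_linordered_idom order_less_irrefl)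
  then have eq: "omega_inv b = t"
    using t by (auto simp: omega_inv_def intro!: the_inv_into_f_eq)
  have "t \<noteq> 0" "t \<noteq> 1" using t(3) assms by (auto simp: omega_def)
  then show "0 < omega_inv b" "omega_inv b < 1" "omega (omega_inv b) = b"
    using eq t by auto
qed

lemma omega_star_inv_props:
  assumes "0 \<le> b"
  shows "0 \<le> omega_star_inv b" "omega_star_inv b < 1" "omega_star (omega_star_inv b) = b"
proof -
  \<comment> \<open>Chosen such that \<open>omega_star T = b + exp (- (b + 1))\<close>, which
    exceeds \<open>b\<close>.\<close>
  define T where "T = 1 - exp (- (b + 1))"
  have T: "0 \<le> T" "T < 1" using assms by (auto simp: T_def)
  have "continuous_on {0..T} omega_star"
    using T by (intro continuous_at_imp_continuous_on ballI DERIV_isCont[OF DERIV_omega_star]) auto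
  moreover have "omega_star 0 \<le> b" "b \<le> omega_star T" using assms by (simp_all add: omega_star_def T_def)
  ultimately obtain t where t: "0 \<le> t" "t \<le> T" "omega_star t = b"
    using IVT'[of omega_star 0 b T] T by auto
  have "inj_on omega_star {0..<1}"
    by (intro inj_onI) (metis atLeastLessThan_iff omega_star_strict_mono linorder_neqE_linordered_idom order_less_irrefl)
  then have eq: "omega_star_inv b = t"
    using t T by (auto simp: omega_star_inv_def intro!: the_inv_into_f_eq)
  then show "0 \<le> omega_star_inv b" "omega_star_inv b < 1" "omega_star (omega_star_inv b) = b"
    using t T by auto
qed

subsection \<open>Binary quadratic and cubic forms\<close>

lemma quadratic_form_disc:
  fixes a b c :: real
  assumes "\<And>x y. 0 \<le> x\<^sup>2 * a + 2 * x * y * b + y\<^sup>2 * c"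
  shows "b\<^sup>2 \<le> a * c"
proof (cases "a = 0")
  case True
  \<comment> \<open>The form at \<open>x = - (c + 1)\<close>, \<open>y = b\<close> equals
    \<open>- b\<^sup>2 * (c + 2)\<close>, which forces \<open>b = 0\<close>.\<close>
  have "0 \<le> 2 * (- (c + 1)) * b * b + b\<^sup>2 * c" using assms[of "- (c + 1)" b] True by simp
  moreover have "0 \<le> c" using assms[of 0 1] by simp
  ultimately have "b\<^sup>2 * (c + 2) \<le> 0" by (simp add: power2_eq_square algebra_simps)
  then have "b\<^sup>2 \<le> 0" using \<open>0 \<le> c\<close> by (simp add: mult_le_0_iff)
  then show ?thesis using True by simp
next
  case False
  have "0 \<le> a" using assms[of 1 0] by simp
  moreover have "0 \<le> b\<^sup>2 * a + 2 * b * (- a) * b + a\<^sup>2 * c" using assms[of b "- a"] by simp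
  then have "0 \<le> a * (a * c - b\<^sup>2)" by (simp add: power2_eq_square algebra_simps)
  ultimately show ?thesis using False by (simp add: zero_le_mult_iff)
qed

text \<open>
  The symmetric tensor \<open>h \<otimes> h \<otimes> k\<close> of two unit vectors of the plane at angle \<open>3\<psi>\<close> is the convex
  combination of the cubes of the unit vectors at the angles \<open>\<psi> + 2\<pi>j/3\<close> from \<open>h\<close>, with the weights
  \<open>((4 cos\<^sup>2 - 1)/3)\<^sup>2\<close>.
\<close>

lemma cubic_form_polar_bound:
  fixes A B C D :: real
  assumes p: "\<And>c s. c\<^sup>2 + s\<^sup>2 = 1 \<Longrightarrow> \<bar>A * c^3 + 3 * B * c\<^sup>2 * s + 3 * C * c * s\<^sup>2 + D * s^3\<bar> \<le> M"
    and cs: "c\<^sup>2 + s\<^sup>2 = 1"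
  shows "\<bar>A * c + B * s\<bar> \<le> M"
proof -
  obtain \<theta> where \<theta>: "c = cos \<theta>" "s = sin \<theta>" using sincos_total_2pi[OF cs] by metis
  define u where "u = cos (\<theta> / 3)"
  define v where "v = sin (\<theta> / 3)"
  define r where "r = sqrt 3"
  have r: "r\<^sup>2 = 3" by (simp add: r_def)
  have uv: "u\<^sup>2 + v\<^sup>2 = 1" by (simp add: u_def v_def)
  have c: "c = u^3 - 3 * u * v\<^sup>2" and s: "s = 3 * u\<^sup>2 * v - v^3"
  proof -
    have "cos (\<theta>/3 + (\<theta>/3 + \<theta>/3)) = u^3 - 3 * u * v\<^sup>2"
      unfolding cos_add sin_add u_def v_def by (simp add: power2_eq_square power3_eq_cube algebra_simps)
    moreover have "sin (\<theta>/3 + (\<theta>/3 + \<theta>/3)) = 3 * u\<^sup>2 * v - v^3"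
      unfolding cos_add sin_add u_def v_def by (simp add: power2_eq_square power3_eq_cube algebra_simps)
    ultimately show "c = u^3 - 3 * u * v\<^sup>2" "s = 3 * u\<^sup>2 * v - v^3" using \<theta> by simp_all
  qed
  \<comment> \<open>In half coordinates the rotations of \<open>(u, v)\<close> by the angles
    2\<pi>/3 and 4\<pi>/3 have coefficients 1 and \<open>r\<close>. With the weight in the
    homogeneous form \<open>(3 * c\<^sup>2 - s\<^sup>2)\<^sup>2 / 9\<close> all moment identities
    are polynomial in \<open>x\<close>, \<open>y\<close>, \<open>r\<close> modulo
    \<open>r * r = 3\<close>.\<close>
  define x where "x = u / 2"
  define y where "y = v / 2"
  have xy: "u = 2 * x" "v = 2 * y" by (simp_all add: x_def y_def)
  define u1 where "u1 = - x - r * y"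
  define v1 where "v1 = r * x - y"
  define u2 where "u2 = r * y - x"
  define v2 where "v2 = - r * x - y"
  define P where "P c s = A * c^3 + 3 * B * c\<^sup>2 * s + 3 * C * c * s\<^sup>2 + D * s^3" for c s
  define V where "V c s = (3 * c\<^sup>2 - s\<^sup>2)\<^sup>2" for c s :: real
  define W where "W c s = V c s / 9" for c s
  have rr: "r * r = 3" "r * (r * z) = 3 * z" for z
    using r by (simp_all add: power2_eq_square mult.assoc[symmetric])
  have "3 * u1\<^sup>2 - v1\<^sup>2 = 8 * y * (r * x + y)" "3 * u2\<^sup>2 - v2\<^sup>2 = 8 * y * (y - r * x)"
    unfolding u1_def v1_def u2_def v2_def by (simp_all add: power2_eq_square algebra_simps rr)
  then have V1: "V u1 v1 = 64 * y\<^sup>2 * (r * x + y)\<^sup>2" and V2: "V u2 v2 = 64 * y\<^sup>2 * (y - r * x)\<^sup>2"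
    by (simp_all add: V_def power_mult_distrib)
  have V0: "V u v = 16 * (3 * x\<^sup>2 - y\<^sup>2)\<^sup>2"
    unfolding V_def xy by (simp add: power2_eq_square algebra_simps)
  have "u1\<^sup>2 + v1\<^sup>2 = (1 + r\<^sup>2) * (x\<^sup>2 + y\<^sup>2)" "u2\<^sup>2 + v2\<^sup>2 = (1 + r\<^sup>2) * (x\<^sup>2 + y\<^sup>2)"
    unfolding u1_def v1_def u2_def v2_def by (simp_all add: power2_eq_square algebra_simps)
  then have uv1: "u1\<^sup>2 + v1\<^sup>2 = 1" and uv2: "u2\<^sup>2 + v2\<^sup>2 = 1"
    using r uv xy by (simp_all add: power_mult_distrib)
  have W: "W u v + W u1 v1 + W u2 v2 = 1"
  proof -
    have "V u v + V u1 v1 + V u2 v2 = 9 * (u\<^sup>2 + v\<^sup>2)\<^sup>2"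
      unfolding V1 V2 V0 unfolding u1_def v1_def u2_def v2_def xy
    by (simp add: power2_eq_square power3_eq_cube algebra_simps rr)
    then show ?thesis using uv by (simp add: W_def)
  qed
  have "V u v * u^3 + V u1 v1 * u1^3 + V u2 v2 * u2^3 = 9 * (u^3 - 3 * u * v\<^sup>2) * (u\<^sup>2 + v\<^sup>2)\<^sup>2"
    unfolding V1 V2 V0 unfolding u1_def v1_def u2_def v2_def xy
    by (simp add: power2_eq_square power3_eq_cube algebra_simps rr)
  then have cube: "W u v * u^3 + W u1 v1 * u1^3 + W u2 v2 * u2^3 = u^3 - 3 * u * v\<^sup>2"
    unfolding uv W_def by simp
  have "3 * (V u v * (u\<^sup>2 * v) + V u1 v1 * (u1\<^sup>2 * v1) + V u2 v2 * (u2\<^sup>2 * v2)) = 9 * (3 * u\<^sup>2 * v - v^3) * (u\<^sup>2 + v\<^sup>2)\<^sup>2"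
    unfolding V1 V2 V0 unfolding u1_def v1_def u2_def v2_def xy
    by (simp add: power2_eq_square power3_eq_cube algebra_simps rr)
  then have sq: "3 * (W u v * (u\<^sup>2 * v) + W u1 v1 * (u1\<^sup>2 * v1) + W u2 v2 * (u2\<^sup>2 * v2)) = 3 * u\<^sup>2 * v - v^3"
    unfolding uv W_def by (simp add: field_simps)
  have "V u v * (u * v\<^sup>2) + V u1 v1 * (u1 * v1\<^sup>2) + V u2 v2 * (u2 * v2\<^sup>2) = 0"
    unfolding V1 V2 V0 unfolding u1_def v1_def u2_def v2_def xy
    by (simp add: power2_eq_square power3_eq_cube algebra_simps rr)
  then have li: "W u v * (u * v\<^sup>2) + W u1 v1 * (u1 * v1\<^sup>2) + W u2 v2 * (u2 * v2\<^sup>2) = 0"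
    unfolding W_def by simp
  have "V u v * v^3 + V u1 v1 * v1^3 + V u2 v2 * v2^3 = 0"
    unfolding V1 V2 V0 unfolding u1_def v1_def u2_def v2_def xy
    by (simp add: power2_eq_square power3_eq_cube algebra_simps rr)
  then have co: "W u v * v^3 + W u1 v1 * v1^3 + W u2 v2 * v2^3 = 0"
    unfolding W_def by simp
  have "W u v * P u v + W u1 v1 * P u1 v1 + W u2 v2 * P u2 v2
      = A * (W u v * u^3 + W u1 v1 * u1^3 + W u2 v2 * u2^3)
      + B * (3 * (W u v * (u\<^sup>2 * v) + W u1 v1 * (u1\<^sup>2 * v1) + W u2 v2 * (u2\<^sup>2 * v2)))
      + 3 * C * (W u v * (u * v\<^sup>2) + W u1 v1 * (u1 * v1\<^sup>2) + W u2 v2 * (u2 * v2\<^sup>2))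
      + D * (W u v * v^3 + W u1 v1 * v1^3 + W u2 v2 * v2^3)"
    unfolding P_def by (simp add: algebra_simps)
  also have "\<dots> = A * c + B * s" unfolding cube sq li co c s by simp
  finally have eq: "A * c + B * s = W u v * P u v + W u1 v1 * P u1 v1 + W u2 v2 * P u2 v2" by simp
  have Wn: "0 \<le> W c s" for c s by (simp add: W_def V_def)
  have "\<bar>A * c + B * s\<bar> \<le> \<bar>W u v * P u v\<bar> + \<bar>W u1 v1 * P u1 v1\<bar> + \<bar>W u2 v2 * P u2 v2\<bar>"
    unfolding eq by linarith
  also have "\<dots> = W u v * \<bar>P u v\<bar> + W u1 v1 * \<bar>P u1 v1\<bar> + W u2 v2 * \<bar>P u2 v2\<bar>"
    by (simp add: abs_mult Wn)
  also have "\<dots> \<le> W u v * M + W u1 v1 * M + W u2 v2 * M"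
    using p[OF uv] p[OF uv1] p[OF uv2] unfolding P_def by (intro add_mono mult_left_mono Wn)
  also have "\<dots> = M" using W by (simp add: distrib_right[symmetric])
  finally show ?thesis .
qed

text \<open>Gram-Schmidt: take a basis orthonormal for the quadratic form, with the normalised
  second coordinate vector as first axis. Up to scaling, \<open>T2\<close> is then the value of the
  cubic tensor at two copies of the first axis and one further unit vector, which
  \<open>cubic_form_polar_bound\<close> controls.\<close>

lemma cubic_form_mixed_bound_pos:
  fixes T0 T1 T2 T3 Q0 Q1 Q2 :: real
  assumes pos: "0 < Q2" "Q1\<^sup>2 < Q0 * Q2"
    and T: "\<And>x y. \<bar>x^3 * T0 + 3 * x\<^sup>2 * y * T1 + 3 * x * y\<^sup>2 * T2 + y^3 * T3\<bar>
        \<le> 2 * (sqrt (x\<^sup>2 * Q0 + 2 * x * y * Q1 + y\<^sup>2 * Q2))^3"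
  shows "\<bar>T2\<bar> \<le> 2 * sqrt Q0 * Q2"
proof -
  define m where "m = Q1 / Q2"
  define a where "a = sqrt Q2"
  define w where "w = sqrt (Q0 - m * Q1)"
  define n where "n = sqrt Q0"
  have w0: "0 < Q0 - m * Q1" using pos by (simp add: m_def field_simps power2_eq_square)
  have a: "0 < a" "a\<^sup>2 = Q2" and w: "0 < w" "w\<^sup>2 = Q0 - m * Q1" using pos w0 by (simp_all add: a_def w_def)
  have Q1: "Q1 = m * a\<^sup>2" using pos a by (simp add: m_def)
  have "0 < Q0" using w0 Q1 a by (smt (verit) zero_le_power2 mult.assoc mult.commute power2_eq_square zero_le_mult_iff)
  then have n: "0 < n" "n\<^sup>2 = Q0" by (simp_all add: n_def)
  define i where "i = 1 / w"
  define j where "j = 1 / a"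
  define l where "l = m / w"
  have iw: "i * w = 1" and ja: "j * a = 1" and l: "l = m * i" using w a by (simp_all add: i_def j_def l_def)
  \<comment> \<open>\<open>A\<close>, \<open>B\<close>, \<open>C\<close>, \<open>D\<close> are the
    coefficients of the cubic form after the substitution \<open>x = s * i\<close>,
    \<open>y = c * j - s * l\<close>, which turns the quadratic form into
    \<open>c\<^sup>2 + s\<^sup>2\<close>.\<close>
  define A where "A = T3 * j^3"
  define B where "B = T2 * i * j\<^sup>2 - T3 * j\<^sup>2 * l"
  define C where "C = T1 * i\<^sup>2 * j - 2 * T2 * i * j * l + T3 * j * l\<^sup>2"
  define D where "D = T0 * i^3 - 3 * T1 * i\<^sup>2 * l + 3 * T2 * i * l\<^sup>2 - T3 * l^3"
  have P: "\<bar>A * c^3 + 3 * B * c\<^sup>2 * s + 3 * C * c * s\<^sup>2 + D * s^3\<bar> \<le> 2" if cs: "c\<^sup>2 + s\<^sup>2 = 1" for c s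
  proof -
    have "A * c^3 + 3 * B * c\<^sup>2 * s + 3 * C * c * s\<^sup>2 + D * s^3 =
      (s * i)^3 * T0 + 3 * (s * i)\<^sup>2 * (c * j - s * l) * T1 + 3 * (s * i) * (c * j - s * l)\<^sup>2 * T2 + (c * j - s * l)^3 * T3"
      unfolding A_def B_def C_def D_def by algebra
    moreover have "(s * i)\<^sup>2 * Q0 + 2 * (s * i) * (c * j - s * l) * Q1 + (c * j - s * l)\<^sup>2 * Q2 = 1"
      using w(2) a(2) Q1 iw ja l cs by algebra
    ultimately show ?thesis using T[of "s * i" "c * j - s * l"] by simp
  qed
  \<comment> \<open>The first coordinate vector has the new coordinates \<open>(m * a, w)\<close>
    and the norm \<open>n\<close>.\<close>
  have cs: "(m * a / n)\<^sup>2 + (w / n)\<^sup>2 = 1"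
  proof -
    have "(m * a)\<^sup>2 + w\<^sup>2 = n\<^sup>2" using w(2) n(2) Q1 by (simp add: power2_eq_square)
    then show ?thesis using n(1) by (simp add: power_divide add_divide_distrib[symmetric])
  qed
  have "\<bar>A * (m * a / n) + B * (w / n)\<bar> \<le> 2" by (rule cubic_form_polar_bound[OF P cs])
  moreover have "A * (m * a / n) + B * (w / n) = T2 / (n * a\<^sup>2)"
    using a(1) w(1) n(1) unfolding A_def B_def i_def j_def l_def
    by (simp add: field_simps power2_eq_square power3_eq_cube)
  ultimately have "\<bar>T2\<bar> / (n * a\<^sup>2) \<le> 2" using n(1) a(1) by simp
  then have "\<bar>T2\<bar> \<le> 2 * (n * a\<^sup>2)" using n(1) a(1) by (simp add: divide_le_eq)
  then show ?thesis using a(2) by (simp add: n_def)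
qed

text \<open>A degenerate quadratic form is made definite by adding \<open>e\<close> to both diagonal
  coefficients. This only enlarges the right side of the cubic bound; then \<open>e\<close> tends to
  0.\<close>

lemma cubic_form_mixed_bound:
  fixes T0 T1 T2 T3 Q0 Q1 Q2 :: real
  assumes pos: "\<And>x y. 0 \<le> x\<^sup>2 * Q0 + 2 * x * y * Q1 + y\<^sup>2 * Q2"
    and T: "\<And>x y. \<bar>x^3 * T0 + 3 * x\<^sup>2 * y * T1 + 3 * x * y\<^sup>2 * T2 + y^3 * T3\<bar>
        \<le> 2 * (sqrt (x\<^sup>2 * Q0 + 2 * x * y * Q1 + y\<^sup>2 * Q2))^3"
  shows "\<bar>T2\<bar> \<le> 2 * sqrt Q0 * Q2"
proof -
  have Q: "0 \<le> Q0" "0 \<le> Q2" using pos[of 1 0] pos[of 0 1] by simp_all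
  have disc: "Q1\<^sup>2 \<le> Q0 * Q2" by (rule quadratic_form_disc[OF pos])
  have "\<bar>T2\<bar> \<le> 2 * sqrt (Q0 + e) * (Q2 + e)" if "0 < e" for e
  proof (rule cubic_form_mixed_bound_pos[where ?Q1.0=Q1 and ?T0.0=T0 and ?T1.0=T1 and ?T3.0=T3])
    have "0 < e * e" "0 \<le> e * Q0" "0 \<le> e * Q2" using Q that by simp_all
    then have "Q0 * Q2 < (Q0 + e) * (Q2 + e)" by (simp add: algebra_simps)
    then show "Q1\<^sup>2 < (Q0 + e) * (Q2 + e)" using disc by simp
    fix x y
    have "x\<^sup>2 * Q0 + 2 * x * y * Q1 + y\<^sup>2 * Q2 \<le> x\<^sup>2 * (Q0 + e) + 2 * x * y * Q1 + y\<^sup>2 * (Q2 + e)"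
      using that by (simp add: algebra_simps)
    then have "2 * (sqrt (x\<^sup>2 * Q0 + 2 * x * y * Q1 + y\<^sup>2 * Q2))^3
        \<le> 2 * (sqrt (x\<^sup>2 * (Q0 + e) + 2 * x * y * Q1 + y\<^sup>2 * (Q2 + e)))^3"
      using pos[of x y] by (intro mult_left_mono power_mono) auto
    then show "\<bar>x^3 * T0 + 3 * x\<^sup>2 * y * T1 + 3 * x * y\<^sup>2 * T2 + y^3 * T3\<bar>
        \<le> 2 * (sqrt (x\<^sup>2 * (Q0 + e) + 2 * x * y * Q1 + y\<^sup>2 * (Q2 + e)))^3"
      using T[of x y] by linarith
  qed (use Q that in simp)
  moreover have "((\<lambda>e. 2 * sqrt (Q0 + e) * (Q2 + e)) \<longlongrightarrow> 2 * sqrt (Q0 + 0) * (Q2 + 0)) (at_right 0)"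
    by (intro tendsto_intros)
  ultimately show ?thesis
    by (intro tendsto_lowerbound[where F="at_right 0" and f="\<lambda>e. 2 * sqrt (Q0 + e) * (Q2 + e)"])
       (auto simp: eventually_at_right_field intro!: exI[of _ 1])
qed

subsection \<open>Differential inequalities of one variable\<close>

lemma DERIV_nonneg_imp_le:
  fixes f f' :: "real \<Rightarrow> real"
  assumes "a \<le> b" "\<And>t. a \<le> t \<Longrightarrow> t \<le> b \<Longrightarrow> (f has_real_derivative f' t) (at t)"
    and "\<And>t. a \<le> t \<Longrightarrow> t \<le> b \<Longrightarrow> 0 \<le> f' t"
  shows "f a \<le> f b"
  using DERIV_nonneg_imp_nondecreasing[OF assms(1), of f] assms(2,3) by blast

text \<open>The bound on \<open>q'\<close> says that \<open>inverse (sqrt q)\<close> has slope at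
  most 1 in absolute value. Adding \<open>e\<close> to \<open>q\<close> avoids its zeros, and the
  conclusion is cleared of denominators so that it survives the limit.\<close>

lemma sqrt_growth:
  fixes q q' :: "real \<Rightarrow> real"
  assumes ab: "a \<le> b"
    and d: "\<And>t. a \<le> t \<Longrightarrow> t \<le> b \<Longrightarrow> (q has_real_derivative q' t) (at t)"
    and q: "\<And>t. a \<le> t \<Longrightarrow> t \<le> b \<Longrightarrow> 0 \<le> q t"
    and q': "\<And>t. a \<le> t \<Longrightarrow> t \<le> b \<Longrightarrow> \<bar>q' t\<bar> \<le> 2 * (sqrt (q t))^3"
  shows "\<bar>sqrt (q b) - sqrt (q a)\<bar> \<le> (b - a) * sqrt (q a) * sqrt (q b)"
proof -
  have eps: "\<bar>sqrt (q b + e) - sqrt (q a + e)\<bar> \<le> (b - a) * sqrt (q a + e) * sqrt (q b + e)" if e: "0 < e" for e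
  proof -
    define r where "r t = inverse (sqrt (q t + e))" for t
    define r' where "r' t = - q' t / (2 * (sqrt (q t + e))^3)" for t
    have r: "(r has_real_derivative r' t) (at t)" if t: "a \<le> t" "t \<le> b" for t
    proof -
      have p: "0 < q t + e" using q[OF t] e by simp
      then have s: "(sqrt (q t + e))\<^sup>2 = q t + e" "0 < sqrt (q t + e)" by simp_all
      show ?thesis unfolding r_def r'_def using p
        by (auto intro!: derivative_eq_intros d[OF t] simp: field_simps power2_eq_square power3_eq_cube)
    qed
    have r1: "\<bar>r' t\<bar> \<le> 1" if t: "a \<le> t" "t \<le> b" for t
    proof -
      have p: "0 < q t + e" using q[OF t] e by simp
      have "\<bar>q' t\<bar> \<le> 2 * (sqrt (q t + e))^3"
        using q'[OF t] power_mono[of "sqrt (q t)" "sqrt (q t + e)" 3] q[OF t] e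
        by (smt (verit) real_sqrt_ge_zero real_sqrt_le_mono)
      then show ?thesis using p by (simp add: r'_def)
    qed
    have "\<bar>r b - r a\<bar> \<le> b - a"
    proof (cases "a = b")
      case False
      then have "a < b" using ab by simp
      from MVT2[OF this, of r r'] r obtain z where "a < z" "z < b" "r b - r a = (b - a) * r' z" by auto
      then show ?thesis using r1[of z] \<open>a < b\<close> by (simp add: abs_mult mult_left_le)
    qed simp
    moreover have p: "0 < sqrt (q a + e)" "0 < sqrt (q b + e)" using q ab e by (simp_all add: add_nonneg_pos)
    moreover have "\<bar>r b - r a\<bar> = \<bar>sqrt (q b + e) - sqrt (q a + e)\<bar> / (sqrt (q a + e) * sqrt (q b + e))"
      using p unfolding r_def by (simp add: inverse_diff_inverse abs_mult abs_minus_commute field_simps)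
    ultimately show ?thesis by (simp add: divide_le_eq mult.assoc)
  qed
  have "((\<lambda>e. \<bar>sqrt (q b + e) - sqrt (q a + e)\<bar>) \<longlongrightarrow> \<bar>sqrt (q b + 0) - sqrt (q a + 0)\<bar>) (at_right 0)"
    by (intro tendsto_intros)
  moreover have "((\<lambda>e. (b - a) * sqrt (q a + e) * sqrt (q b + e)) \<longlongrightarrow> (b - a) * sqrt (q a + 0) * sqrt (q b + 0)) (at_right 0)"
    by (intro tendsto_intros)
  moreover have "\<forall>\<^sub>F e in at_right 0. \<bar>sqrt (q b + e) - sqrt (q a + e)\<bar> \<le> (b - a) * sqrt (q a + e) * sqrt (q b + e)"
    using eps by (auto simp: eventually_at_right_field intro!: exI[of _ 1])
  ultimately show ?thesis using tendsto_le[of "at_right (0::real)"] by fastforce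
qed

text \<open>By \<open>sqrt_growth\<close> the second derivative is at least
  \<open>b\<^sup>2 / (1 + t * b)\<^sup>2\<close>; integrating once gives the slope bound, and
  integrating again gives \<open>omega\<close>.\<close>

lemma omega_lower_bound:
  fixes g g1 g2 g3 :: "real \<Rightarrow> real"
  assumes T: "0 \<le> T"
    and g: "\<And>t. 0 \<le> t \<Longrightarrow> t \<le> T \<Longrightarrow> (g has_real_derivative g1 t) (at t)"
    and g1: "\<And>t. 0 \<le> t \<Longrightarrow> t \<le> T \<Longrightarrow> (g1 has_real_derivative g2 t) (at t)"
    and g2: "\<And>t. 0 \<le> t \<Longrightarrow> t \<le> T \<Longrightarrow> (g2 has_real_derivative g3 t) (at t)"
    and q: "\<And>t. 0 \<le> t \<Longrightarrow> t \<le> T \<Longrightarrow> 0 \<le> g2 t"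
    and g3: "\<And>t. 0 \<le> t \<Longrightarrow> t \<le> T \<Longrightarrow> \<bar>g3 t\<bar> \<le> 2 * (sqrt (g2 t))^3"
  defines "b \<equiv> sqrt (g2 0)"
  shows "g1 0 + T * b\<^sup>2 / (1 + T * b) \<le> g1 T" and "g 0 + T * g1 0 + omega (T * b) \<le> g T"
proof -
  have b: "0 \<le> b" using q T by (simp add: b_def)
  have lo: "b\<^sup>2 / (1 + t * b)\<^sup>2 \<le> g2 t" if t: "0 \<le> t" "t \<le> T" for t
  proof -
    have "\<bar>sqrt (g2 t) - sqrt (g2 0)\<bar> \<le> (t - 0) * sqrt (g2 0) * sqrt (g2 t)"
      using t by (intro sqrt_growth[where q'=g3]) (auto intro!: g2 q g3)
    then have "b \<le> sqrt (g2 t) * (1 + t * b)" by (simp add: b_def algebra_simps)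
    then have "b\<^sup>2 \<le> (sqrt (g2 t) * (1 + t * b))\<^sup>2" using b by (rule power_mono)
    also have "\<dots> = g2 t * (1 + t * b)\<^sup>2" using q t by (simp add: power_mult_distrib)
    finally show ?thesis using b t by (simp add: divide_le_eq zero_less_power2 add_nonneg_eq_0_iff)
  qed
  have A: "g1 0 + t * b\<^sup>2 / (1 + t * b) \<le> g1 t" if t: "0 \<le> t" "t \<le> T" for t
  proof -
    define k where "k t = g1 t - t * b\<^sup>2 / (1 + t * b)" for t
    have "k 0 \<le> k t"
    proof (rule DERIV_nonneg_imp_le[OF t(1)])
      fix s assume s: "0 \<le> s" "s \<le> t"
      then have p: "0 < 1 + s * b" using b by (simp add: add_pos_nonneg)
      show "(k has_real_derivative g2 s - b\<^sup>2 / (1 + s * b)\<^sup>2) (at s)"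
        unfolding k_def using p s t
        by (auto intro!: derivative_eq_intros g1 simp: field_simps power2_eq_square)
      show "0 \<le> g2 s - b\<^sup>2 / (1 + s * b)\<^sup>2" using lo[of s] s t by simp
    qed
    then show ?thesis by (simp add: k_def)
  qed
  then show "g1 0 + T * b\<^sup>2 / (1 + T * b) \<le> g1 T" using T by simp
  define k where "k t = g t - t * g1 0 - omega (t * b)" for t
  have "k 0 \<le> k T"
  proof (rule DERIV_nonneg_imp_le[OF T])
    fix s assume s: "0 \<le> s" "s \<le> T"
    then have p: "0 \<le> s * b" using b by simp
    have "((\<lambda>t. omega (t * b)) has_real_derivative (s * b / (1 + s * b)) * b) (at s)"
      using DERIV_chain2[where g="\<lambda>t. t * b", OF DERIV_omega[OF p] DERIV_cmult_right[OF DERIV_ident]] by simp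
    then show "(k has_real_derivative g1 s - g1 0 - (s * b / (1 + s * b)) * b) (at s)"
      unfolding k_def by (auto intro!: derivative_eq_intros g s)
    show "0 \<le> g1 s - g1 0 - (s * b / (1 + s * b)) * b"
      using A[OF s] by (simp add: power2_eq_square mult.assoc)
  qed
  then show "g 0 + T * g1 0 + omega (T * b) \<le> g T" by (simp add: k_def)
qed

text \<open>Mirror image of \<open>omega_lower_bound\<close>: the other half of
  \<open>sqrt_growth\<close> bounds the second derivative by
  \<open>b\<^sup>2 / (1 - t * b)\<^sup>2\<close>, as long as the denominator stays positive.\<close>

lemma omega_star_upper_bound:
  fixes g g1 g2 g3 :: "real \<Rightarrow> real"
  assumes T: "0 \<le> T"
    and g: "\<And>t. 0 \<le> t \<Longrightarrow> t \<le> T \<Longrightarrow> (g has_real_derivative g1 t) (at t)"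
    and g1: "\<And>t. 0 \<le> t \<Longrightarrow> t \<le> T \<Longrightarrow> (g1 has_real_derivative g2 t) (at t)"
    and g2: "\<And>t. 0 \<le> t \<Longrightarrow> t \<le> T \<Longrightarrow> (g2 has_real_derivative g3 t) (at t)"
    and q: "\<And>t. 0 \<le> t \<Longrightarrow> t \<le> T \<Longrightarrow> 0 \<le> g2 t"
    and g3: "\<And>t. 0 \<le> t \<Longrightarrow> t \<le> T \<Longrightarrow> \<bar>g3 t\<bar> \<le> 2 * (sqrt (g2 t))^3"
  defines "b \<equiv> sqrt (g2 0)"
  assumes Tb: "T * b < 1"
  shows "sqrt (g2 T) \<le> b / (1 - T * b)" and "g T \<le> g 0 + T * g1 0 + omega_star (T * b)"
proof -
  have b: "0 \<le> b" using q T by (simp add: b_def)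
  have tb: "t * b < 1" if t: "0 \<le> t" "t \<le> T" for t
    using mult_right_mono[OF t(2) b] Tb by linarith
  have up: "sqrt (g2 t) \<le> b / (1 - t * b)" if t: "0 \<le> t" "t \<le> T" for t
  proof -
    have "\<bar>sqrt (g2 t) - sqrt (g2 0)\<bar> \<le> (t - 0) * sqrt (g2 0) * sqrt (g2 t)"
      using t by (intro sqrt_growth[where q'=g3]) (auto intro!: g2 q g3)
    then have "sqrt (g2 t) * (1 - t * b) \<le> b" by (simp add: b_def algebra_simps)
    then show ?thesis using tb[OF t] by (simp add: le_divide_eq)
  qed
  then show "sqrt (g2 T) \<le> b / (1 - T * b)" using T by simp
  have up2: "g2 t \<le> b\<^sup>2 / (1 - t * b)\<^sup>2" if t: "0 \<le> t" "t \<le> T" for t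
    using power_mono[OF up[OF t], of 2] q[OF t] by (simp add: power_divide)
  have A: "g1 t \<le> g1 0 + t * b\<^sup>2 / (1 - t * b)" if t: "0 \<le> t" "t \<le> T" for t
  proof -
    define k where "k t = t * b\<^sup>2 / (1 - t * b) - g1 t" for t
    have "k 0 \<le> k t"
    proof (rule DERIV_nonneg_imp_le[OF t(1)])
      fix s assume s: "0 \<le> s" "s \<le> t"
      then have p: "0 < 1 - s * b" using tb[of s] t by simp
      show "(k has_real_derivative b\<^sup>2 / (1 - s * b)\<^sup>2 - g2 s) (at s)"
        unfolding k_def using p s t
        by (auto intro!: derivative_eq_intros g1 simp: field_simps power2_eq_square)
      show "0 \<le> b\<^sup>2 / (1 - s * b)\<^sup>2 - g2 s" using up2[of s] s t by simp
    qed
    then show ?thesis by (simp add: k_def)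
  qed
  define k where "k t = t * g1 0 + omega_star (t * b) - g t" for t
  have "k 0 \<le> k T"
  proof (rule DERIV_nonneg_imp_le[OF T])
    fix s assume s: "0 \<le> s" "s \<le> T"
    have "((\<lambda>t. omega_star (t * b)) has_real_derivative (s * b / (1 - s * b)) * b) (at s)"
      using DERIV_chain2[where g="\<lambda>t. t * b", OF DERIV_omega_star[OF tb[OF s]] DERIV_cmult_right[OF DERIV_ident]]
      by simp
    then show "(k has_real_derivative g1 0 + (s * b / (1 - s * b)) * b - g1 s) (at s)"
      unfolding k_def by (auto intro!: derivative_eq_intros g s)
    show "0 \<le> g1 0 + (s * b / (1 - s * b)) * b - g1 s"
      using A[OF s] by (simp add: power2_eq_square mult.assoc)
  qed
  then show "g T \<le> g 0 + T * g1 0 + omega_star (T * b)" by (simp add: k_def)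
qed

subsection \<open>Self-concordant functions\<close>

text \<open>
  The last clause is the barrier property: a segment can leave the domain only where \<open>f\<close> is unbounded.
\<close>

definition sc_barrier :: "'a::euclidean_space set \<Rightarrow> ('a \<Rightarrow> real) \<Rightarrow> bool" where
  "sc_barrier D f \<longleftrightarrow> open D \<and> convex D \<and> smooth_on 3 D f \<and>
    (\<forall>x\<in>D. \<forall>h. 0 \<le> DD f [h, h] x \<and> DD f [h, h, h] x \<le> 2 * (DD f [h, h] x) powr (3/2)) \<and>
    (\<forall>x\<in>D. \<forall>h C. (\<forall>t\<in>{0..<1}. x + t *\<^sub>R h \<in> D \<and> f (x + t *\<^sub>R h) \<le> C) \<longrightarrow> x + h \<in> D)"

text \<open>The local norm of self-concordance theory. It is a seminorm here, because the functions
  it is used for are constant in the directions orthogonal to the subspaces of the blocks.\<close>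

definition lnorm :: "('a::euclidean_space \<Rightarrow> real) \<Rightarrow> 'a \<Rightarrow> 'a \<Rightarrow> real" where
  "lnorm f x h = sqrt (DD f [h, h] x)"

lemma powr_three_halves: "0 \<le> x \<Longrightarrow> x powr (3/2) = (sqrt x)^3"
  by (cases "x = 0") (simp_all add: powr_half_sqrt[symmetric] powr_powr flip: powr_realpow)

lemma convex_line_mem:
  assumes "convex D" "x \<in> D" "x + h \<in> D" "0 \<le> t" "t \<le> 1"
  shows "x + t *\<^sub>R h \<in> D"
proof -
  have "(1 - t) *\<^sub>R x + t *\<^sub>R (x + h) \<in> D" using assms by (intro convexD) auto
  then show ?thesis by (simp add: algebra_simps)
qed

section \<open>Multilinearity and symmetry of derivatives\<close>

context
  fixes f :: "'a::euclidean_space \<Rightarrow> real" and U :: "'a set"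
  assumes U: "open U"
begin

lemma DD1_linear:
  assumes "smooth_on 1 U f" "x \<in> U"
  shows "linear (\<lambda>h. DD f [h] x)"
  using DD_linear[OF U, of "[]" "[]" f] assms by (simp del: DD.simps)

lemma DD2_linear:
  assumes "smooth_on 2 U f" "x \<in> U"
  shows "linear (\<lambda>h. DD f [h, k] x)" "linear (\<lambda>h. DD f [k, h] x)"
  using DD_linear[OF U, of "[]" "[k]" f] DD_linear[OF U, of "[k]" "[]" f] assms
  by (simp_all add: numeral_2_eq_2 del: DD.simps)

lemma DD3_linear:
  assumes "smooth_on 3 U f" "x \<in> U"
  shows "linear (\<lambda>h. DD f [h, k, l] x)" "linear (\<lambda>h. DD f [k, h, l] x)" "linear (\<lambda>h. DD f [k, l, h] x)"
  using DD_linear[OF U, of "[]" "[k, l]" f] DD_linear[OF U, of "[k]" "[l]" f] DD_linear[OF U, of "[k, l]" "[]" f] assms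
  by (simp_all add: numeral_3_eq_3 del: DD.simps)

lemma DD2_perm:
  assumes "smooth_on 2 U f" "x \<in> U"
  shows "DD f [h, k] x = DD f [k, h] x"
  using DD_perm[OF U, of "[h, k]" f x] assms by (simp add: numeral_2_eq_2 add_mset_commute del: DD.simps)

lemma DD3_perm:
  assumes "smooth_on 3 U f" "x \<in> U" "mset [h, k, l] = mset [h', k', l']"
  shows "DD f [h, k, l] x = DD f [h', k', l'] x"
  using DD_perm[OF U, of "[h, k, l]" f x] assms by (simp add: numeral_3_eq_3 del: DD.simps)

lemma DD2_expand:
  assumes "smooth_on 2 U f" "x \<in> U"
  shows "DD f [a *\<^sub>R e + b *\<^sub>R d, a *\<^sub>R e + b *\<^sub>R d] x
    = a\<^sup>2 * DD f [e, e] x + 2 * a * b * DD f [e, d] x + b\<^sup>2 * DD f [d, d] x"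
proof -
  note l = DD2_linear[OF assms]
  show ?thesis
    unfolding linear_add[OF l(1)] linear_add[OF l(2)] linear_cmul[OF l(1)] linear_cmul[OF l(2)]
      DD2_perm[OF assms, of d e]
    by (simp add: power2_eq_square algebra_simps del: DD.simps)
qed

lemma DD3_expand:
  assumes "smooth_on 3 U f" "x \<in> U"
  shows "DD f [a *\<^sub>R e + b *\<^sub>R d, a *\<^sub>R e + b *\<^sub>R d, a *\<^sub>R e + b *\<^sub>R d] x
    = a^3 * DD f [e, e, e] x + 3 * a\<^sup>2 * b * DD f [e, e, d] x + 3 * a * b\<^sup>2 * DD f [e, d, d] x + b^3 * DD f [d, d, d] x"
proof -
  note l = DD3_linear[OF assms]
  have p: "DD f [d, e, e] x = DD f [e, e, d] x" "DD f [e, d, e] x = DD f [e, e, d] x"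
    "DD f [d, d, e] x = DD f [e, d, d] x" "DD f [d, e, d] x = DD f [e, d, d] x"
    by (intro DD3_perm[OF assms]; simp)+
  show ?thesis
    unfolding linear_add[OF l(1)] linear_add[OF l(2)] linear_add[OF l(3)]
      linear_cmul[OF l(1)] linear_cmul[OF l(2)] linear_cmul[OF l(3)] p
    by (simp add: power2_eq_square power3_eq_cube algebra_simps del: DD.simps)
qed

end

context
  fixes D :: "'a::euclidean_space set" and f :: "'a \<Rightarrow> real"
  assumes sc: "sc_barrier D f"
begin

lemma sc_open: "open D" and sc_convex: "convex D" and sc_smooth: "smooth_on 3 D f"
  using sc by (auto simp: sc_barrier_def)

lemma sc_smooth_le: "k \<le> 3 \<Longrightarrow> smooth_on k D f"
  using smooth_on_mono[OF sc_open sc_smooth] .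

lemma sc_D2_nonneg: "x \<in> D \<Longrightarrow> 0 \<le> DD f [h, h] x"
  using sc unfolding sc_barrier_def by blast

lemma lnorm_nonneg: "x \<in> D \<Longrightarrow> 0 \<le> lnorm f x h"
  by (simp add: lnorm_def sc_D2_nonneg del: DD.simps)

lemma lnorm_square: "x \<in> D \<Longrightarrow> (lnorm f x h)\<^sup>2 = DD f [h, h] x"
  by (simp add: lnorm_def sc_D2_nonneg del: DD.simps)

lemma sc_D3_bound:
  assumes "x \<in> D"
  shows "\<bar>DD f [h, h, h] x\<bar> \<le> 2 * (lnorm f x h)^3"
proof -
  have b: "DD f [h, h, h] x \<le> 2 * (lnorm f x h)^3" for h
    using sc assms powr_three_halves[OF sc_D2_nonneg[OF assms, of h]]
    unfolding sc_barrier_def lnorm_def by metis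
  have "DD f [- h, - h, - h] x = - DD f [h, h, h] x"
    using DD3_expand[OF sc_open sc_smooth assms, of "-1" h 0 0] by (simp del: DD.simps)
  moreover have "DD f [- h, - h] x = DD f [h, h] x"
    using DD2_expand[OF sc_open sc_smooth_le assms, of "-1" h 0 0] by (simp del: DD.simps)
  ultimately show ?thesis using b[of h] b[of "- h"] by (simp add: lnorm_def del: DD.simps)
qed

lemma lnorm_scale:
  assumes "x \<in> D"
  shows "lnorm f x (t *\<^sub>R h) = \<bar>t\<bar> * lnorm f x h"
  using DD2_expand[OF sc_open sc_smooth_le assms, of t h 0 0]
  by (simp add: lnorm_def real_sqrt_mult del: DD.simps)

lemma sc_D2_disc:
  assumes "x \<in> D"
  shows "(DD f [h, k] x)\<^sup>2 \<le> DD f [h, h] x * DD f [k, k] x"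
proof (rule quadratic_form_disc)
  fix a b :: real
  show "0 \<le> a\<^sup>2 * DD f [h, h] x + 2 * a * b * DD f [h, k] x + b\<^sup>2 * DD f [k, k] x"
    using sc_D2_nonneg[OF assms, of "a *\<^sub>R h + b *\<^sub>R k"]
    unfolding DD2_expand[OF sc_open sc_smooth_le[of 2, simplified] assms] .
qed

lemma lnorm_triangle:
  assumes "x \<in> D"
  shows "lnorm f x (h + k) \<le> lnorm f x h + lnorm f x k"
proof (rule power2_le_imp_le)
  have "(lnorm f x (h + k))\<^sup>2 = DD f [1 *\<^sub>R h + 1 *\<^sub>R k, 1 *\<^sub>R h + 1 *\<^sub>R k] x"
    by (simp add: lnorm_square[OF assms] del: DD.simps)
  also have "\<dots> = DD f [h, h] x + 2 * DD f [h, k] x + DD f [k, k] x"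
    unfolding DD2_expand[OF sc_open sc_smooth_le[of 2, simplified] assms] by simp
  also have "DD f [h, k] x \<le> lnorm f x h * lnorm f x k"
    using sc_D2_disc[OF assms, of h k] real_le_rsqrt
    by (simp add: lnorm_def real_sqrt_mult[symmetric] del: DD.simps)
  finally show "(lnorm f x (h + k))\<^sup>2 \<le> (lnorm f x h + lnorm f x k)\<^sup>2"
    by (simp add: power2_sum lnorm_square[OF assms] algebra_simps del: DD.simps)
  show "0 \<le> lnorm f x h + lnorm f x k" by (simp add: lnorm_nonneg assms)
qed

text \<open>On the plane of \<open>h\<close> and \<open>d\<close> the third derivative is a binary
  cubic form dominated by the second. The constant 2 survives the passage from equal to mixed
  arguments, and it becomes the exponent 2 in the comparison of Hessians.\<close>

lemma sc_D3_mixed_bound: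
  assumes "x \<in> D"
  shows "\<bar>DD f [h, d, d] x\<bar> \<le> 2 * lnorm f x h * DD f [d, d] x"
  unfolding lnorm_def
proof (rule cubic_form_mixed_bound)
  note e2 = DD2_expand[OF sc_open sc_smooth_le[of 2, simplified] assms]
  fix a b :: real
  show "0 \<le> a\<^sup>2 * DD f [h, h] x + 2 * a * b * DD f [h, d] x + b\<^sup>2 * DD f [d, d] x"
    using sc_D2_nonneg[OF assms, of "a *\<^sub>R h + b *\<^sub>R d"] unfolding e2 .
  show "\<bar>a^3 * DD f [h, h, h] x + 3 * a\<^sup>2 * b * DD f [h, h, d] x + 3 * a * b\<^sup>2 * DD f [h, d, d] x + b^3 * DD f [d, d, d] x\<bar>
    \<le> 2 * (sqrt (a\<^sup>2 * DD f [h, h] x + 2 * a * b * DD f [h, d] x + b\<^sup>2 * DD f [d, d] x))^3"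
    using sc_D3_bound[OF assms, of "a *\<^sub>R h + b *\<^sub>R d"]
    unfolding lnorm_def e2 DD3_expand[OF sc_open sc_smooth assms] .
qed

lemma sc_line:
  assumes "x + t *\<^sub>R h \<in> D" "length hs < 3"
  shows "((\<lambda>s. DD f hs (x + s *\<^sub>R h)) has_real_derivative DD f (h # hs) (x + t *\<^sub>R h)) (at t)"
  using DD_line[OF sc_open sc_smooth assms(2,1)] .

lemma sc_lower_bound:
  assumes "x \<in> D" "x + h \<in> D"
  shows "f x + DD f [h] x + omega (lnorm f x h) \<le> f (x + h)"
proof -
  have mem: "x + t *\<^sub>R h \<in> D" if "0 \<le> t" "t \<le> 1" for t
    using convex_line_mem[OF sc_convex assms that] .
  have "DD f [] (x + 0 *\<^sub>R h) + 1 * DD f [h] (x + 0 *\<^sub>R h) + omega (1 * sqrt (DD f [h, h] (x + 0 *\<^sub>R h)))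
    \<le> DD f [] (x + 1 *\<^sub>R h)"
    by (rule omega_lower_bound(2)[where ?g1.0 = "\<lambda>t. DD f [h] (x + t *\<^sub>R h)" and ?g2.0 = "\<lambda>t. DD f [h, h] (x + t *\<^sub>R h)"
          and ?g3.0 = "\<lambda>t. DD f [h, h, h] (x + t *\<^sub>R h)"])
       (use mem sc_line sc_D2_nonneg sc_D3_bound[unfolded lnorm_def] in \<open>auto simp del: DD.simps\<close>)
  then show ?thesis by (simp add: lnorm_def)
qed

lemma sc_tangent_bound:
  assumes "x \<in> D" "x + h \<in> D"
  shows "f x + DD f [h] x \<le> f (x + h)"
proof -
  have "omega 0 \<le> omega (lnorm f x h)" using lnorm_nonneg[OF assms(1)] by (subst omega_le_iff) auto
  then show ?thesis using sc_lower_bound[OF assms] by simp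
qed

text \<open>The segment is assumed to lie in \<open>D\<close>, because \<open>sc_dikin\<close> uses
  this bound to prove that it does.\<close>

lemma sc_upper_bound_aux:
  assumes "lnorm f x h < 1" "\<And>t. 0 \<le> t \<Longrightarrow> t \<le> 1 \<Longrightarrow> x + t *\<^sub>R h \<in> D"
  shows "lnorm f (x + h) h \<le> lnorm f x h / (1 - lnorm f x h)"
    and "f (x + h) \<le> f x + DD f [h] x + omega_star (lnorm f x h)"
proof -
  have b: "1 * sqrt (DD f [h, h] (x + 0 *\<^sub>R h)) < 1" using assms(1) by (simp add: lnorm_def)
  have "sqrt (DD f [h, h] (x + 1 *\<^sub>R h)) \<le> sqrt (DD f [h, h] (x + 0 *\<^sub>R h)) / (1 - 1 * sqrt (DD f [h, h] (x + 0 *\<^sub>R h)))"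
    by (rule omega_star_upper_bound(1)[where g = "\<lambda>t. DD f [] (x + t *\<^sub>R h)" and ?g1.0 = "\<lambda>t. DD f [h] (x + t *\<^sub>R h)" and ?g2.0 = "\<lambda>t. DD f [h, h] (x + t *\<^sub>R h)"
          and ?g3.0 = "\<lambda>t. DD f [h, h, h] (x + t *\<^sub>R h)"])
       (use b assms(2) sc_line sc_D2_nonneg sc_D3_bound[unfolded lnorm_def] in \<open>auto simp del: DD.simps\<close>)
  then show "lnorm f (x + h) h \<le> lnorm f x h / (1 - lnorm f x h)" by (simp add: lnorm_def)
  have "DD f [] (x + 1 *\<^sub>R h) \<le> DD f [] (x + 0 *\<^sub>R h) + 1 * DD f [h] (x + 0 *\<^sub>R h) + omega_star (1 * sqrt (DD f [h, h] (x + 0 *\<^sub>R h)))"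
    by (rule omega_star_upper_bound(2)[where ?g1.0 = "\<lambda>t. DD f [h] (x + t *\<^sub>R h)" and ?g2.0 = "\<lambda>t. DD f [h, h] (x + t *\<^sub>R h)"
          and ?g3.0 = "\<lambda>t. DD f [h, h, h] (x + t *\<^sub>R h)"])
       (use b assms(2) sc_line sc_D2_nonneg sc_D3_bound[unfolded lnorm_def] in \<open>auto simp del: DD.simps\<close>)
  then show "f (x + h) \<le> f x + DD f [h] x + omega_star (lnorm f x h)" by (simp add: lnorm_def)
qed

text \<open>Consider the first time at which the segment is outside \<open>D\<close>. Before it the
  segment is inside and \<open>f\<close> is bounded, so the barrier property puts the exit point
  into \<open>D\<close>. The bound may therefore presuppose that the segment has stayed inside so
  far.\<close>

lemma sc_stay:
  assumes x: "x \<in> D"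
    and bound: "\<And>t. 0 \<le> t \<Longrightarrow> t < 1 \<Longrightarrow> (\<And>s. 0 \<le> s \<Longrightarrow> s \<le> t \<Longrightarrow> x + s *\<^sub>R h \<in> D) \<Longrightarrow> f (x + t *\<^sub>R h) \<le> C"
  shows "x + h \<in> D"
proof (rule ccontr)
  assume out: "x + h \<notin> D"
  define S where "S = {t \<in> {0..1}. x + t *\<^sub>R h \<in> - D}"
  have "closed {t. x + t *\<^sub>R h \<in> - D}"
    using continuous_closed_vimage[of "- D" "\<lambda>t. x + t *\<^sub>R h"] sc_open
    by (auto simp: vimage_def intro!: continuous_intros)
  then have "compact S"
    unfolding S_def using compact_Int_closed[of "{0..1}" "{t. x + t *\<^sub>R h \<in> - D}"]
    by (simp add: Int_def)
  moreover have "1 \<in> S" using out by (simp add: S_def)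
  ultimately obtain t where t: "t \<in> S" "\<And>s. s \<in> S \<Longrightarrow> t \<le> s"
    using compact_attains_inf[of S] by auto
  have t01: "0 \<le> t" "t \<le> 1" and tD: "x + t *\<^sub>R h \<notin> D" using t(1) by (auto simp: S_def)
  have mem: "x + s *\<^sub>R h \<in> D" if "0 \<le> s" "s < t" for s
  proof (rule ccontr)
    assume "x + s *\<^sub>R h \<notin> D"
    then have "s \<in> S" using that t01 by (simp add: S_def)
    then show False using t(2) that by fastforce
  qed
  have "\<forall>r\<in>{0..<1}. x + r *\<^sub>R (t *\<^sub>R h) \<in> D \<and> f (x + r *\<^sub>R (t *\<^sub>R h)) \<le> C"
  proof
    fix r :: real assume r: "r \<in> {0..<1}"
    have "t \<noteq> 0" using x tD by auto
    then have "r * t < t" "0 \<le> r * t" using r t01 by auto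
    moreover have "f (x + (r * t) *\<^sub>R h) \<le> C" by (rule bound) (use calculation mem t01 in auto)
    ultimately show "x + r *\<^sub>R (t *\<^sub>R h) \<in> D \<and> f (x + r *\<^sub>R (t *\<^sub>R h)) \<le> C"
      using mem[of "r * t"] by simp
  qed
  then have "x + t *\<^sub>R h \<in> D" using sc x unfolding sc_barrier_def by blast
  then show False using tD by simp
qed

text \<open>As long as the segment stays inside, the upper bound with \<open>omega_star\<close>
  keeps \<open>f\<close> below a constant, so \<open>sc_stay\<close> applies.\<close>

lemma sc_dikin:
  assumes x: "x \<in> D" and h: "lnorm f x h < 1"
  shows "x + h \<in> D"
proof (rule sc_stay[OF x])
  fix s :: real assume s: "0 \<le> s" "s < 1" and mem: "\<And>r. 0 \<le> r \<Longrightarrow> r \<le> s \<Longrightarrow> x + r *\<^sub>R h \<in> D"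
  have n: "0 \<le> lnorm f x h" by (rule lnorm_nonneg[OF x])
  have le: "lnorm f x (s *\<^sub>R h) \<le> lnorm f x h"
    using s n by (simp add: lnorm_scale[OF x] mult_left_le_one_le)
  have "f (x + s *\<^sub>R h) \<le> f x + DD f [s *\<^sub>R h] x + omega_star (lnorm f x (s *\<^sub>R h))"
  proof (rule sc_upper_bound_aux(2))
    show "lnorm f x (s *\<^sub>R h) < 1" using le h by simp
    fix r :: real assume r: "0 \<le> r" "r \<le> 1"
    then have "r * s \<le> s" using s by (simp add: mult_left_le_one_le)
    then show "x + r *\<^sub>R s *\<^sub>R h \<in> D" using mem[of "r * s"] r s by simp
  qed
  also have "DD f [s *\<^sub>R h] x = s * DD f [h] x"
    using linear_cmul[OF DD1_linear[OF sc_open sc_smooth_le x], of s h] by simp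
  also have "s * DD f [h] x \<le> \<bar>DD f [h] x\<bar>"
    using mult_left_mono[OF abs_ge_self s(1), of "DD f [h] x"] mult_left_le_one_le[of "\<bar>DD f [h] x\<bar>" s] s
    by linarith
  also have "omega_star (lnorm f x (s *\<^sub>R h)) \<le> omega_star (lnorm f x h)"
    using le h n lnorm_nonneg[OF x] by (subst omega_star_le_iff) auto
  finally show "f (x + s *\<^sub>R h) \<le> f x + \<bar>DD f [h] x\<bar> + omega_star (lnorm f x h)" by simp
qed

lemma sc_upper_bound:
  assumes x: "x \<in> D" and h: "lnorm f x h < 1"
  shows "f (x + h) \<le> f x + DD f [h] x + omega_star (lnorm f x h)"
  using sc_upper_bound_aux(2)[OF h] convex_line_mem[OF sc_convex x sc_dikin[OF x h]] by blast

text \<open>For \<open>q t = DD f [d, d] (x + t *\<^sub>R h)\<close> the mixed bound gives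
  \<open>\<bar>q'\<bar> \<le> 2 * b / (1 - t * b) * q\<close>. Hence \<open>q\<close> times
  \<open>(1 - t * b)\<^sup>2\<close> decreases and \<open>q\<close> divided by it increases; the two
  conclusions are the square roots of these facts.\<close>

lemma sc_lnorm_compare:
  assumes x: "x \<in> D" and h: "lnorm f x h < 1"
  shows "(1 - lnorm f x h) * lnorm f (x + h) d \<le> lnorm f x d"
    and "(1 - lnorm f x h) * lnorm f x d \<le> lnorm f (x + h) d"
proof -
  define b where "b = lnorm f x h"
  have b: "0 \<le> b" "b < 1" using lnorm_nonneg[OF x] h by (simp_all add: b_def)
  have mem: "x + t *\<^sub>R h \<in> D" if "0 \<le> t" "t \<le> 1" for t
    using convex_line_mem[OF sc_convex x sc_dikin[OF x h] that] .
  have tb: "0 < 1 - t * b" if "0 \<le> t" "t \<le> 1" for t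
    using mult_left_le_one_le[OF b(1) that] b by simp
  have n: "lnorm f (x + t *\<^sub>R h) h \<le> b / (1 - t * b)" if t: "0 \<le> t" "t \<le> 1" for t
  proof (cases "t = 0")
    case True then show ?thesis by (simp add: b_def)
  next
    case False
    have l: "lnorm f x (t *\<^sub>R h) = t * b" using t by (simp add: lnorm_scale[OF x] b_def)
    have "lnorm f (x + t *\<^sub>R h) (t *\<^sub>R h) \<le> lnorm f x (t *\<^sub>R h) / (1 - lnorm f x (t *\<^sub>R h))"
    proof (rule sc_upper_bound_aux(1))
      show "lnorm f x (t *\<^sub>R h) < 1" using l tb[OF t] by simp
      fix s :: real assume s: "0 \<le> s" "s \<le> 1"
      then have "s * t \<le> 1" using t by (simp add: mult_le_one)
      then show "x + s *\<^sub>R t *\<^sub>R h \<in> D" using mem[of "s * t"] s t by simp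
    qed
    then have "t * lnorm f (x + t *\<^sub>R h) h \<le> t * (b / (1 - t * b))"
      using t by (simp add: lnorm_scale[OF mem[OF t]] l)
    then show ?thesis using t False by (simp only: mult_le_cancel_left_pos)
  qed
  define q where "q t = DD f [d, d] (x + t *\<^sub>R h)" for t
  define q' where "q' t = DD f [h, d, d] (x + t *\<^sub>R h)" for t
  have q: "(q has_real_derivative q' t) (at t)" if t: "0 \<le> t" "t \<le> 1" for t
    unfolding q_def q'_def using sc_line[OF mem[OF t], of "[d, d]"] by (simp del: DD.simps)
  have q0: "0 \<le> q t" if "0 \<le> t" "t \<le> 1" for t using sc_D2_nonneg[OF mem[OF that]] by (simp add: q_def)
  have q': "(1 - t * b) * \<bar>q' t\<bar> \<le> 2 * b * q t" if t: "0 \<le> t" "t \<le> 1" for t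
  proof -
    have "\<bar>q' t\<bar> \<le> 2 * lnorm f (x + t *\<^sub>R h) h * q t"
      unfolding q_def q'_def by (rule sc_D3_mixed_bound[OF mem[OF t]])
    also have "\<dots> \<le> 2 * (b / (1 - t * b)) * q t"
      by (intro mult_right_mono mult_left_mono n[OF t] q0[OF t]) auto
    finally show ?thesis using tb[OF t] by (simp add: field_simps)
  qed
  have "q 1 * (1 - 1 * b)\<^sup>2 \<le> q 0 * (1 - 0 * b)\<^sup>2"
  proof -
    have "- (q 0 * (1 - 0 * b)\<^sup>2) \<le> - (q 1 * (1 - 1 * b)\<^sup>2)"
    proof (rule DERIV_nonneg_imp_le[where f="\<lambda>t. - (q t * (1 - t * b)\<^sup>2)"])
      fix t :: real assume t: "0 \<le> t" "t \<le> 1"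
      show "((\<lambda>t. - (q t * (1 - t * b)\<^sup>2)) has_real_derivative (1 - t * b) * (2 * b * q t - (1 - t * b) * q' t)) (at t)"
        by (auto intro!: derivative_eq_intros q t simp: power2_eq_square algebra_simps)
      have "(1 - t * b) * q' t \<le> (1 - t * b) * \<bar>q' t\<bar>" using tb[OF t] by (intro mult_left_mono) auto
      then show "0 \<le> (1 - t * b) * (2 * b * q t - (1 - t * b) * q' t)"
        using q'[OF t] tb[OF t] by (intro mult_nonneg_nonneg) linarith+
    qed simp
    then show ?thesis by simp
  qed
  then have "((1 - b) * lnorm f (x + h) d)\<^sup>2 \<le> (lnorm f x d)\<^sup>2"
    using lnorm_square[OF x, of d] lnorm_square[OF mem[of 1], of d]
    by (simp add: q_def power_mult_distrib mult.commute del: DD.simps)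
  then show "(1 - lnorm f x h) * lnorm f (x + h) d \<le> lnorm f x d"
    using power2_le_imp_le lnorm_nonneg[OF x] unfolding b_def by blast
  define r where "r t = inverse (1 - t * b)" for t
  have "q 0 * (r 0)\<^sup>2 \<le> q 1 * (r 1)\<^sup>2"
  proof (rule DERIV_nonneg_imp_le[where f="\<lambda>t. q t * (r t)\<^sup>2"])
    fix t :: real assume t: "0 \<le> t" "t \<le> 1"
    have p: "1 - t * b \<noteq> 0" using tb[OF t] by simp
    have "(r has_real_derivative b * (r t)\<^sup>2) (at t)"
      unfolding r_def using p by (auto intro!: derivative_eq_intros simp: power2_eq_square)
    then have "((\<lambda>t. q t * (r t)\<^sup>2) has_real_derivative q' t * (r t)\<^sup>2 + 2 * b * q t * (r t)^3) (at t)"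
      by (auto intro!: derivative_eq_intros q t simp: power2_eq_square power3_eq_cube)
    also have "q' t * (r t)\<^sup>2 + 2 * b * q t * (r t)^3 = ((1 - t * b) * q' t + 2 * b * q t) * (r t)^3"
    proof -
      have "(1 - t * b) * r t = 1" using p by (simp add: r_def)
      then show ?thesis by algebra
    qed
    finally show "((\<lambda>t. q t * (r t)\<^sup>2) has_real_derivative ((1 - t * b) * q' t + 2 * b * q t) * (r t)^3) (at t)" .
    have "- ((1 - t * b) * \<bar>q' t\<bar>) \<le> (1 - t * b) * q' t"
      using mult_left_mono[of "- \<bar>q' t\<bar>" "q' t" "1 - t * b"] tb[OF t] by simp
    then show "0 \<le> ((1 - t * b) * q' t + 2 * b * q t) * (r t)^3"
      using q'[OF t] tb[OF t] by (intro mult_nonneg_nonneg) (auto simp: r_def)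
  qed simp
  then have "(1 - b)\<^sup>2 * q 0 \<le> q 1" using b by (simp add: r_def field_simps)
  then have "((1 - b) * lnorm f x d)\<^sup>2 \<le> (lnorm f (x + h) d)\<^sup>2"
    using lnorm_square[OF x, of d] lnorm_square[OF mem[of 1], of d]
    by (simp add: q_def power_mult_distrib del: DD.simps)
  then show "(1 - lnorm f x h) * lnorm f x d \<le> lnorm f (x + h) d"
    using power2_le_imp_le lnorm_nonneg[OF mem[of 1]] unfolding b_def by fastforce
qed

end

section \<open>Operations that preserve self-concordant barriers\<close>

lemma sc_barrier_affine:
  fixes L :: "'b::euclidean_space \<Rightarrow> 'a::euclidean_space"
  assumes sc: "sc_barrier D f" and L: "linear L"
  shows "sc_barrier {x. a + L x \<in> D} (\<lambda>x. f (a + L x))"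
  unfolding sc_barrier_def
proof (intro conjI ballI allI impI)
  have c: "continuous_on UNIV (\<lambda>x. a + L x)"
    using L by (intro continuous_intros linear_continuous_on) (simp add: linear_conv_bounded_linear)
  show o: "open {x. a + L x \<in> D}"
    using open_vimage[OF sc_open[OF sc] c] by (simp add: vimage_def)
  show "convex {x. a + L x \<in> D}"
  proof (rule convexI)
    fix x y and u v :: real assume h: "x \<in> {x. a + L x \<in> D}" "y \<in> {x. a + L x \<in> D}" "0 \<le> u" "0 \<le> v" "u + v = 1"
    have "a + L (u *\<^sub>R x + v *\<^sub>R y) = u *\<^sub>R (a + L x) + v *\<^sub>R (a + L y)"
      using h(5) L by (simp add: linear_add linear_cmul algebra_simps flip: scaleR_add_left)
    then show "u *\<^sub>R x + v *\<^sub>R y \<in> {x. a + L x \<in> D}"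
      using convexD[OF sc_convex[OF sc], of "a + L x" "a + L y" u v] h by simp
  qed
  show "smooth_on 3 {x. a + L x \<in> D} (\<lambda>x. f (a + L x))"
    using smooth_on_affine[OF o sc_open[OF sc] L sc_smooth[OF sc]] by simp
  fix x assume x: "x \<in> {x. a + L x \<in> D}"
  fix h
  show "0 \<le> DD (\<lambda>x. f (a + L x)) [h, h] x"
    using sc_D2_nonneg[OF sc, of "a + L x" "L h"] x by (simp add: DD_affine[OF L] del: DD.simps)
  show "DD (\<lambda>x. f (a + L x)) [h, h, h] x \<le> 2 * DD (\<lambda>x. f (a + L x)) [h, h] x powr (3 / 2)"
    using sc x by (simp add: sc_barrier_def DD_affine[OF L] del: DD.simps)
  fix C
  assume "\<forall>t\<in>{0..<1}. x + t *\<^sub>R h \<in> {x. a + L x \<in> D} \<and> f (a + L (x + t *\<^sub>R h)) \<le> C"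
  then have "\<forall>t\<in>{0..<1}. (a + L x) + t *\<^sub>R L h \<in> D \<and> f ((a + L x) + t *\<^sub>R L h) \<le> C"
    using L by (simp add: linear_add linear_cmul add.assoc)
  then have "(a + L x) + L h \<in> D" using sc x unfolding sc_barrier_def by blast
  then show "x + h \<in> {x. a + L x \<in> D}" using L by (simp add: linear_add add.assoc)
qed

text \<open>If a sum is bounded above on a segment and each summand is bounded below by its tangent,
  then each summand is bounded above. This gives the barrier property of sums.\<close>

lemma sc_barrier_segment_lower:
  assumes sc: "sc_barrier D f" and "x \<in> D" "x + t *\<^sub>R h \<in> D" "t \<in> {0..<1}"
  shows "f x - \<bar>DD f [h] x\<bar> \<le> f (x + t *\<^sub>R h)"
proof -
  have "f x + DD f [t *\<^sub>R h] x \<le> f (x + t *\<^sub>R h)" by (rule sc_tangent_bound[OF sc assms(2,3)])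
  moreover have "DD f [t *\<^sub>R h] x = t * DD f [h] x"
    using linear_cmul[OF DD1_linear[OF sc_open[OF sc] sc_smooth_le[OF sc] assms(2)], of t h] by simp
  moreover have "\<bar>t * DD f [h] x\<bar> \<le> \<bar>DD f [h] x\<bar>"
    using assms(4) by (simp add: abs_mult mult_left_le_one_le)
  ultimately show ?thesis by linarith
qed

lemma sc_barrier_add:
  assumes f: "sc_barrier D f" and g: "sc_barrier E g"
  shows "sc_barrier (D \<inter> E) (\<lambda>x. f x + g x)"
  unfolding sc_barrier_def
proof (intro conjI ballI allI impI)
  show o: "open (D \<inter> E)" using f g by (auto simp: sc_barrier_def)
  show "convex (D \<inter> E)" using f g by (auto simp: sc_barrier_def intro: convex_Int)
  have sf: "smooth_on 3 (D \<inter> E) f"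
    using smooth_on_subset[OF sc_open[OF f] o _ sc_smooth[OF f]] by simp
  have sg: "smooth_on 3 (D \<inter> E) g"
    using smooth_on_subset[OF sc_open[OF g] o _ sc_smooth[OF g]] by simp
  show "smooth_on 3 (D \<inter> E) (\<lambda>x. f x + g x)" by (rule smooth_on_add[OF o sf sg])
  fix x assume x: "x \<in> D \<inter> E"
  fix h
  have add: "DD (\<lambda>x. f x + g x) hs x = DD f hs x + DD g hs x" if "length hs \<le> 3" for hs
    by (rule DD_add[OF o smooth_on_mono[OF o sf that] smooth_on_mono[OF o sg that] x])
  have e2: "DD (\<lambda>x. f x + g x) [h, h] x = DD f [h, h] x + DD g [h, h] x" by (rule add) simp
  have e3: "DD (\<lambda>x. f x + g x) [h, h, h] x = DD f [h, h, h] x + DD g [h, h, h] x" by (rule add) simp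
  have p: "0 \<le> DD f [h, h] x" "0 \<le> DD g [h, h] x"
    using sc_D2_nonneg[OF f] sc_D2_nonneg[OF g] x by auto
  then show "0 \<le> DD (\<lambda>x. f x + g x) [h, h] x" unfolding e2 by simp
  \<comment> \<open>Superadditivity of the power 3/2 lets the bounds on the third derivatives add up
    without a worse constant.\<close>
  have "u powr (3/2) + v powr (3/2) \<le> (u + v) powr (3/2)" if uv: "0 \<le> u" "0 \<le> v" for u v :: real
  proof -
    have "u powr (3/2) = u * sqrt u" "v powr (3/2) = v * sqrt v" "(u + v) powr (3/2) = (u + v) * sqrt (u + v)"
      using uv by (simp_all add: powr_three_halves power3_eq_cube)
    moreover have "u * sqrt u \<le> u * sqrt (u + v)" "v * sqrt v \<le> v * sqrt (u + v)"
      using uv by (auto intro!: mult_left_mono)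
    ultimately show ?thesis by (simp add: algebra_simps)
  qed
  from this[OF p] show "DD (\<lambda>x. f x + g x) [h, h, h] x \<le> 2 * DD (\<lambda>x. f x + g x) [h, h] x powr (3 / 2)"
    using f g x unfolding e2 e3 sc_barrier_def by (smt (verit) IntD1 IntD2)
  fix C
  assume *: "\<forall>t\<in>{0..<1}. x + t *\<^sub>R h \<in> D \<inter> E \<and> f (x + t *\<^sub>R h) + g (x + t *\<^sub>R h) \<le> C"
  have "\<forall>t\<in>{0..<1}. x + t *\<^sub>R h \<in> D \<and> f (x + t *\<^sub>R h) \<le> C - (g x - \<bar>DD g [h] x\<bar>)"
    using * sc_barrier_segment_lower[OF g, of x _ h] x by (smt (verit) IntD1 IntD2)
  moreover have "\<forall>t\<in>{0..<1}. x + t *\<^sub>R h \<in> E \<and> g (x + t *\<^sub>R h) \<le> C - (f x - \<bar>DD f [h] x\<bar>)"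
    using * sc_barrier_segment_lower[OF f, of x _ h] x by (smt (verit) IntD1 IntD2)
  ultimately show "x + h \<in> D \<inter> E" using f g x unfolding sc_barrier_def by blast
qed

lemma sc_barrier_sum:
  assumes "finite I" "I \<noteq> {}" "\<And>i. i \<in> I \<Longrightarrow> sc_barrier (D i) (f i)"
  shows "sc_barrier (\<Inter>i\<in>I. D i) (\<lambda>x. \<Sum>i\<in>I. f i x)"
  using assms
proof (induction I rule: finite_ne_induct)
  case (singleton i) then show ?case by simp
next
  case (insert i I)
  then show ?case using sc_barrier_add[of "D i" "f i" "\<Inter>i\<in>I. D i" "\<lambda>x. \<Sum>i\<in>I. f i x"] by simp
qed

lemma sc_barrier_ln: "sc_barrier {0<..} (\<lambda>x::real. - ln x)"
  unfolding sc_barrier_def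
proof (intro conjI ballI allI impI)
  show "smooth_on 3 {0<..} (\<lambda>x::real. - ln x)"
    using smooth_on_mult[OF _ smooth_on_const[of _ _ "- 1"] smooth_on_ln, of 3] by simp
  fix x :: real assume x: "x \<in> {0<..}"
  fix h :: real
  define U where "U = ({0<..} :: real set)"
  have U: "open U" and xU: "x \<in> U" using x by (simp_all add: U_def)
  have d1: "DD (\<lambda>x. - ln x) [h] (x + t *\<^sub>R h) = - h / (x + t * h)" if "x + t *\<^sub>R h \<in> U" for t
    by (rule DD_line_unique[where g="\<lambda>t. - ln (x + t * h)", OF U xU _ _ that])
       (auto simp: U_def intro!: derivative_eq_intros)
  have d2: "DD (\<lambda>x. - ln x) [h, h] (x + t *\<^sub>R h) = h\<^sup>2 / (x + t * h)\<^sup>2" if "x + t *\<^sub>R h \<in> U" for t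
    by (rule DD_line_unique[where g="\<lambda>t. - h / (x + t * h)", OF U xU d1 _ that])
       (auto simp: U_def power2_eq_square intro!: derivative_eq_intros)
  have d3: "DD (\<lambda>x. - ln x) [h, h, h] (x + t *\<^sub>R h) = - 2 * h^3 / (x + t * h)^3" if "x + t *\<^sub>R h \<in> U" for t
    by (rule DD_line_unique[where g="\<lambda>t. h\<^sup>2 / (x + t * h)\<^sup>2", OF U xU d2 _ that])
       (auto simp: U_def power2_eq_square power3_eq_cube divide_simps intro!: derivative_eq_intros)
  have e2: "DD (\<lambda>x. - ln x) [h, h] x = (h / x)\<^sup>2" and e3: "DD (\<lambda>x. - ln x) [h, h, h] x = - 2 * (h / x)^3"
    using d2[of 0] d3[of 0] xU by (simp_all add: power_divide del: DD.simps)
  show "0 \<le> DD (\<lambda>x. - ln x) [h, h] x" unfolding e2 by simp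
  have "- ((h / x)^3) \<le> \<bar>h / x\<bar>^3" by (metis abs_ge_minus_self power_abs)
  then show "DD (\<lambda>x. - ln x) [h, h, h] x \<le> 2 * DD (\<lambda>x. - ln x) [h, h] x powr (3 / 2)"
    unfolding e2 e3 by (simp add: powr_three_halves)
  fix C assume *: "\<forall>t\<in>{0..<1}. x + t *\<^sub>R h \<in> {0<..} \<and> - ln (x + t *\<^sub>R h) \<le> C"
  \<comment> \<open>A bound on \<open>- ln\<close> keeps the argument away from 0 uniformly, hence
    also in the limit.\<close>
  have "exp (- C) \<le> x + t * h" if "t \<in> {0..<1}" for t
  proof -
    have "0 < x + t * h \<and> - ln (x + t * h) \<le> C" using * that by auto
    then have "0 < x + t * h" "- C \<le> ln (x + t * h)" by linarith+
    then show ?thesis by (metis exp_le_cancel_iff exp_ln)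
  qed
  moreover have "((\<lambda>t. x + t * h) \<longlongrightarrow> x + 1 * h) (at_left 1)" by (intro tendsto_intros)
  ultimately have "exp (- C) \<le> x + 1 * h"
    by (intro tendsto_lowerbound[where F="at_left 1" and f="\<lambda>t. x + t * h"])
       (auto simp: eventually_at_left_field intro!: exI[of _ 0])
  then show "x + h \<in> {0<..}" by (simp add: less_le_trans[OF exp_gt_zero])
qed auto

subsection \<open>Subspaces, cones and Riesz representatives\<close>

lemma riesz_eqI:
  assumes "subspace E" "g \<in> E" "\<And>h. h \<in> E \<Longrightarrow> g \<bullet> h = l h"
  shows "riesz E l = g"
  unfolding riesz_def
proof (rule the_equality)
  fix g' assume g': "g' \<in> E \<and> (\<forall>h\<in>E. g' \<bullet> h = l h)"
  then have "(g' - g) \<bullet> (g' - g) = 0"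
    using assms subspace_diff[OF assms(1), of g' g] by (simp add: inner_diff_left)
  then show "g' = g" by simp
qed (use assms in auto)

text \<open>\<open>riesz\<close> is a definite description. A functional that is linear on
  \<open>E\<close> has a representative: the one of its linear extension in the whole space,
  projected to \<open>E\<close>.\<close>

lemma riesz_linear:
  fixes l l' :: "'a::euclidean_space \<Rightarrow> real"
  assumes E: "subspace E" and l': "linear l'" and eq: "\<And>h. h \<in> E \<Longrightarrow> l h = l' h"
  shows "riesz E l \<in> E" and "h \<in> E \<Longrightarrow> riesz E l \<bullet> h = l h"
proof -
  define g where "g = (\<Sum>b\<in>Basis. l' b *\<^sub>R b)"
  have g: "g \<bullet> h = l' h" for h
  proof -
    have "l' h = l' (\<Sum>b\<in>Basis. (h \<bullet> b) *\<^sub>R b)" by (simp add: euclidean_representation)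
    also have "\<dots> = (\<Sum>b\<in>Basis. (h \<bullet> b) * l' b)" by (simp add: linear_sum[OF l'] linear_cmul[OF l'])
    also have "\<dots> = g \<bullet> h" by (simp add: g_def inner_sum_left inner_commute[of h] mult.commute)
    finally show ?thesis by simp
  qed
  obtain y z where yz: "y \<in> span E" "\<And>w. w \<in> span E \<Longrightarrow> orthogonal z w" "g = y + z"
    by (rule orthogonal_subspace_decomp_exists[of E g]) blast
  have sp: "span E = E" using E by (simp add: span_eq_iff)
  have y: "y \<in> E" "\<And>h. h \<in> E \<Longrightarrow> y \<bullet> h = l h"
    using yz g eq by (auto simp: sp orthogonal_def inner_add_left) (metis add.right_neutral inner_add_left)
  have "riesz E l = y" by (rule riesz_eqI[OF E y])
  then show "riesz E l \<in> E" "h \<in> E \<Longrightarrow> riesz E l \<bullet> h = l h" using y by auto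
qed

definition proj :: "'a::euclidean_space set \<Rightarrow> 'a \<Rightarrow> 'a" where
  "proj E x = riesz E (\<lambda>h. x \<bullet> h)"

lemma proj_props:
  assumes "subspace E"
  shows "proj E x \<in> E" and "h \<in> E \<Longrightarrow> proj E x \<bullet> h = x \<bullet> h" and "x \<in> E \<Longrightarrow> proj E x = x"
proof -
  have l: "linear (\<lambda>h. x \<bullet> h)" by (simp add: linear_iff inner_add_right)
  show "proj E x \<in> E" "h \<in> E \<Longrightarrow> proj E x \<bullet> h = x \<bullet> h"
    unfolding proj_def using riesz_linear[OF assms l] by auto
  show "x \<in> E \<Longrightarrow> proj E x = x" unfolding proj_def by (rule riesz_eqI[OF assms]) auto
qed

lemma linear_proj:
  assumes E: "subspace E"
  shows "linear (proj E)"
proof -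
  note p = proj_props[OF E]
  show ?thesis
  proof (rule linearI)
    fix x y and c :: real
    show "proj E (x + y) = proj E x + proj E y"
      unfolding proj_def[of E "x + y"]
      by (rule riesz_eqI[OF E]) (auto simp: p inner_add_left intro: subspace_add[OF E])
    show "proj E (c *\<^sub>R x) = c *\<^sub>R proj E x"
      unfolding proj_def[of E "c *\<^sub>R x"]
      by (rule riesz_eqI[OF E]) (auto simp: p intro: subspace_scale[OF E])
  qed
qed

lemma proj_symmetric:
  assumes "subspace E"
  shows "proj E x \<bullet> y = x \<bullet> proj E y"
  using proj_props[OF assms] by (metis inner_commute)

lemma int_in_iff:
  "x \<in> int_in E S \<longleftrightarrow> x \<in> E \<and> (\<exists>e>0. \<forall>y\<in>E. dist x y < e \<longrightarrow> y \<in> S)"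
proof
  assume "x \<in> int_in E S"
  then obtain T where T: "openin (top_of_set E) T" "x \<in> T" "T \<subseteq> S"
    by (auto simp: int_in_def interior_of_def)
  then show "x \<in> E \<and> (\<exists>e>0. \<forall>y\<in>E. dist x y < e \<longrightarrow> y \<in> S)"
    unfolding openin_euclidean_subtopology_iff by (metis dist_commute subset_iff)
next
  assume *: "x \<in> E \<and> (\<exists>e>0. \<forall>y\<in>E. dist x y < e \<longrightarrow> y \<in> S)"
  then obtain e where e: "e > 0" "\<forall>y\<in>E. dist x y < e \<longrightarrow> y \<in> S" by blast
  have "openin (top_of_set E) (E \<inter> ball x e)" by (simp add: openin_open_Int)
  moreover have "x \<in> E \<inter> ball x e" "E \<inter> ball x e \<subseteq> S" using * e by auto
  ultimately show "x \<in> int_in E S" unfolding int_in_def interior_of_def by blast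
qed

lemma int_in_subset: "int_in E S \<subseteq> S" "int_in E S \<subseteq> E"
  by (auto simp: int_in_iff)

lemma openin_int_in: "openin (top_of_set E) (int_in E S)"
  by (simp add: int_in_def openin_interior_of)

lemma int_in_add:
  assumes "subspace E" "\<And>x y. x \<in> K \<Longrightarrow> y \<in> K \<Longrightarrow> x + y \<in> K" "x \<in> int_in E K" "k \<in> K" "k \<in> E"
  shows "x + k \<in> int_in E K"
proof -
  obtain e where e: "e > 0" "\<forall>y\<in>E. dist x y < e \<longrightarrow> y \<in> K" and x: "x \<in> E"
    using assms(3) by (auto simp: int_in_iff)
  have "y \<in> K" if "y \<in> E" "dist (x + k) y < e" for y
  proof -
    have "dist x (y - k) < e" using that(2) by (simp add: dist_norm algebra_simps)
    then have "y - k \<in> K" using e(2) subspace_diff[OF assms(1) that(1) assms(5)] by blast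
    then show ?thesis using assms(2)[of "y - k" k] assms(4) by simp
  qed
  then show ?thesis using x e(1) assms by (auto simp: int_in_iff subspace_add)
qed

lemma int_in_scale:
  assumes "subspace E" "\<And>x c. x \<in> K \<Longrightarrow> 0 < c \<Longrightarrow> c *\<^sub>R x \<in> K" "x \<in> int_in E K" "0 < (c::real)"
  shows "c *\<^sub>R x \<in> int_in E K"
proof -
  obtain e where e: "e > 0" "\<forall>y\<in>E. dist x y < e \<longrightarrow> y \<in> K" and x: "x \<in> E"
    using assms(3) by (auto simp: int_in_iff)
  have "y \<in> K" if y: "y \<in> E" "dist (c *\<^sub>R x) y < c * e" for y
  proof -
    have "dist (c *\<^sub>R x) (c *\<^sub>R z) = c * dist x z" for z
      using assms(4) by (simp add: dist_norm flip: scaleR_diff_right)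
    from this[of "y /\<^sub>R c"] have "c * dist x (y /\<^sub>R c) < c * e" using y(2) assms(4) by simp
    then have "dist x (y /\<^sub>R c) < e" using assms(4) by simp
    then have "y /\<^sub>R c \<in> K" using e(2) subspace_scale[OF assms(1) y(1)] by blast
    then show ?thesis using assms(2)[of "y /\<^sub>R c" c] assms(4) by simp
  qed
  then show ?thesis using x e(1) assms(1,4) by (auto simp: int_in_iff subspace_scale intro!: exI[of _ "c * e"])
qed

lemma convex_int_in:
  assumes E: "subspace E" and K: "convex K"
  shows "convex (int_in E K)"
proof (rule convexI)
  fix x y and u v :: real
  assume xy: "x \<in> int_in E K" "y \<in> int_in E K" and uv: "0 \<le> u" "0 \<le> v" "u + v = 1"
  obtain e where e: "e > 0" "\<And>z. z \<in> E \<Longrightarrow> dist x z < e \<Longrightarrow> z \<in> K" using xy by (auto simp: int_in_iff)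
  obtain d where d: "d > 0" "\<And>z. z \<in> E \<Longrightarrow> dist y z < d \<Longrightarrow> z \<in> K" using xy by (auto simp: int_in_iff)
  have xyE: "x \<in> E" "y \<in> E" using xy by (auto simp: int_in_iff)
  define w where "w = u *\<^sub>R x + v *\<^sub>R y"
  have wE: "w \<in> E" using xyE E by (simp add: w_def subspace_add subspace_scale)
  have "z \<in> K" if z: "z \<in> E" "dist w z < min e d" for z
  proof -
    have zw: "z - w \<in> E" using z wE E by (simp add: subspace_diff)
    have "x + (z - w) \<in> K" "y + (z - w) \<in> K"
      using e(2)[of "x + (z - w)"] d(2)[of "y + (z - w)"] z zw xyE E
      by (auto simp: dist_norm norm_minus_commute subspace_add)
    then have "u *\<^sub>R (x + (z - w)) + v *\<^sub>R (y + (z - w)) \<in> K" using K uv by (intro convexD) auto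
    also have "u *\<^sub>R (x + (z - w)) + v *\<^sub>R (y + (z - w)) = w + (u + v) *\<^sub>R (z - w)"
      by (simp add: w_def algebra_simps)
    finally show ?thesis using uv by simp
  qed
  moreover have "0 < min e d" using e(1) d(1) by simp
  ultimately show "u *\<^sub>R x + v *\<^sub>R y \<in> int_in E K" using wE unfolding int_in_iff w_def by blast
qed

lemma dual_cone_props:
  assumes "subspace E"
  shows "convex (dual_cone E K)" "\<And>x y. x \<in> dual_cone E K \<Longrightarrow> y \<in> dual_cone E K \<Longrightarrow> x + y \<in> dual_cone E K"
    "\<And>x c. x \<in> dual_cone E K \<Longrightarrow> 0 \<le> c \<Longrightarrow> c *\<^sub>R x \<in> dual_cone E K"
  using assms by (auto simp: dual_cone_def subspace_def inner_add_left intro!: convexI)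

lemma int_dual_cone_coercive:
  assumes E: "subspace E" and s: "s \<in> int_in E (dual_cone E K)" and KE: "K \<subseteq> E"
  obtains e where "0 < e" "\<And>x. x \<in> K \<Longrightarrow> e * norm x \<le> s \<bullet> x"
proof -
  obtain e where e: "e > 0" "\<forall>y\<in>E. dist s y < e \<longrightarrow> y \<in> dual_cone E K" and sE: "s \<in> E"
    using s by (auto simp: int_in_iff)
  have "(e / 2) * norm x \<le> s \<bullet> x" if x: "x \<in> K" for x
  proof (cases "x = 0")
    case False
    \<comment> \<open>Moving from \<open>s\<close> against the direction of \<open>x\<close> by half
      the radius stays in the dual cone; pairing with \<open>x\<close> yields the linear
      growth.\<close>
    define y where "y = s - (e / 2) *\<^sub>R (x /\<^sub>R norm x)"
    have "y \<in> E" using x KE sE E by (auto simp: y_def intro!: subspace_diff subspace_scale)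
    moreover have "dist s y < e" using False e by (simp add: y_def dist_norm)
    ultimately have "0 \<le> y \<bullet> x" using e(2) x by (auto simp: dual_cone_def)
    then show ?thesis using False by (simp add: y_def inner_diff_left dot_square_norm power2_eq_square field_simps)
  qed simp
  then show thesis using that[of "e / 2"] e by auto
qed

lemma DD_const: "DD (\<lambda>x. c) (h # hs) = (\<lambda>x. 0)"
  by (induction hs arbitrary: h) (simp_all add: dirderiv_def fun_eq_iff)

lemma DD_scale:
  assumes "open U" "smooth_on (length hs) U f" "x \<in> U"
  shows "DD f (map (\<lambda>h. c *\<^sub>R h) hs) x = c ^ length hs * DD f hs x"
  using assms(2,3)
proof (induction hs arbitrary: x)
  case Nil then show ?case by simp
next
  case (Cons h hs)
  have d: "DD f hs differentiable (at x)"
    using DD_differentiable[OF assms(1) Cons.prems(1) _ Cons.prems(2)] by simp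
  have "dirderiv (DD f (map (\<lambda>h. c *\<^sub>R h) hs)) (c *\<^sub>R h) x = dirderiv (\<lambda>x. c ^ length hs * DD f hs x) (c *\<^sub>R h) x"
    using Cons smooth_on_mono[OF assms(1) Cons.prems(1), of "length hs"] by (intro dirderiv_cong[OF assms(1)]) auto
  also have "\<dots> = c ^ length hs * dirderiv (DD f hs) (c *\<^sub>R h) x"
    by (intro dirderiv_eq) (auto intro!: derivative_eq_intros has_derivative_dirderiv d)
  also have "dirderiv (DD f hs) (c *\<^sub>R h) x = c * dirderiv (DD f hs) h x"
    using linear_cmul[OF linear_dirderiv[OF d], of c h] by simp
  finally show ?case by simp
qed

subsection \<open>Self-scaled barriers\<close>

locale self_scaled_block =
  fixes E K :: "'a::euclidean_space set" and \<nu> :: real and F :: "'a \<Rightarrow> real"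
  assumes subE: "subspace E" and ss: "self_scaled E K \<nu> F" and fo: "fourth_order_condition E K F"
begin

abbreviation "I \<equiv> int_in E K"
abbreviation "Ks \<equiv> dual_cone E K"
abbreviation "Is \<equiv> int_in E Ks"
abbreviation "p \<equiv> proj E"

text \<open>Outside the interior of the cone \<open>F\<close> is arbitrary, and derivatives across
  \<open>E\<close> say nothing. Extending \<open>F\<close> constantly along the orthogonal
  complement gives a function on the open set \<open>U\<close> with the same derivatives at points
  of \<open>E\<close> in directions of \<open>E\<close>.\<close>

definition Fp :: "'a \<Rightarrow> real" where "Fp x = F (p x)"
definition U :: "'a set" where "U = {x. p x \<in> I}"

lemma p_in [simp]: "p x \<in> E" and p_id [simp]: "x \<in> E \<Longrightarrow> p x = x"
  and p_inner: "h \<in> E \<Longrightarrow> p x \<bullet> h = x \<bullet> h"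
  using proj_props[OF subE] by auto

lemma linp: "linear p" by (rule linear_proj[OF subE])

lemma nb: "normal_barrier E K \<nu> F" and pc: "proper_cone E K" and nu1: "1 \<le> \<nu>"
  and scF: "self_concordant E I F"
  using ss by (auto simp: self_scaled_def normal_barrier_def)

lemma K_props: "K \<subseteq> E" "closed K" "convex K" "cone K" "K \<inter> uminus ` K = {0}" "I \<noteq> {}"
  using pc by (auto simp: proper_cone_def)

lemma K_scale: "x \<in> K \<Longrightarrow> 0 \<le> c \<Longrightarrow> c *\<^sub>R x \<in> K"
  using K_props(4) by (auto simp: cone_def)

lemma K_add:
  assumes "x \<in> K" "y \<in> K"
  shows "x + y \<in> K"
proof -
  have "(1/2) *\<^sub>R x + (1/2) *\<^sub>R y \<in> K" using assms K_props(3) by (intro convexD) auto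
  then have "2 *\<^sub>R ((1/2) *\<^sub>R x + (1/2) *\<^sub>R y) \<in> K" by (rule K_scale) simp
  then show ?thesis by (simp add: scaleR_add_right)
qed

lemma I_sub: "x \<in> I \<Longrightarrow> x \<in> E" "x \<in> I \<Longrightarrow> x \<in> K"
  using int_in_subset by blast+

lemma Is_sub: "s \<in> Is \<Longrightarrow> s \<in> E" "s \<in> Is \<Longrightarrow> s \<in> Ks"
  using int_in_subset by blast+

lemma I_add: "x \<in> I \<Longrightarrow> k \<in> K \<Longrightarrow> x + k \<in> I"
  using K_props(1) by (intro int_in_add[OF subE K_add]) auto

lemma Is_add: "s \<in> Is \<Longrightarrow> k \<in> Ks \<Longrightarrow> s + k \<in> Is"
  by (intro int_in_add[OF subE dual_cone_props(2)[OF subE]]) (auto simp: dual_cone_def)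

lemma I_scale: "x \<in> I \<Longrightarrow> 0 < c \<Longrightarrow> c *\<^sub>R x \<in> I"
  by (intro int_in_scale[OF subE]) (auto simp: K_scale)

lemma Is_scale: "s \<in> Is \<Longrightarrow> 0 < c \<Longrightarrow> c *\<^sub>R s \<in> Is"
  by (intro int_in_scale[OF subE]) (auto simp: dual_cone_props(3)[OF subE])

lemma convex_I: "convex I" and convex_Is: "convex Is"
  using convex_int_in[OF subE] K_props(3) dual_cone_props(1)[OF subE] by auto

lemma U_I: "x \<in> I \<Longrightarrow> x \<in> U"
  using I_sub by (simp add: U_def)

lemma Fp_I: "x \<in> I \<Longrightarrow> Fp x = F x"
  using I_sub by (simp add: Fp_def)

lemma U_E: "x \<in> U \<Longrightarrow> x \<in> E \<Longrightarrow> x \<in> I"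
  by (simp add: U_def)

lemma continuous_p: "continuous_on S p"
  using linp by (simp add: linear_continuous_on linear_conv_bounded_linear)

lemma open_U: "open U"
proof -
  obtain T where T: "open T" "I = E \<inter> T" using openin_int_in[of E K] by (auto simp: openin_open)
  have "U = p -` T" using T by (auto simp: U_def)
  then show ?thesis using open_vimage[OF T(1) continuous_p] by simp
qed

lemma DD_Fp: "DD Fp hs x = DD F (map p hs) (p x)"
  using DD_affine[OF linp, of F 0 hs x] by (simp add: Fp_def[abs_def])

lemma DD_Fp_E:
  assumes "x \<in> E" "set hs \<subseteq> E"
  shows "DD Fp hs x = DD F hs x"
proof -
  have "map p hs = hs" using assms(2) by (intro map_idI) auto
  then show ?thesis using assms(1) by (simp add: DD_Fp)
qed

text \<open>The derivative of the composition along \<open>h\<close> is the derivative of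
  \<open>f\<close> along \<open>p h\<close>, again composed with \<open>p\<close>; so smoothness
  relative to \<open>E\<close> passes to the open set \<open>U\<close> order by order.\<close>

lemma smooth_comp_p: "C_k_on k E I f \<Longrightarrow> smooth_on k U (\<lambda>x. f (p x))"
proof (induction k arbitrary: f)
  case 0
  then show ?case using continuous_p by (auto simp: U_def intro!: continuous_on_compose2[of I f])
next
  case (Suc k)
  have "(\<lambda>x. f (p x)) differentiable (at x)" if x: "x \<in> U" for x
  proof -
    have "f differentiable (at (p x) within I)"
      using Suc.prems x by (auto simp: C_k_on.simps differentiable_on_def U_def)
    then have "f differentiable (at (p x) within (p ` U))"
      by (rule differentiable_within_subset) (auto simp: U_def)
    moreover have "p differentiable (at x within U)"
      using linp by (simp add: linear_imp_differentiable)
    ultimately have "(f \<circ> p) differentiable (at x within U)" by (intro differentiable_chain_within)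
    then show ?thesis using at_within_open[OF x open_U] by (simp add: comp_def)
  qed
  moreover have "smooth_on k U (dirderiv (\<lambda>x. f (p x)) h)" for h
  proof -
    have "dirderiv (\<lambda>x. f (p x)) h = (\<lambda>x. dirderiv f (p h) (p x))"
      using linp by (simp add: dirderiv_def fun_eq_iff linear_add linear_cmul)
    moreover have "C_k_on k E I (dirderiv f (p h))" using Suc.prems by (simp add: C_k_on.simps)
    ultimately show ?thesis using Suc.IH by simp
  qed
  ultimately show ?case by (simp add: smooth_on_Suc[OF open_U])
qed

lemma smooth4: "smooth_on 4 U Fp"
  using smooth_comp_p[of 4 F] fo by (simp add: fourth_order_condition_def Fp_def[abs_def])

lemma smooth_le: "k \<le> 4 \<Longrightarrow> smooth_on k U Fp"
  using smooth_on_mono[OF open_U smooth4] .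

lemma grad_inner:
  assumes "x \<in> I"
  shows "grad E F x \<in> E" and "h \<in> E \<Longrightarrow> grad E F x \<bullet> h = DD Fp [h] x"
proof -
  have l: "linear (\<lambda>h. DD Fp [h] x)" using DD1_linear[OF open_U smooth_le U_I[OF assms]] by simp
  have eq: "DD F [h] x = DD Fp [h] x" if "h \<in> E" for h
    using DD_Fp_E[of x "[h]"] assms I_sub that by simp
  show "grad E F x \<in> E" "h \<in> E \<Longrightarrow> grad E F x \<bullet> h = DD Fp [h] x"
    unfolding grad_def using riesz_linear[OF subE l eq] eq by auto
qed

lemma hess_inner:
  assumes "x \<in> I" "h \<in> E"
  shows "hess E F x h \<in> E" and "k \<in> E \<Longrightarrow> hess E F x h \<bullet> k = DD Fp [h, k] x"
proof -
  have l: "linear (\<lambda>k. DD Fp [h, k] x)" using DD2_linear(2)[OF open_U smooth_le U_I[OF assms(1)]] by simp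
  have eq: "DD F [h, k] x = DD Fp [h, k] x" if "k \<in> E" for k
    using DD_Fp_E[of x "[h, k]"] assms I_sub that by simp
  show "hess E F x h \<in> E" "k \<in> E \<Longrightarrow> hess E F x h \<bullet> k = DD Fp [h, k] x"
    unfolding hess_def using riesz_linear[OF subE l eq] eq by auto
qed

text \<open>Closedness of the epigraph in sequential form: \<open>F\<close> cannot stay bounded
  along a sequence that approaches a point outside its domain.\<close>

lemma closed_barrier:
  assumes "\<And>n. X n \<in> I" "\<And>n. F (X n) \<le> C" "X \<longlonglongrightarrow> x"
  shows "x \<in> I" and "F x \<le> C"
proof -
  have "closed (epigraph I F)" using scF by (simp add: self_concordant_def)
  moreover have "(\<lambda>n. (X n, C)) \<longlonglongrightarrow> (x, C)" by (intro tendsto_intros assms)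
  moreover have "(X n, C) \<in> epigraph I F" for n using assms by (simp add: epigraph_def)
  ultimately have "(x, C) \<in> epigraph I F" by (meson closed_sequentially)
  then show "x \<in> I" "F x \<le> C" by (auto simp: epigraph_def)
qed

lemma sc_Fp: "sc_barrier U Fp"
  unfolding sc_barrier_def
proof (intro conjI ballI allI impI)
  show "convex U"
  proof (rule convexI)
    fix x y and u v :: real assume "x \<in> U" "y \<in> U" "0 \<le> u" "0 \<le> v" "u + v = 1"
    then show "u *\<^sub>R x + v *\<^sub>R y \<in> U"
      using convexD[OF convex_I, of "p x" "p y" u v] linp by (simp add: U_def linear_add linear_cmul)
  qed
  show "smooth_on 3 U Fp" by (rule smooth_le) simp
  fix x h assume x: "x \<in> U"
  then have px: "p x \<in> I" by (simp add: U_def)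
  have e: "DD Fp [h, h] x = DD F [p h, p h] (p x)" "DD Fp [h, h, h] x = DD F [p h, p h, p h] (p x)"
    by (simp_all add: DD_Fp del: DD.simps)
  \<comment> \<open>The Hessian is nonnegative because the barrier inequality bounds a square by
    \<nu> times it.\<close>
  have "0 \<le> (grad E F (p x) \<bullet> p h)\<^sup>2" by simp
  also have "\<dots> \<le> \<nu> * (hess E F (p x) (p h) \<bullet> p h)"
    using nb px by (simp add: normal_barrier_def)
  also have "hess E F (p x) (p h) \<bullet> p h = DD Fp [h, h] x"
    using hess_inner(2)[OF px, of "p h" "p h"] by (simp add: DD_Fp del: DD.simps)
  finally show "0 \<le> DD Fp [h, h] x" using nu1 by (simp add: zero_le_mult_iff)
  show "DD Fp [h, h, h] x \<le> 2 * DD Fp [h, h] x powr (3 / 2)"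
    using scF px unfolding e self_concordant_def by simp
  fix C
  assume *: "\<forall>t\<in>{0..<1}. x + t *\<^sub>R h \<in> U \<and> Fp (x + t *\<^sub>R h) \<le> C"
  define t where "t n = 1 - inverse (real (Suc n))" for n
  have t: "t n \<in> {0..<1}" for n by (simp add: t_def inverse_le_1_iff)
  have "t \<longlonglongrightarrow> 1 - 0" unfolding t_def by (intro tendsto_intros LIMSEQ_inverse_real_of_nat)
  then have lim: "(\<lambda>n. p x + t n *\<^sub>R p h) \<longlonglongrightarrow> p x + (1 - 0) *\<^sub>R p h" by (intro tendsto_intros)
  have "p x + t n *\<^sub>R p h \<in> I" "F (p x + t n *\<^sub>R p h) \<le> C" for n
    using bspec[OF * t[of n]] linp by (simp_all add: U_def Fp_def linear_add linear_cmul)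
  from closed_barrier(1)[OF this lim] have "p x + (1 - 0) *\<^sub>R p h \<in> I" .
  then show "x + h \<in> U" using linp by (simp add: U_def linear_add)
qed (rule open_U)

subsubsection \<open>Logarithmic homogeneity\<close>

lemma log_homogeneous: "x \<in> I \<Longrightarrow> 0 < t \<Longrightarrow> F (t *\<^sub>R x) = F x - \<nu> * ln t"
  using nb by (simp add: normal_barrier_def)

lemma zero_notin_I: "0 \<notin> I"
proof
  assume "0 \<in> I"
  from log_homogeneous[OF this, of 2] have "\<nu> * ln 2 = 0" by simp
  then show False using nu1 by simp
qed

text \<open>Differentiating \<open>F y = F (c *\<^sub>R y) + \<nu> * ln c\<close> removes the
  logarithm and puts a factor \<open>c\<close> into every slot.\<close>

lemma DD_homogeneous:
  assumes "x \<in> I" "0 < t" "hs \<noteq> []" "length hs \<le> 4"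
  shows "DD Fp hs (t *\<^sub>R x) = inverse t ^ length hs * DD Fp hs x"
proof -
  define c where "c = inverse t"
  have c: "0 < c" using assms by (simp add: c_def)
  have lin: "linear (\<lambda>y. c *\<^sub>R y)" by (simp add: linear_scaleR)
  have cU: "c *\<^sub>R y \<in> U" if "y \<in> U" for y
    using that I_scale[of "p y" c] c linp by (simp add: U_def linear_cmul)
  have eq: "Fp y = Fp (0 + c *\<^sub>R y) + \<nu> * ln c" if "y \<in> U" for y
    using that log_homogeneous[of "p y" c] c linp by (simp add: U_def Fp_def linear_cmul)
  have tx: "t *\<^sub>R x \<in> U" using assms I_scale U_I by blast
  have "DD Fp hs (t *\<^sub>R x) = DD (\<lambda>y. Fp (0 + c *\<^sub>R y) + \<nu> * ln c) hs (t *\<^sub>R x)"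
    by (rule DD_cong[OF open_U eq tx])
  also have "\<dots> = DD (\<lambda>y. Fp (0 + c *\<^sub>R y)) hs (t *\<^sub>R x) + DD (\<lambda>y. \<nu> * ln c) hs (t *\<^sub>R x)"
  proof (rule DD_add[OF open_U _ smooth_on_const[OF open_U] tx])
    show "smooth_on (length hs) U (\<lambda>y. Fp (0 + c *\<^sub>R y))"
      by (rule smooth_on_affine[OF open_U open_U lin smooth_le[OF assms(4)]]) (use cU in simp)
  qed
  also have "DD (\<lambda>y. \<nu> * ln c) hs (t *\<^sub>R x) = 0"
    using assms(3) DD_const by (metis list.exhaust)
  also have "DD (\<lambda>y. Fp (0 + c *\<^sub>R y)) hs (t *\<^sub>R x) = DD Fp (map (\<lambda>y. c *\<^sub>R y) hs) x"
    unfolding DD_affine[OF lin] using assms(2) by (simp add: c_def)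
  also have "\<dots> = c ^ length hs * DD Fp hs x"
    by (rule DD_scale[OF open_U smooth_le[OF assms(4)] U_I[OF assms(1)]])
  finally show ?thesis by (simp add: c_def)
qed

lemma euler_0:
  assumes "x \<in> I"
  shows "DD Fp [x] x = - \<nu>"
proof -
  have "((\<lambda>s. Fp x - \<nu> * ln (1 + s)) has_real_derivative - \<nu>) (at 0)"
    by (auto intro!: derivative_eq_intros)
  then have "((\<lambda>s. Fp (x + s *\<^sub>R x)) has_real_derivative - \<nu>) (at 0)"
  proof (rule has_field_derivative_transform_within_open[where S="{-1<..}"])
    fix s :: real assume s: "s \<in> {-1<..}"
    have "x + s *\<^sub>R x = (1 + s) *\<^sub>R x" by (simp add: scaleR_add_left)
    then show "Fp x - \<nu> * ln (1 + s) = Fp (x + s *\<^sub>R x)"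
      using log_homogeneous[OF assms, of "1 + s"] I_scale[OF assms, of "1 + s"] s assms by (simp add: Fp_I)
  qed auto
  moreover have "((\<lambda>s. DD Fp [] (x + s *\<^sub>R x)) has_real_derivative DD Fp [x] (x + 0 *\<^sub>R x)) (at 0)"
    using U_I[OF assms] by (intro DD_line[OF open_U smooth4]) auto
  ultimately show ?thesis using DERIV_unique by fastforce
qed

text \<open>Euler's identity: differentiate the homogeneity of the derivative along the ray
  \<open>(1 + s) *\<^sub>R x\<close> at \<open>s = 0\<close>.\<close>

lemma euler:
  assumes "x \<in> I" "hs \<noteq> []" "length hs \<le> 3"
  shows "DD Fp (x # hs) x = - real (length hs) * DD Fp hs x"
proof -
  define k where "k = length hs"
  have "((\<lambda>s. inverse (1 + s) ^ k * DD Fp hs x) has_real_derivative - real k * DD Fp hs x) (at 0)"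
    by (auto intro!: derivative_eq_intros)
  then have "((\<lambda>s. DD Fp hs (x + s *\<^sub>R x)) has_real_derivative - real k * DD Fp hs x) (at 0)"
  proof (rule has_field_derivative_transform_within_open[where S="{-1<..}"])
    fix s :: real assume s: "s \<in> {-1<..}"
    have "x + s *\<^sub>R x = (1 + s) *\<^sub>R x" by (simp add: scaleR_add_left)
    then show "inverse (1 + s) ^ k * DD Fp hs x = DD Fp hs (x + s *\<^sub>R x)"
      using DD_homogeneous[OF assms(1), of "1 + s" hs] assms s by (simp add: k_def)
  qed auto
  moreover have "((\<lambda>s. DD Fp hs (x + s *\<^sub>R x)) has_real_derivative DD Fp (x # hs) (x + 0 *\<^sub>R x)) (at 0)"
    using U_I[OF assms(1)] assms(3) by (intro DD_line[OF open_U smooth4]) auto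
  ultimately show ?thesis using DERIV_unique unfolding k_def by fastforce
qed

text \<open>Along the ray through an interior \<open>y\<close> the barrier falls like
  \<open>- \<nu> * ln t\<close>, whereas a positive slope would make its tangent at \<open>x\<close>
  grow linearly. Boundary directions are limits of interior ones.\<close>

lemma DD1_nonpos:
  assumes x: "x \<in> I" and k: "k \<in> K"
  shows "DD Fp [k] x \<le> 0"
proof -
  have lin: "linear (\<lambda>h. DD Fp [h] x)" using DD1_linear[OF open_U smooth_le U_I[OF x]] by simp
  have int: "DD Fp [y] x \<le> 0" if y: "y \<in> I" for y
  proof (rule ccontr)
    assume "\<not> DD Fp [y] x \<le> 0"
    then have pos: "0 < DD Fp [y] x" by simp
    \<comment> \<open>Large enough for the tangent at \<open>x\<close> to exceed \<open>F y\<close>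
      at the point \<open>t *\<^sub>R y\<close>, and at least 1 so that \<open>\<nu> * ln t\<close>
      is nonnegative.\<close>
    define t where "t = max 1 ((F y - F x - \<nu> + 1) / DD Fp [y] x)"
    have t: "1 \<le> t" "F y - F x - \<nu> + 1 \<le> t * DD Fp [y] x"
      using pos by (auto simp: t_def pos_divide_le_eq[symmetric] simp del: DD.simps)
    have ty: "t *\<^sub>R y \<in> I" using I_scale[OF y] t by simp
    have "Fp x + DD Fp [t *\<^sub>R y - x] x \<le> Fp (x + (t *\<^sub>R y - x))"
      using U_I[OF ty] by (intro sc_tangent_bound[OF sc_Fp U_I[OF x]]) simp
    also have "Fp (x + (t *\<^sub>R y - x)) = F y - \<nu> * ln t"
      using Fp_I[OF ty] log_homogeneous[OF y, of t] t by simp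
    also have "DD Fp [t *\<^sub>R y - x] x = t * DD Fp [y] x + \<nu>"
      using linear_diff[OF lin] linear_cmul[OF lin] euler_0[OF x] by (simp del: DD.simps)
    finally have "Fp x + (t * DD Fp [y] x + \<nu>) \<le> F y - \<nu> * ln t" .
    moreover have "0 \<le> \<nu> * ln t" using nu1 ln_ge_zero[OF t(1)] by simp
    ultimately show False using t(2) Fp_I[OF x] by linarith
  qed
  show ?thesis
  proof (rule field_le_epsilon)
    fix e :: real assume e: "0 < e"
    \<comment> \<open>The slope along \<open>x\<close> is \<open>- \<nu>\<close>, so adding
      \<open>d *\<^sub>R x\<close> costs exactly \<open>e\<close>.\<close>
    define d where "d = e / \<nu>"
    have "0 < d" using e nu1 by (simp add: d_def)
    then have "d *\<^sub>R x + k \<in> I" using I_scale[OF x] I_add k by blast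
    then have "DD Fp [d *\<^sub>R x + k] x \<le> 0" by (rule int)
    also have "DD Fp [d *\<^sub>R x + k] x = - d * \<nu> + DD Fp [k] x"
      using linear_add[OF lin] linear_cmul[OF lin] euler_0[OF x] by (simp del: DD.simps)
    finally show "DD Fp [k] x \<le> 0 + e" using nu1 by (simp add: d_def)
  qed
qed

text \<open>Along a recession direction the slope stays nonpositive for all times, which bounds the curvature at the start.\<close>

lemma lnorm_le_slope:
  assumes x: "x \<in> I" and k: "k \<in> K"
  shows "lnorm Fp x k \<le> - DD Fp [k] x"
proof (rule ccontr)
  define b where "b = lnorm Fp x k"
  define c where "c = - DD Fp [k] x"
  assume "\<not> lnorm Fp x k \<le> - DD Fp [k] x"
  then have bc: "c < b" by (simp add: b_def c_def)
  have c: "0 \<le> c" using DD1_nonpos[OF x k] by (simp add: c_def)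
  have mem: "x + t *\<^sub>R k \<in> U" if "0 \<le> t" for t
    using I_add[OF x K_scale[OF k that]] U_I by blast
  have main: "T * (b * (b - c)) \<le> c" if T: "0 \<le> T" for T
  proof -
    have "DD Fp [k] (x + 0 *\<^sub>R k) + T * (sqrt (DD Fp [k, k] (x + 0 *\<^sub>R k)))\<^sup>2 / (1 + T * sqrt (DD Fp [k, k] (x + 0 *\<^sub>R k)))
      \<le> DD Fp [k] (x + T *\<^sub>R k)"
      by (rule omega_lower_bound(1)[where g="\<lambda>t. DD Fp [] (x + t *\<^sub>R k)" and ?g2.0 = "\<lambda>t. DD Fp [k, k] (x + t *\<^sub>R k)"
            and ?g3.0 = "\<lambda>t. DD Fp [k, k, k] (x + t *\<^sub>R k)", OF T])
         (use mem sc_line[OF sc_Fp] sc_D2_nonneg[OF sc_Fp] sc_D3_bound[OF sc_Fp, unfolded lnorm_def] in \<open>auto simp del: DD.simps\<close>)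
    also have "DD Fp [k] (x + T *\<^sub>R k) \<le> 0"
      by (rule DD1_nonpos[OF I_add[OF x K_scale[OF k T]] k])
    finally have "T * b\<^sup>2 / (1 + T * b) \<le> c" by (simp add: b_def c_def lnorm_def del: DD.simps)
    moreover have "0 < 1 + T * b" using T bc c by (simp add: add_pos_nonneg)
    ultimately have "T * b\<^sup>2 \<le> c * (1 + T * b)" by (simp add: divide_le_eq)
    then show ?thesis by (simp add: power2_eq_square algebra_simps)
  qed
  define m where "m = b * (b - c)"
  have "0 < m" using bc c by (simp add: m_def)
  then show False using main[of "(c + 1) / m"] c by (simp flip: m_def)
qed

subsubsection \<open>The conjugate barrier as a linear image of the barrier\<close>

text \<open>On the slice where \<open>s \<bullet> x = 1\<close> points of the cone have norm at most
  \<open>1 / e\<close>, so the tangent at a fixed point bounds \<open>F\<close> below there.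
  Logarithmic homogeneity carries the bound to all of the interior.\<close>

lemma F_lower_bound:
  assumes s: "s \<in> Is"
  obtains C where "\<And>x. x \<in> I \<Longrightarrow> C - \<nu> * ln (s \<bullet> x) \<le> F x"
proof -
  obtain e where e: "0 < e" "\<And>x. x \<in> K \<Longrightarrow> e * norm x \<le> s \<bullet> x"
    using int_dual_cone_coercive[OF subE s K_props(1)] by blast
  obtain w where w: "w \<in> I" using K_props(6) by blast
  have "linear (\<lambda>h. DD Fp [h] w)" using DD1_linear[OF open_U smooth_le U_I[OF w]] by simp
  then obtain B where B: "\<And>h. \<bar>DD Fp [h] w\<bar> \<le> B * norm h" "0 < B"
    using linear_bounded_pos by (metis real_norm_def)
  define C where "C = F w - B * (1 / e + norm w)"
  have "C - \<nu> * ln (s \<bullet> x) \<le> F x" if x: "x \<in> I" for x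
  proof -
    have "x \<noteq> 0" using x zero_notin_I by auto
    then have "0 < e * norm x" using e(1) by simp
    then have sx: "0 < s \<bullet> x" using e(2)[OF I_sub(2)[OF x]] by simp
    define y where "y = x /\<^sub>R (s \<bullet> x)"
    have y: "y \<in> I" using I_scale[OF x] sx by (simp add: y_def)
    have xy: "x = (s \<bullet> x) *\<^sub>R y" using sx by (simp add: y_def)
    have "s \<bullet> y = 1" using sx by (simp add: y_def)
    then have ny: "norm y \<le> 1 / e" using e(2)[OF I_sub(2)[OF y]] e(1) by (simp add: field_simps)
    have "Fp w + DD Fp [y - w] w \<le> Fp (w + (y - w))"
      using U_I[OF y] by (intro sc_tangent_bound[OF sc_Fp U_I[OF w]]) simp
    moreover have "\<bar>DD Fp [y - w] w\<bar> \<le> B * (1 / e + norm w)"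
      using B(1)[of "y - w"] norm_triangle_ineq4[of y w] ny B(2)
      by (smt (verit) mult_left_mono)
    ultimately have "C \<le> F y" using Fp_I[OF w] Fp_I[OF y] by (simp add: C_def)
    moreover have "F x = F y - \<nu> * ln (s \<bullet> x)" using log_homogeneous[OF y sx] xy by metis
    ultimately show ?thesis by simp
  qed
  then show thesis using that by blast
qed

lemma inner_pos:
  assumes "s \<in> Is" "x \<in> I"
  shows "0 < s \<bullet> x"
proof -
  obtain e where e: "0 < e" "\<And>x. x \<in> K \<Longrightarrow> e * norm x \<le> s \<bullet> x"
    using int_dual_cone_coercive[OF subE assms(1) K_props(1)] by blast
  have "x \<noteq> 0" using assms zero_notin_I by auto
  then have "0 < e * norm x" using e(1) by simp
  then show ?thesis using e(2)[OF I_sub(2)[OF assms(2)]] by simp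
qed

lemma conj_bdd:
  assumes s: "s \<in> Is"
  shows "bdd_above ((\<lambda>x. - (s \<bullet> x) - F x) ` I)"
proof -
  obtain C where C: "\<And>x. x \<in> I \<Longrightarrow> C - \<nu> * ln (s \<bullet> x) \<le> F x" using F_lower_bound[OF s] by blast
  show ?thesis
  proof (rule bdd_aboveI2)
    fix x assume x: "x \<in> I"
    have p: "0 < s \<bullet> x" by (rule inner_pos[OF s x])
    \<comment> \<open>Normalising by \<nu> makes the linear term produced by the logarithm exactly
      \<open>s \<bullet> x\<close>, which cancels.\<close>
    have "ln (s \<bullet> x / \<nu>) \<le> s \<bullet> x / \<nu> - 1" using p nu1 by (intro ln_le_minus_one) simp
    then have "ln (s \<bullet> x) \<le> s \<bullet> x / \<nu> - 1 + ln \<nu>" using p nu1 by (simp add: ln_div)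
    then have "\<nu> * ln (s \<bullet> x) \<le> \<nu> * (s \<bullet> x / \<nu> - 1 + ln \<nu>)" using nu1 by (intro mult_left_mono) auto
    also have "\<dots> = s \<bullet> x - \<nu> + \<nu> * ln \<nu>" using nu1 by (simp add: field_simps)
    finally show "- (s \<bullet> x) - F x \<le> \<nu> * ln \<nu> - \<nu> - C" using C[OF x] by simp
  qed
qed

lemma conj_upper: "s \<in> Is \<Longrightarrow> x \<in> I \<Longrightarrow> - (s \<bullet> x) - F x \<le> conj_barrier E K F s"
  unfolding conj_barrier_def by (intro cSUP_upper conj_bdd)

lemma conj_convex:
  assumes "a \<in> Is" "s \<in> Is" "0 \<le> t" "t \<le> 1"
  shows "conj_barrier E K F ((1 - t) *\<^sub>R a + t *\<^sub>R s) \<le> (1 - t) * conj_barrier E K F a + t * conj_barrier E K F s"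
  unfolding conj_barrier_def[of E K F "(1 - t) *\<^sub>R a + t *\<^sub>R s"]
proof (rule cSUP_least[OF K_props(6)])
  fix x assume x: "x \<in> I"
  have "- (((1 - t) *\<^sub>R a + t *\<^sub>R s) \<bullet> x) - F x = (1 - t) * (- (a \<bullet> x) - F x) + t * (- (s \<bullet> x) - F x)"
    by (simp add: inner_add_left algebra_simps)
  also have "\<dots> \<le> (1 - t) * conj_barrier E K F a + t * conj_barrier E K F s"
    using assms conj_upper[OF _ x] by (intro add_mono mult_left_mono) auto
  finally show "- (((1 - t) *\<^sub>R a + t *\<^sub>R s) \<bullet> x) - F x \<le> (1 - t) * conj_barrier E K F a + t * conj_barrier E K F s" .
qed

lemma hess_Is: "x \<in> I \<Longrightarrow> w \<in> I \<Longrightarrow> hess E F w x \<in> Is"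
  and conj_hess: "x \<in> I \<Longrightarrow> w \<in> I \<Longrightarrow> conj_barrier E K F (hess E F w x) = F x - 2 * F w - \<nu>"
  using ss by (auto simp: self_scaled_def)

lemma hess_linear:
  assumes w: "w \<in> I" and "x \<in> E" "y \<in> E"
  shows "hess E F w (a *\<^sub>R x + b *\<^sub>R y) = a *\<^sub>R hess E F w x + b *\<^sub>R hess E F w y"
proof -
  have lin: "linear (\<lambda>h. DD Fp [h, k] w)" for k using DD2_linear(1)[OF open_U smooth_le U_I[OF w]] by simp
  have E: "a *\<^sub>R x + b *\<^sub>R y \<in> E" using assms subE by (simp add: subspace_add subspace_scale)
  have "riesz E (\<lambda>k. DD F [a *\<^sub>R x + b *\<^sub>R y, k] w) = a *\<^sub>R hess E F w x + b *\<^sub>R hess E F w y"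
  proof (rule riesz_eqI[OF subE])
    show "a *\<^sub>R hess E F w x + b *\<^sub>R hess E F w y \<in> E"
      using assms hess_inner(1)[OF w] subE by (simp add: subspace_add subspace_scale)
    fix k assume k: "k \<in> E"
    have "DD F [a *\<^sub>R x + b *\<^sub>R y, k] w = DD Fp [a *\<^sub>R x + b *\<^sub>R y, k] w"
      using DD_Fp_E[of w "[a *\<^sub>R x + b *\<^sub>R y, k]"] E k I_sub(1)[OF w] by simp
    also have "\<dots> = a * DD Fp [x, k] w + b * DD Fp [y, k] w"
      using linear_add[OF lin] linear_cmul[OF lin] by (simp del: DD.simps)
    finally show "(a *\<^sub>R hess E F w x + b *\<^sub>R hess E F w y) \<bullet> k = DD F [a *\<^sub>R x + b *\<^sub>R y, k] w"
      using assms k by (simp add: inner_add_left hess_inner(2)[OF w] del: DD.simps)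
  qed
  then show ?thesis by (simp add: hess_def)
qed

text \<open>
  In a direction \<open>h\<close> with \<open>F''(w) h = 0\<close> the barrier is constant, by the self-scaled identity; then the
  cone contains the line spanned by \<open>h\<close>.
\<close>

lemma hess_inj:
  assumes w: "w \<in> I" and h: "h \<in> E" "hess E F w h = 0"
  shows "h = 0"
proof -
  have step: "w + h' \<in> I" if h': "h' \<in> E" "hess E F w h' = 0" for h'
  proof -
    have "w + h' \<in> U"
    proof (rule sc_stay[OF sc_Fp U_I[OF w]])
      fix t :: real assume t: "0 \<le> t" and mem: "\<And>s. 0 \<le> s \<Longrightarrow> s \<le> t \<Longrightarrow> w + s *\<^sub>R h' \<in> U"
      have "w + t *\<^sub>R h' \<in> E" using w h' I_sub subE by (simp add: subspace_add subspace_scale)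
      then have I: "w + t *\<^sub>R h' \<in> I" using mem[of t] t U_E by simp
      have "hess E F w (w + t *\<^sub>R h') = hess E F w w"
        using hess_linear[OF w I_sub(1)[OF w] h'(1), of 1 t] h'(2) by simp
      then show "Fp (w + t *\<^sub>R h') \<le> F w" using conj_hess[OF I w] conj_hess[OF w w] Fp_I[OF I] by simp
    qed
    then show ?thesis using w h' I_sub subE U_E by (simp add: subspace_add)
  qed
  have K: "h' \<in> K" if h': "h' \<in> E" "hess E F w h' = 0" for h'
  proof -
    have "inverse (real (Suc n)) *\<^sub>R w + h' \<in> K" for n
    proof -
      have "hess E F w (real (Suc n) *\<^sub>R h' + 0 *\<^sub>R h') = 0" by (subst hess_linear[OF w h'(1) h'(1)]) (simp add: h')
      then have "w + real (Suc n) *\<^sub>R h' \<in> I"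
        using step[of "real (Suc n) *\<^sub>R h'"] h' subE by (simp add: subspace_scale)
      then have "inverse (real (Suc n)) *\<^sub>R (w + real (Suc n) *\<^sub>R h') \<in> K" by (intro K_scale I_sub) auto
      then show ?thesis by (simp add: scaleR_add_right del: of_nat_Suc)
    qed
    moreover have "(\<lambda>n. inverse (real (Suc n)) *\<^sub>R w + h') \<longlonglongrightarrow> 0 *\<^sub>R w + h'"
      by (intro tendsto_intros LIMSEQ_inverse_real_of_nat)
    ultimately have "0 *\<^sub>R w + h' \<in> K" by (rule closed_sequentially[OF K_props(2)])
    then show ?thesis by simp
  qed
  have "hess E F w ((-1) *\<^sub>R h + 0 *\<^sub>R h) = 0" by (subst hess_linear[OF w h(1) h(1)]) (simp add: h)
  then have "- h \<in> K" using K[of "- h"] h(1) subE by (simp add: subspace_neg)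
  moreover have "h \<in> K" by (rule K[OF h])
  ultimately have "h \<in> K \<inter> uminus ` K" by (metis IntI imageI minus_minus)
  then show ?thesis using K_props(5) by simp
qed

definition w0 :: 'a where "w0 = (SOME w. w \<in> I)"

lemma w0: "w0 \<in> I" unfolding w0_def using K_props(6) by (simp add: some_in_eq)

text \<open>The Hessian at \<open>w0\<close> is invertible only on \<open>E\<close>; its inverse is
  extended to the whole space through the projection, so that \<open>F\<^sub>*\<close> becomes
  \<open>F\<close> composed with a globally linear map plus a constant, as stated in
  \<open>conj_eq\<close>.\<close>

definition is_inverse :: "('a \<Rightarrow> 'a) \<Rightarrow> bool" where
  "is_inverse T \<longleftrightarrow> linear T \<and> (\<forall>s. T s \<in> E) \<and> (\<forall>s. T (p s) = T s) \<and>
     (\<forall>s\<in>E. hess E F w0 (T s) = s) \<and> (\<forall>x\<in>E. T (hess E F w0 x) = x)"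

definition T :: "'a \<Rightarrow> 'a" where "T = (SOME T. is_inverse T)"

lemma is_inverse_T: "is_inverse T"
proof -
  define A where "A x = hess E F w0 (p x)" for x
  have linA: "linear A"
  proof (rule linearI)
    fix x y and c :: real
    show "A (x + y) = A x + A y"
      using hess_linear[OF w0 p_in p_in, of 1 x 1 y] linp by (simp add: A_def linear_add)
    show "A (c *\<^sub>R x) = c *\<^sub>R A x"
      using hess_linear[OF w0 p_in p_in, of c x 0 x] linp by (simp add: A_def linear_cmul)
  qed
  have inj: "inj_on A E"
  proof (rule inj_onI)
    fix x y assume xy: "x \<in> E" "y \<in> E" "A x = A y"
    then have "A (x - y) = 0" using linA by (simp add: linear_diff)
    moreover have "x - y \<in> E" using xy subE by (simp add: subspace_diff)
    ultimately show "x = y" using hess_inj[OF w0, of "x - y"] by (simp add: A_def)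
  qed
  obtain S where S: "range S \<subseteq> E" "linear S" "\<forall>v\<in>E. S (A v) = v"
    using linear_exists_left_inverse_on[OF linA subE inj] by auto
  have AE: "A ` E \<subseteq> E" using hess_inner(1)[OF w0] by (auto simp: A_def)
  \<comment> \<open>Injectivity and equality of dimensions give surjectivity, which makes the left
    inverse a right inverse too.\<close>
  have "A ` E = E"
  proof (rule subspace_dim_equal[OF _ subE AE])
    show "subspace (A ` E)" using linear_subspace_image[OF linA subE] .
    show "dim E \<le> dim (A ` E)"
      using dim_image_eq[OF linA, of E] inj subE by (simp add: span_eq_iff[THEN iffD2])
  qed
  then have AS: "A (S s) = s" if "s \<in> E" for s using that S(3) by (metis imageE)
  have "is_inverse (S \<circ> p)"
    unfolding is_inverse_def
  proof (intro conjI ballI allI)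
    show "linear (S \<circ> p)" using linear_compose[OF linp S(2)] .
    fix s show "(S \<circ> p) s \<in> E" using S(1) by auto
    show "(S \<circ> p) (p s) = (S \<circ> p) s" by simp
  next
    fix s assume s: "s \<in> E"
    have "S s \<in> E" using S(1) by auto
    then show "hess E F w0 ((S \<circ> p) s) = s" using s AS[OF s] by (simp add: A_def)
    show "(S \<circ> p) (hess E F w0 s) = s" using s S(3) hess_inner(1)[OF w0 s] by (simp add: A_def)
  qed
  then show ?thesis unfolding T_def by (rule someI[where P=is_inverse])
qed

lemma linT: "linear T" and T_E [simp]: "T s \<in> E" and T_p [simp]: "T (p s) = T s"
  and hess_T: "s \<in> E \<Longrightarrow> hess E F w0 (T s) = s" and T_hess: "x \<in> E \<Longrightarrow> T (hess E F w0 x) = x"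
  using is_inverse_T by (auto simp: is_inverse_def)

text \<open>
  On the segment from \<open>w0\<close> to \<open>T s\<close> the values of \<open>F\<close> are values of the convex function \<open>F\<^sub>*\<close> on a segment
  in the interior of the dual cone, hence bounded, so the segment cannot reach the boundary of the cone.
\<close>

lemma T_I_iff:
  assumes s: "s \<in> E"
  shows "T s \<in> I \<longleftrightarrow> s \<in> Is"
proof
  assume "T s \<in> I"
  then show "s \<in> Is" using hess_Is[OF _ w0, of "T s"] hess_T[OF s] by simp
next
  assume sI: "s \<in> Is"
  define h where "h = T s - w0"
  have hE: "h \<in> E" using I_sub(1)[OF w0] subE by (simp add: h_def subspace_diff)
  define a where "a = hess E F w0 w0"
  have a: "a \<in> Is" unfolding a_def by (rule hess_Is[OF w0 w0])
  define C where "C = \<bar>conj_barrier E K F a\<bar> + \<bar>conj_barrier E K F s\<bar> + 2 * F w0 + \<nu>"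
  have "w0 + h \<in> U"
  proof (rule sc_stay[OF sc_Fp U_I[OF w0]])
    fix t :: real assume t: "0 \<le> t" "t < 1" and mem: "\<And>r. 0 \<le> r \<Longrightarrow> r \<le> t \<Longrightarrow> w0 + r *\<^sub>R h \<in> U"
    have "w0 + t *\<^sub>R h \<in> E" using I_sub(1)[OF w0] hE subE by (simp add: subspace_add subspace_scale)
    then have I: "w0 + t *\<^sub>R h \<in> I" using mem[of t] t U_E by simp
    have "w0 + t *\<^sub>R h = (1 - t) *\<^sub>R w0 + t *\<^sub>R T s" by (simp add: h_def algebra_simps)
    then have "hess E F w0 (w0 + t *\<^sub>R h) = (1 - t) *\<^sub>R a + t *\<^sub>R s"
      using hess_linear[OF w0 I_sub(1)[OF w0] T_E, of "1 - t" t s] hess_T[OF s] by (simp add: a_def)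
    then have "F (w0 + t *\<^sub>R h) = conj_barrier E K F ((1 - t) *\<^sub>R a + t *\<^sub>R s) + 2 * F w0 + \<nu>"
      using conj_hess[OF I w0] by simp
    also have "\<dots> \<le> (1 - t) * conj_barrier E K F a + t * conj_barrier E K F s + 2 * F w0 + \<nu>"
      using conj_convex[OF a sI t(1)] t by simp
    also have "\<dots> \<le> C"
    proof -
      have "(1 - t) * conj_barrier E K F a \<le> (1 - t) * \<bar>conj_barrier E K F a\<bar>" using t by (intro mult_left_mono) auto
      also have "\<dots> \<le> \<bar>conj_barrier E K F a\<bar>" using t by (intro mult_left_le_one_le) auto
      finally have 1: "(1 - t) * conj_barrier E K F a \<le> \<bar>conj_barrier E K F a\<bar>" .
      have "t * conj_barrier E K F s \<le> t * \<bar>conj_barrier E K F s\<bar>" using t by (intro mult_left_mono) auto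
      also have "\<dots> \<le> \<bar>conj_barrier E K F s\<bar>" using t by (intro mult_left_le_one_le) auto
      finally show ?thesis using 1 by (simp add: C_def)
    qed
    finally show "Fp (w0 + t *\<^sub>R h) \<le> C" using Fp_I[OF I] by simp
  qed
  then show "T s \<in> I" using U_E by (simp add: h_def)
qed

lemma conj_eq:
  assumes "s \<in> Is"
  shows "conj_barrier E K F s = F (T s) - 2 * F w0 - \<nu>"
  using conj_hess[OF _ w0, of "T s"] hess_T[OF Is_sub(1)[OF assms]] T_I_iff[OF Is_sub(1)[OF assms]] assms by simp

text \<open>Adding small multiples of an interior point \<open>s\<close> moves \<open>b\<close> into
  the interior, where \<open>T_I_iff\<close> applies; then the cone is closed.\<close>

lemma T_Ks:
  assumes b: "b \<in> Ks"
  shows "T b \<in> K"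
proof -
  obtain s where s: "s \<in> Is" using hess_Is[OF w0 w0] by blast
  have "inverse (real (Suc n)) *\<^sub>R T s + T b \<in> K" for n
  proof -
    have "inverse (real (Suc n)) *\<^sub>R s + b \<in> Is" by (intro Is_add Is_scale s b) simp
    then have "T (inverse (real (Suc n)) *\<^sub>R s + b) \<in> I" using T_I_iff Is_sub(1) by blast
    then show ?thesis using I_sub(2) linT by (simp add: linear_add linear_cmul)
  qed
  moreover have "(\<lambda>n. inverse (real (Suc n)) *\<^sub>R T s + T b) \<longlonglongrightarrow> 0 *\<^sub>R T s + T b"
    by (intro tendsto_intros LIMSEQ_inverse_real_of_nat)
  ultimately have "0 *\<^sub>R T s + T b \<in> K" by (rule closed_sequentially[OF K_props(2)])
  then show ?thesis by simp
qed

text \<open>Euler's identity for the gradient, which is homogeneous of degree -1. It brings negative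
  gradients within reach of the self-scaled property with \<open>w = x\<close>.\<close>

lemma grad_eq_hess:
  assumes x: "x \<in> I"
  shows "grad E F x = - hess E F x x"
proof -
  have "riesz E (\<lambda>h. DD F [h] x) = - hess E F x x"
  proof (rule riesz_eqI[OF subE])
    show "- hess E F x x \<in> E" using hess_inner(1)[OF x I_sub(1)[OF x]] subE by (simp add: subspace_neg)
    fix h assume h: "h \<in> E"
    have "hess E F x x \<bullet> h = DD Fp [x, h] x" by (rule hess_inner(2)[OF x I_sub(1)[OF x] h])
    also have "\<dots> = - DD Fp [h] x" using euler[OF x, of "[h]"] by (simp del: DD.simps)
    also have "DD Fp [h] x = DD F [h] x" using DD_Fp_E[of x "[h]"] h I_sub(1)[OF x] by simp
    finally show "(- hess E F x x) \<bullet> h = DD F [h] x" by simp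
  qed
  then show ?thesis by (simp add: grad_def)
qed

lemma neg_grad_Is: "x \<in> I \<Longrightarrow> - grad E F x \<in> Is"
  using hess_Is[of x x] by (simp add: grad_eq_hess)

text \<open>The self-scaled identity with \<open>w = x\<close>, combined with homogeneity of
  \<open>F\<close> along \<open>T\<close>. At a central point all scaled slacks have this form, so
  the potential can be evaluated exactly.\<close>

lemma conj_scaled_grad:
  assumes x: "x \<in> I" and k: "0 < k"
  shows "conj_barrier E K F (- k *\<^sub>R grad E F x) = - F x - \<nu> - \<nu> * ln k"
proof -
  have g: "- grad E F x \<in> Is" by (rule neg_grad_Is[OF x])
  have kg: "k *\<^sub>R (- grad E F x) \<in> Is" by (rule Is_scale[OF g k])
  have "conj_barrier E K F (k *\<^sub>R (- grad E F x)) = F (k *\<^sub>R T (- grad E F x)) - 2 * F w0 - \<nu>"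
    using conj_eq[OF kg] linear_cmul[OF linT, of k "- grad E F x"] by simp
  also have "F (k *\<^sub>R T (- grad E F x)) = F (T (- grad E F x)) - \<nu> * ln k"
    using T_I_iff[OF Is_sub(1)[OF g]] g k by (intro log_homogeneous) auto
  also have "F (T (- grad E F x)) - \<nu> * ln k - 2 * F w0 - \<nu> = conj_barrier E K F (hess E F x x) - \<nu> * ln k"
    using conj_eq[OF g] by (simp add: grad_eq_hess[OF x])
  finally show ?thesis using conj_hess[OF x x] by simp
qed

lemma grad_self:
  assumes "x \<in> I"
  shows "grad E F x \<bullet> x = - \<nu>"
  using grad_inner(2)[OF assms I_sub(1)[OF assms]] euler_0[OF assms] by simp

lemma conj_lower:
  assumes s: "s \<in> Is" and x: "x \<in> I"
  shows "- \<nu> - \<nu> * ln (s \<bullet> x / \<nu>) \<le> conj_barrier E K F s + F x"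
proof -
  have p: "0 < s \<bullet> x" by (rule inner_pos[OF s x])
  \<comment> \<open>The multiple of \<open>x\<close> that maximises
    \<open>- t * (s \<bullet> x) + \<nu> * ln t\<close>, so the best one on the ray.\<close>
  define t where "t = \<nu> / (s \<bullet> x)"
  have t: "0 < t" using p nu1 by (simp add: t_def)
  have "- (s \<bullet> (t *\<^sub>R x)) - F (t *\<^sub>R x) \<le> conj_barrier E K F s" by (rule conj_upper[OF s I_scale[OF x t]])
  moreover have "s \<bullet> (t *\<^sub>R x) = \<nu>" using p by (simp add: t_def)
  moreover have "F (t *\<^sub>R x) = F x - \<nu> * ln t" by (rule log_homogeneous[OF x t])
  moreover have "ln t = - ln (s \<bullet> x / \<nu>)" using p nu1 by (simp add: t_def ln_div)
  ultimately show ?thesis by simp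
qed

end

subsection \<open>Differentiation along curves\<close>

text \<open>A line in \<open>(x, s, v)\<close> is mapped to a curve by the scaled slack, so
  derivatives of \<open>Fp\<close> are needed along curves and with arguments that vary as
  well.\<close>

lemma DD_curve:
  assumes U: "open U" "smooth_on k U f" and hs: "length hs < k" and y: "y t \<in> U"
    and dy: "(y has_vector_derivative y') (at t)"
  shows "((\<lambda>t. DD f hs (y t)) has_real_derivative DD f (y' # hs) (y t)) (at t)"
proof -
  have d: "DD f hs differentiable (at (y t))" by (rule DD_differentiable[OF U hs y])
  have "((\<lambda>t. DD f hs (y t)) has_derivative (\<lambda>s. dirderiv (DD f hs) (s *\<^sub>R y') (y t))) (at t)"
    using has_derivative_compose[OF dy[unfolded has_vector_derivative_def] has_derivative_dirderiv[OF d]] .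
  moreover have "dirderiv (DD f hs) (s *\<^sub>R y') (y t) = s * dirderiv (DD f hs) y' (y t)" for s
    using linear_cmul[OF linear_dirderiv[OF d], of s y'] by simp
  ultimately show ?thesis by (simp add: has_field_derivative_def mult_commute_abs)
qed

lemma DD_basis_sum:
  assumes U: "open U" "smooth_on (Suc (length hs)) U f" and x: "x \<in> U"
  shows "DD f (a # hs) x = (\<Sum>k\<in>Basis. (a \<bullet> k) * DD f (k # hs) x)"
proof -
  have lin: "linear (\<lambda>h. DD f (h # hs) x)" by (rule DD_linear_hd[OF U _ x]) simp
  have "DD f ((\<Sum>k\<in>Basis. (a \<bullet> k) *\<^sub>R k) # hs) x = (\<Sum>k\<in>Basis. DD f (((a \<bullet> k) *\<^sub>R k) # hs) x)"
    by (rule linear_sum[OF lin])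
  also have "\<dots> = (\<Sum>k\<in>Basis. (a \<bullet> k) * DD f (k # hs) x)"
    by (intro sum.cong refl, subst linear_cmul[OF lin]) simp
  finally show ?thesis by (simp add: euclidean_representation)
qed

text \<open>Expanding the varying argument in the basis turns it into scalar factors, to which the
  product rule applies.\<close>

lemma DD_curve_arg:
  assumes U: "open U" "smooth_on k U f" and hs: "Suc (length hs) < k" and y: "\<And>s. s \<in> S \<Longrightarrow> y s \<in> U"
    and S: "open S" "t \<in> S"
    and dy: "(y has_vector_derivative y') (at t)" and da: "(a has_vector_derivative a') (at t)"
  shows "((\<lambda>t. DD f (a t # hs) (y t)) has_real_derivative
    DD f (y' # a t # hs) (y t) + DD f (a' # hs) (y t)) (at t)"
proof -
  have sm: "smooth_on (Suc (length hs)) U f" using smooth_on_mono[OF U] hs by simp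
  have sm2: "smooth_on (Suc (Suc (length hs))) U f" using smooth_on_mono[OF U] hs by simp
  have yt: "y t \<in> U" using y S by simp
  have dak: "((\<lambda>t. a t \<bullet> k) has_real_derivative a' \<bullet> k) (at t)" for k
    using da by (simp add: has_real_derivative_iff_has_vector_derivative bounded_linear.has_vector_derivative[OF bounded_linear_inner_left])
  have dD: "((\<lambda>t. DD f (k # hs) (y t)) has_real_derivative DD f (y' # k # hs) (y t)) (at t)" for k
    by (rule DD_curve[OF U _ yt dy]) (use hs in simp)
  have "((\<lambda>t. \<Sum>k\<in>Basis. (a t \<bullet> k) * DD f (k # hs) (y t)) has_real_derivative
      (\<Sum>k\<in>Basis. (a' \<bullet> k) * DD f (k # hs) (y t) + DD f (y' # k # hs) (y t) * (a t \<bullet> k))) (at t)"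
    by (intro DERIV_sum DERIV_mult dak dD)
  also have "(\<Sum>k\<in>Basis. (a' \<bullet> k) * DD f (k # hs) (y t) + DD f (y' # k # hs) (y t) * (a t \<bullet> k))
      = DD f (a' # hs) (y t) + DD f (y' # a t # hs) (y t)"
  proof -
    have sw: "DD f (y' # k # hs) (y t) = DD f (k # y' # hs) (y t)" for k
      by (rule DD_swap[OF U(1) sm2 yt])
    have "DD f (y' # a t # hs) (y t) = DD f (a t # y' # hs) (y t)" by (rule DD_swap[OF U(1) sm2 yt])
    also have "\<dots> = (\<Sum>k\<in>Basis. (a t \<bullet> k) * DD f (k # y' # hs) (y t))"
      by (rule DD_basis_sum[OF U(1) _ yt]) (use sm2 in simp)
    finally show ?thesis
      by (simp only: sw DD_basis_sum[OF U(1) sm yt, of a'] sum.distrib mult.commute[of _ "a t \<bullet> _"])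
  qed
  finally have "((\<lambda>t. \<Sum>k\<in>Basis. (a t \<bullet> k) * DD f (k # hs) (y t)) has_real_derivative
      DD f (a' # hs) (y t) + DD f (y' # a t # hs) (y t)) (at t)" .
  then show ?thesis
  proof (subst add.commute, rule has_field_derivative_transform_within_open[OF _ S])
    fix s assume "s \<in> S"
    then show "(\<Sum>k\<in>Basis. (a s \<bullet> k) * DD f (k # hs) (y s)) = DD f (a s # hs) (y s)"
      using DD_basis_sum[OF U(1) sm y, of s "a s"] by simp
  qed
qed

lemma DD_curve_arg2:
  assumes U: "open U" "smooth_on 3 U f" and y: "\<And>s. s \<in> S \<Longrightarrow> y s \<in> U"
    and S: "open S" "t \<in> S"
    and dy: "(y has_vector_derivative y') (at t)" and da: "(a has_vector_derivative a') (at t)"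
  shows "((\<lambda>t. DD f [a t, a t] (y t)) has_real_derivative
    DD f [y', a t, a t] (y t) + 2 * DD f [a t, a'] (y t)) (at t)"
proof -
  have sm1: "smooth_on 1 U f" and sm2: "smooth_on 2 U f" using smooth_on_mono[OF U] by simp_all
  have yt: "y t \<in> U" using y S by simp
  have dak: "((\<lambda>t. a t \<bullet> k) has_real_derivative a' \<bullet> k) (at t)" for k
    using da by (simp add: has_real_derivative_iff_has_vector_derivative bounded_linear.has_vector_derivative[OF bounded_linear_inner_left])
  have dD: "((\<lambda>t. DD f [a t, k] (y t)) has_real_derivative DD f [y', a t, k] (y t) + DD f [a', k] (y t)) (at t)" for k
    by (rule DD_curve_arg[OF U _ y S dy da]) simp_all
  have b2: "DD f [h, b] x = (\<Sum>k\<in>Basis. (b \<bullet> k) * DD f [h, k] x)" if "x \<in> U" for h b x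
  proof -
    have "DD f [h, b] x = DD f [b, h] x" by (rule DD2_perm[OF U(1) sm2 that])
    also have "\<dots> = (\<Sum>k\<in>Basis. (b \<bullet> k) * DD f [k, h] x)"
      by (rule DD_basis_sum[OF U(1) _ that]) (use sm2 in \<open>simp add: numeral_2_eq_2\<close>)
    also have "\<dots> = (\<Sum>k\<in>Basis. (b \<bullet> k) * DD f [h, k] x)"
      by (intro sum.cong refl arg_cong2[where f="(*)"] DD2_perm[OF U(1) sm2 that])
    finally show ?thesis .
  qed
  have b3: "DD f [y', a t, a t] (y t) = (\<Sum>k\<in>Basis. (a t \<bullet> k) * DD f [y', a t, k] (y t))"
  proof -
    have "DD f [y', a t, a t] (y t) = DD f [a t, y', a t] (y t)"
      by (rule DD3_perm[OF U yt]) simp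
    also have "\<dots> = (\<Sum>k\<in>Basis. (a t \<bullet> k) * DD f [k, y', a t] (y t))"
      by (rule DD_basis_sum[OF U(1) _ yt]) (use U in \<open>simp add: numeral_3_eq_3\<close>)
    also have "\<dots> = (\<Sum>k\<in>Basis. (a t \<bullet> k) * DD f [y', a t, k] (y t))"
      by (intro sum.cong refl arg_cong2[where f="(*)"] DD3_perm[OF U yt]) simp
    finally show ?thesis .
  qed
  have "((\<lambda>t. \<Sum>k\<in>Basis. (a t \<bullet> k) * DD f [a t, k] (y t)) has_real_derivative
      (\<Sum>k\<in>Basis. (a' \<bullet> k) * DD f [a t, k] (y t) + (DD f [y', a t, k] (y t) + DD f [a', k] (y t)) * (a t \<bullet> k))) (at t)"
    by (intro DERIV_sum DERIV_mult dak dD)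
  also have "(\<Sum>k\<in>Basis. (a' \<bullet> k) * DD f [a t, k] (y t) + (DD f [y', a t, k] (y t) + DD f [a', k] (y t)) * (a t \<bullet> k))
      = DD f [y', a t, a t] (y t) + 2 * DD f [a t, a'] (y t)"
    unfolding b3
    using b2[OF yt, of "a t" a'] b2[OF yt, of a' "a t"] DD2_perm[OF U(1) sm2 yt, of a' "a t"]
    by (simp add: sum.distrib ring_distribs mult.commute[of _ "a t \<bullet> _"] del: DD.simps)
  finally show ?thesis
  proof (rule has_field_derivative_transform_within_open[OF _ S])
    fix s assume "s \<in> S"
    then show "(\<Sum>k\<in>Basis. (a s \<bullet> k) * DD f [a s, k] (y s)) = DD f [a s, a s] (y s)"
      using b2[OF y, of s "a s" "a s"] by simp
  qed
qed

subsection \<open>Self-concordance of the block potential\<close>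

text \<open>\<open>a\<close> and \<open>b\<close> will be the local norms of the velocity of the
  transformed slack and of \<open>h\<close>, and \<open>r\<close> the contribution of the curvature
  of the slack. With \<open>n\<close> the root on the right, the gap is
  \<open>(n - (a + b))\<^sup>2 * (2 * n + (a + b))\<close>, so the constant of self-concordance does
  not deteriorate.\<close>

lemma cubic_sum_bound:
  fixes a b r :: real
  assumes "0 \<le> a" "0 \<le> b" "0 \<le> r"
  shows "2 * a^3 + 3 * a * r + 3 * b * r + 2 * b^3 \<le> 2 * (sqrt (a\<^sup>2 + r + b\<^sup>2))^3"
proof -
  define n where "n = sqrt (a\<^sup>2 + r + b\<^sup>2)"
  have n: "0 \<le> n" "n\<^sup>2 = a\<^sup>2 + r + b\<^sup>2" using assms by (simp_all add: n_def)
  have r: "r = n\<^sup>2 - a\<^sup>2 - b\<^sup>2" using n by simp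
  have "2 * n^3 - (2 * a^3 + 3 * a * r + 3 * b * r + 2 * b^3) = (n - (a + b))\<^sup>2 * (2 * n + (a + b))"
    unfolding r by (simp add: power2_eq_square power3_eq_cube algebra_simps)
  moreover have "0 \<le> (n - (a + b))\<^sup>2 * (2 * n + (a + b))" using n assms by simp
  ultimately show ?thesis by (simp add: n_def)
qed

context self_scaled_block
begin

text \<open>\<open>GG hs x\<close> is the vector representing the functional \<open>D\<^bsup>k+1\<^esup>F(x)[hs, \<cdot>]\<close>.\<close>

definition GG :: "'a list \<Rightarrow> 'a \<Rightarrow> 'a" where
  "GG hs x = (\<Sum>k\<in>Basis. DD Fp (hs @ [k]) x *\<^sub>R k)"

lemma GG_inner:
  assumes "x \<in> U" "length hs \<le> 3"
  shows "GG hs x \<bullet> b = DD Fp (hs @ [b]) x"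
proof -
  have lin: "linear (\<lambda>h. DD Fp (hs @ [h]) x)"
    using DD_linear[OF open_U smooth_le assms(1), of hs "[]"] assms(2) by simp
  have "DD Fp (hs @ [b]) x = DD Fp (hs @ [\<Sum>k\<in>Basis. (b \<bullet> k) *\<^sub>R k]) x" by (simp add: euclidean_representation)
  also have "\<dots> = (\<Sum>k\<in>Basis. DD Fp (hs @ [(b \<bullet> k) *\<^sub>R k]) x)" by (rule linear_sum[OF lin])
  also have "\<dots> = (\<Sum>k\<in>Basis. (b \<bullet> k) * DD Fp (hs @ [k]) x)"
    by (intro sum.cong refl, subst linear_cmul[OF lin]) simp
  also have "\<dots> = GG hs x \<bullet> b" by (simp add: GG_def inner_sum_left inner_commute[of b] mult.commute)
  finally show ?thesis by simp
qed

lemma GG_E: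
  assumes "x \<in> U" "length hs \<le> 3"
  shows "GG hs x \<in> E"
proof -
  have "p (GG hs x) \<bullet> b = GG hs x \<bullet> b" for b
  proof -
    have "p (GG hs x) \<bullet> b = GG hs x \<bullet> p b" by (rule proj_symmetric[OF subE])
    also have "\<dots> = GG hs x \<bullet> b" unfolding GG_inner[OF assms] by (simp add: DD_Fp)
    finally show ?thesis .
  qed
  then have "p (GG hs x) = GG hs x" by (metis euclidean_eqI)
  then show ?thesis by (metis p_in)
qed

lemma GG_grad: "x \<in> U \<Longrightarrow> grad E F (p x) = GG [] x"
proof -
  assume x: "x \<in> U"
  then have px: "p x \<in> I" by (simp add: U_def)
  have "riesz E (\<lambda>h. DD F [h] (p x)) = GG [] x"
  proof (rule riesz_eqI[OF subE])
    show "GG [] x \<in> E" by (rule GG_E[OF x]) simp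
    fix h assume "h \<in> E"
    then show "GG [] x \<bullet> h = DD F [h] (p x)" using GG_inner[OF x, of "[]" h] by (simp add: DD_Fp del: DD.simps)
  qed
  then show ?thesis by (simp add: grad_def)
qed

lemma GG_line:
  assumes "x + t *\<^sub>R h \<in> U" "length hs \<le> 2"
  shows "((\<lambda>t. GG hs (x + t *\<^sub>R h)) has_vector_derivative GG (h # hs) (x + t *\<^sub>R h)) (at t)"
proof -
  have "((\<lambda>t. DD Fp (hs @ [k]) (x + t *\<^sub>R h)) has_real_derivative DD Fp (h # hs @ [k]) (x + t *\<^sub>R h)) (at t)" for k
    using assms by (intro DD_line[OF open_U smooth4]) auto
  then show ?thesis unfolding GG_def
    by (auto intro!: derivative_eq_intros simp: has_real_derivative_iff_has_vector_derivative simp del: DD.simps)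
qed

text \<open>
  The homogeneity identities turn the second and third derivatives of \<open>v\<^sup>2 \<nabla>F(x)\<close> into the functionals
  of the fourth order condition at \<open>q = v h - \<eta> x\<close>.
\<close>

lemma GG_homogeneous:
  fixes v \<eta> :: real and x h :: 'a
  assumes x: "x \<in> I"
  defines "q \<equiv> v *\<^sub>R h - \<eta> *\<^sub>R x"
  shows "(2 * \<eta>\<^sup>2) *\<^sub>R GG [] x + (4 * v * \<eta>) *\<^sub>R GG [h] x + v\<^sup>2 *\<^sub>R GG [h, h] x = GG [q, q] x"
    and "(6 * \<eta>\<^sup>2) *\<^sub>R GG [h] x + (6 * v * \<eta>) *\<^sub>R GG [h, h] x + v\<^sup>2 *\<^sub>R GG [h, h, h] x = GG [h, q, q] x"
proof -
  have U: "x \<in> U" by (rule U_I[OF x])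
  have q: "q = v *\<^sub>R h + (- \<eta>) *\<^sub>R x" by (simp add: q_def)
  have sw3: "DD Fp [h, x, k] x = DD Fp [x, h, k] x" for k
    by (rule DD_perm[OF open_U smooth_le U]) simp_all
  have sw4: "DD Fp [h, x, h, k] x = DD Fp [x, h, h, k] x" for k
    by (rule DD_perm[OF open_U smooth_le U]) simp_all
  have e: "DD Fp [x, k] x = - DD Fp [k] x" "DD Fp [x, h, k] x = - 2 * DD Fp [h, k] x"
    "DD Fp [x, x, k] x = 2 * DD Fp [k] x" "DD Fp [x, h, h, k] x = - 3 * DD Fp [h, h, k] x"
    "DD Fp [x, x, h, k] x = 6 * DD Fp [h, k] x" for k
    using euler[OF x, of "[k]"] euler[OF x, of "[h, k]"] euler[OF x, of "[x, k]"] euler[OF x, of "[h, h, k]"]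
      euler[OF x, of "[x, h, k]"] by (simp_all del: DD.simps)
  have s1: "smooth_on 2 U (DD Fp [k])" "smooth_on 2 U (DD Fp [h, k])" for k
    using smooth_on_DD[OF open_U, of "[k]" 2] smooth_on_DD[OF open_U, of "[h, k]" 2] smooth_le
    by (simp_all del: DD.simps add: numeral_eq_Suc)
  have app: "DD (DD Fp ks) hs = DD Fp (hs @ ks)" for hs ks by (induction hs) simp_all
  have e3: "DD Fp [q, q, k] x = v\<^sup>2 * DD Fp [h, h, k] x + 2 * v * (- \<eta>) * DD Fp [h, x, k] x + (- \<eta>)\<^sup>2 * DD Fp [x, x, k] x" for k
    using DD2_expand[OF open_U s1(1)[of k] U, of v h "- \<eta>" x] unfolding q app by simp
  have e4: "DD Fp [h, q, q, k] x = v\<^sup>2 * DD Fp [h, h, h, k] x + 2 * v * (- \<eta>) * DD Fp [h, x, h, k] x + (- \<eta>)\<^sup>2 * DD Fp [x, x, h, k] x" for k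
  proof -
    have "DD Fp [h, q, q, k] x = DD Fp [q, q, h, k] x"
      by (rule DD_perm[OF open_U smooth_le U]) simp_all
    then show ?thesis
      using DD2_expand[OF open_U s1(2)[of k] U, of v h "- \<eta>" x] unfolding q app by simp
  qed
  show "(2 * \<eta>\<^sup>2) *\<^sub>R GG [] x + (4 * v * \<eta>) *\<^sub>R GG [h] x + v\<^sup>2 *\<^sub>R GG [h, h] x = GG [q, q] x"
    by (rule euclidean_eqI) (simp add: inner_add_left GG_inner[OF U] e3 sw3 e del: DD.simps)
  show "(6 * \<eta>\<^sup>2) *\<^sub>R GG [h] x + (6 * v * \<eta>) *\<^sub>R GG [h, h] x + v\<^sup>2 *\<^sub>R GG [h, h, h] x = GG [h, q, q] x"
    by (rule euclidean_eqI) (simp add: inner_add_left GG_inner[OF U] e4 sw4 e del: DD.simps)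
qed

text \<open>The second claim is the first for \<open>- h\<close> and \<open>- \<beta>\<close>: this
  leaves \<open>q\<close> and the local norm of \<open>h\<close> unchanged and reverses the sign of
  \<open>GG [h, q, q] x\<close>.\<close>

lemma fourth_order_GG:
  assumes x: "x \<in> I" and h: "h \<in> E" and q: "q = \<alpha> *\<^sub>R x + \<beta> *\<^sub>R h"
  shows "(- 3 * lnorm Fp x h) *\<^sub>R GG [q, q] x - GG [h, q, q] x \<in> Ks"
    and "(- 3 * lnorm Fp x h) *\<^sub>R GG [q, q] x + GG [h, q, q] x \<in> Ks"
proof -
  have U: "x \<in> U" by (rule U_I[OF x])
  have main: "(- 3 * lnorm Fp x h) *\<^sub>R GG [q, q] x - GG [h, q, q] x \<in> Ks"
    if h: "h \<in> E" and q: "q = \<alpha> *\<^sub>R x + \<beta> *\<^sub>R h" for h q \<alpha> \<beta>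
  proof -
    have qE: "q \<in> E" using q h I_sub[OF x] subE by (simp add: subspace_add subspace_scale)
    have "riesz E (\<lambda>k. - 3 * DD F [q, q, k] x * sqrt (hess E F x h \<bullet> h) - DD F [h, q, q, k] x) \<in> Ks"
      using fo x h unfolding fourth_order_condition_def Let_def q by blast
    also have "riesz E (\<lambda>k. - 3 * DD F [q, q, k] x * sqrt (hess E F x h \<bullet> h) - DD F [h, q, q, k] x)
      = (- 3 * lnorm Fp x h) *\<^sub>R GG [q, q] x - GG [h, q, q] x"
    proof (rule riesz_eqI[OF subE])
      show "(- 3 * lnorm Fp x h) *\<^sub>R GG [q, q] x - GG [h, q, q] x \<in> E"
        by (intro subspace_diff subspace_scale subE GG_E U) simp_all
      fix k assume k: "k \<in> E"
      show "((- 3 * lnorm Fp x h) *\<^sub>R GG [q, q] x - GG [h, q, q] x) \<bullet> k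
        = - 3 * DD F [q, q, k] x * sqrt (hess E F x h \<bullet> h) - DD F [h, q, q, k] x"
        using DD_Fp_E[of x "[q, q, k]"] DD_Fp_E[of x "[h, q, q, k]"] k h qE I_sub[OF x] hess_inner(2)[OF x h h]
        by (simp add: inner_diff_left GG_inner[OF U] lnorm_def del: DD.simps)
    qed
    finally show ?thesis .
  qed
  show "(- 3 * lnorm Fp x h) *\<^sub>R GG [q, q] x - GG [h, q, q] x \<in> Ks" by (rule main[OF h q])
  have "q = \<alpha> *\<^sub>R x + (- \<beta>) *\<^sub>R (- h)" using q by simp
  from main[OF subspace_neg[OF subE h] this]
  have "(- 3 * lnorm Fp x (- h)) *\<^sub>R GG [q, q] x - GG [- h, q, q] x \<in> Ks" .
  moreover have "lnorm Fp x (- h) = lnorm Fp x h"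
    using lnorm_scale[OF sc_Fp U, of "-1" h] by simp
  moreover have "GG [- h, q, q] x = - GG [h, q, q] x"
  proof (rule euclidean_eqI)
    fix b :: 'a
    have lin: "linear (\<lambda>h. DD Fp [h, q, q, b] x)"
      using DD_linear_hd[OF open_U smooth4 _ U, of "[q, q, b]"] by simp
    show "GG [- h, q, q] x \<bullet> b = - GG [h, q, q] x \<bullet> b"
      using linear_neg[OF lin, of h] by (simp add: GG_inner[OF U] del: DD.simps)
  qed
  ultimately show "(- 3 * lnorm Fp x h) *\<^sub>R GG [q, q] x + GG [h, q, q] x \<in> Ks" by simp
qed

text \<open>A vanishing local norm makes the Hessian annihilate \<open>h\<close> by the
  Cauchy-Schwarz inequality, and the Hessian is injective on \<open>E\<close>.\<close>

lemma lnorm_pos: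
  assumes x: "x \<in> I" and h: "h \<in> E" "h \<noteq> 0"
  shows "0 < lnorm Fp x h"
proof (rule ccontr)
  assume "\<not> 0 < lnorm Fp x h"
  then have "lnorm Fp x h = 0" using lnorm_nonneg[OF sc_Fp U_I[OF x], of h] by simp
  then have "DD Fp [h, h] x = 0" using lnorm_square[OF sc_Fp U_I[OF x], of h] by simp
  then have z: "DD Fp [h, k] x = 0" for k using sc_D2_disc[OF sc_Fp U_I[OF x], of h k] by simp
  have "hess E F x h \<bullet> hess E F x h = DD Fp [h, hess E F x h] x"
    by (rule hess_inner(2)[OF x h(1) hess_inner(1)[OF x h(1)]])
  then have "hess E F x h = 0" using z by simp
  then show False using hess_inj[OF x h(1)] h(2) by simp
qed

text \<open>Adding both signs of the fourth order condition cancels the fourth derivative and leaves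
  a positive multiple of \<open>- GG [q, q] x\<close>. This is the concavity of the scaled gradient
  with respect to the dual cone.\<close>

lemma neg_GG_Ks:
  assumes x: "x \<in> I" and h: "h \<in> E" and q: "q = \<alpha> *\<^sub>R x + \<beta> *\<^sub>R h"
  shows "- GG [q, q] x \<in> Ks"
proof (cases "h = 0")
  case True
  have U: "x \<in> U" by (rule U_I[OF x])
  have "GG [q, q] x = (2 * (- \<alpha>)\<^sup>2) *\<^sub>R GG [] x"
    using GG_homogeneous(1)[OF x, of "- \<alpha>" 0 0] True q by simp
  then have "- GG [q, q] x = (2 * \<alpha>\<^sup>2) *\<^sub>R (- grad E F x)"
    using GG_grad[OF U] I_sub[OF x] by simp
  then show ?thesis
    using Is_sub(2)[OF neg_grad_Is[OF x]] dual_cone_props(3)[OF subE, of "- grad E F x" K "2 * \<alpha>\<^sup>2"] by simp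
next
  case False
  define n where "n = lnorm Fp x h"
  have n: "0 < n" unfolding n_def by (rule lnorm_pos[OF x h False])
  have "((- 3 * n) *\<^sub>R GG [q, q] x - GG [h, q, q] x) + ((- 3 * n) *\<^sub>R GG [q, q] x + GG [h, q, q] x) \<in> Ks"
    unfolding n_def by (rule dual_cone_props(2)[OF subE fourth_order_GG[OF x h q]])
  then have "(6 * n) *\<^sub>R (- GG [q, q] x) \<in> Ks" by (simp add: algebra_simps flip: scaleR_add_left)
  from dual_cone_props(3)[OF subE this, of "inverse (6 * n)"]
  have "inverse (6 * n) *\<^sub>R ((6 * n) *\<^sub>R (- GG [q, q] x)) \<in> Ks" using n by simp
  moreover have "inverse (6 * n) *\<^sub>R ((6 * n) *\<^sub>R (- GG [q, q] x)) = - GG [q, q] x"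
    using n by (simp del: scaleR_minus_right)
  ultimately show ?thesis by simp
qed

section \<open>The block potential as a function of \<open>(x, s, v)\<close>\<close>

definition slack :: "'a \<times> 'a \<times> real \<Rightarrow> 'a" where
  "slack = (\<lambda>(x, s, v). s + v\<^sup>2 *\<^sub>R GG [] x)"

definition Y :: "'a \<times> 'a \<times> real \<Rightarrow> 'a" where "Y z = T (slack z)"

definition Dpsi :: "('a \<times> 'a \<times> real) set" where "Dpsi = {z. fst z \<in> U \<and> Y z \<in> I}"

text \<open>\<open>Phi\<close> up to the constant in \<open>Psi_conj\<close>. With \<open>T\<close>
  in place of the conjugate it is a composition of smooth functions on an open subset of the whole
  space.\<close>

definition Psi :: "'a \<times> 'a \<times> real \<Rightarrow> real" where "Psi z = Fp (Y z) + Fp (fst z)"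

definition Line :: "'a \<times> 'a \<times> real \<Rightarrow> 'a \<times> 'a \<times> real \<Rightarrow> bool" where
  "Line z d \<longleftrightarrow> fst z \<in> E \<and> fst (snd z) \<in> E \<and> fst d \<in> E \<and> fst (snd d) \<in> E"

text \<open>\<open>q t\<close> is in fact the constant
  \<open>v *\<^sub>R h - \<eta> *\<^sub>R x\<close>; written in this way it is visibly a combination
  of the current point and \<open>h\<close>, the shape that \<open>GG_homogeneous\<close> and the
  fourth order condition ask for.\<close>

lemma slack_derivs:
  fixes v \<eta> t :: real and x s h ds :: 'a
  assumes L: "Line (x, s, v) (h, ds, \<eta>)" and t: "x + t *\<^sub>R h \<in> I"
  defines "q \<equiv> \<lambda>t. (v + t * \<eta>) *\<^sub>R h - \<eta> *\<^sub>R (x + t *\<^sub>R h)"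
  defines "S1 \<equiv> \<lambda>t. ds + (2 * (v + t * \<eta>) * \<eta>) *\<^sub>R GG [] (x + t *\<^sub>R h) + (v + t * \<eta>)\<^sup>2 *\<^sub>R GG [h] (x + t *\<^sub>R h)"
  shows "((\<lambda>t. slack ((x, s, v) + t *\<^sub>R (h, ds, \<eta>))) has_vector_derivative S1 t) (at t)"
    and "(S1 has_vector_derivative GG [q t, q t] (x + t *\<^sub>R h)) (at t)"
    and "((\<lambda>t. (2 * \<eta>\<^sup>2) *\<^sub>R GG [] (x + t *\<^sub>R h) + (4 * (v + t * \<eta>) * \<eta>) *\<^sub>R GG [h] (x + t *\<^sub>R h) + (v + t * \<eta>)\<^sup>2 *\<^sub>R GG [h, h] (x + t *\<^sub>R h))
      has_vector_derivative GG [h, q t, q t] (x + t *\<^sub>R h)) (at t)"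
proof -
  note l = GG_line[OF U_I[OF t]]
  have c1: "((\<lambda>t. (v + t * \<eta>)\<^sup>2) has_real_derivative 2 * (v + t * \<eta>) * \<eta>) (at t)"
    "((\<lambda>t. 2 * (v + t * \<eta>) * \<eta>) has_real_derivative 2 * \<eta>\<^sup>2) (at t)"
    "((\<lambda>t. 4 * (v + t * \<eta>) * \<eta>) has_real_derivative 4 * \<eta>\<^sup>2) (at t)"
    by (auto intro!: derivative_eq_intros simp: power2_eq_square)
  have "((\<lambda>t. s + t *\<^sub>R ds + (v + t * \<eta>)\<^sup>2 *\<^sub>R GG [] (x + t *\<^sub>R h)) has_vector_derivative
    ds + ((v + t * \<eta>)\<^sup>2 *\<^sub>R GG [h] (x + t *\<^sub>R h) + (2 * (v + t * \<eta>) * \<eta>) *\<^sub>R GG [] (x + t *\<^sub>R h))) (at t)"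
    by (intro has_vector_derivative_add has_vector_derivative_scaleR c1 l) (auto intro!: derivative_eq_intros)
  then show "((\<lambda>t. slack ((x, s, v) + t *\<^sub>R (h, ds, \<eta>))) has_vector_derivative S1 t) (at t)"
    by (simp add: slack_def S1_def algebra_simps)
  have "(S1 has_vector_derivative (0 + ((2 * (v + t * \<eta>) * \<eta>) *\<^sub>R GG [h] (x + t *\<^sub>R h) + (2 * \<eta>\<^sup>2) *\<^sub>R GG [] (x + t *\<^sub>R h))
    + ((v + t * \<eta>)\<^sup>2 *\<^sub>R GG [h, h] (x + t *\<^sub>R h) + (2 * (v + t * \<eta>) * \<eta>) *\<^sub>R GG [h] (x + t *\<^sub>R h)))) (at t)"
    unfolding S1_def by (intro has_vector_derivative_add has_vector_derivative_scaleR c1 l has_vector_derivative_const) simp_all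
  moreover have "(0 + ((2 * (v + t * \<eta>) * \<eta>) *\<^sub>R GG [h] (x + t *\<^sub>R h) + (2 * \<eta>\<^sup>2) *\<^sub>R GG [] (x + t *\<^sub>R h))
    + ((v + t * \<eta>)\<^sup>2 *\<^sub>R GG [h, h] (x + t *\<^sub>R h) + (2 * (v + t * \<eta>) * \<eta>) *\<^sub>R GG [h] (x + t *\<^sub>R h)))
    = GG [q t, q t] (x + t *\<^sub>R h)"
    unfolding q_def GG_homogeneous(1)[OF t, symmetric] by (simp add: algebra_simps flip: scaleR_add_left)
  ultimately show "(S1 has_vector_derivative GG [q t, q t] (x + t *\<^sub>R h)) (at t)" by simp
  have "((\<lambda>t. (2 * \<eta>\<^sup>2) *\<^sub>R GG [] (x + t *\<^sub>R h) + (4 * (v + t * \<eta>) * \<eta>) *\<^sub>R GG [h] (x + t *\<^sub>R h) + (v + t * \<eta>)\<^sup>2 *\<^sub>R GG [h, h] (x + t *\<^sub>R h))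
      has_vector_derivative ((2 * \<eta>\<^sup>2) *\<^sub>R GG [h] (x + t *\<^sub>R h) + 0 *\<^sub>R GG [] (x + t *\<^sub>R h)
       + ((4 * (v + t * \<eta>) * \<eta>) *\<^sub>R GG [h, h] (x + t *\<^sub>R h) + (4 * \<eta>\<^sup>2) *\<^sub>R GG [h] (x + t *\<^sub>R h))
       + ((v + t * \<eta>)\<^sup>2 *\<^sub>R GG [h, h, h] (x + t *\<^sub>R h) + (2 * (v + t * \<eta>) * \<eta>) *\<^sub>R GG [h, h] (x + t *\<^sub>R h)))) (at t)"
    by (intro has_vector_derivative_add has_vector_derivative_scaleR c1 l) simp_all
  moreover have "((2 * \<eta>\<^sup>2) *\<^sub>R GG [h] (x + t *\<^sub>R h) + 0 *\<^sub>R GG [] (x + t *\<^sub>R h)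
       + ((4 * (v + t * \<eta>) * \<eta>) *\<^sub>R GG [h, h] (x + t *\<^sub>R h) + (4 * \<eta>\<^sup>2) *\<^sub>R GG [h] (x + t *\<^sub>R h))
       + ((v + t * \<eta>)\<^sup>2 *\<^sub>R GG [h, h, h] (x + t *\<^sub>R h) + (2 * (v + t * \<eta>) * \<eta>) *\<^sub>R GG [h, h] (x + t *\<^sub>R h)))
     = GG [h, q t, q t] (x + t *\<^sub>R h)"
    unfolding q_def GG_homogeneous(2)[OF t, symmetric] by (simp add: algebra_simps flip: scaleR_add_left)
  ultimately show "((\<lambda>t. (2 * \<eta>\<^sup>2) *\<^sub>R GG [] (x + t *\<^sub>R h) + (4 * (v + t * \<eta>) * \<eta>) *\<^sub>R GG [h] (x + t *\<^sub>R h) + (v + t * \<eta>)\<^sup>2 *\<^sub>R GG [h, h] (x + t *\<^sub>R h))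
      has_vector_derivative GG [h, q t, q t] (x + t *\<^sub>R h)) (at t)" by simp
qed

lemma linear_fst': "linear (fst :: 'a \<times> 'a \<times> real \<Rightarrow> 'a)"
  by (simp add: linear_iff)

lemma open_fst_U: "open {z :: 'a \<times> 'a \<times> real. fst z \<in> U}"
  using open_vimage_fst[OF open_U] by (simp add: vimage_def)

text \<open>The gradient uses up one derivative, so class 4 of \<open>Fp\<close> leaves the class 3
  that self-concordance asks for.\<close>

lemma smooth_Y: "smooth_on 3 {z. fst z \<in> U} (\<lambda>z. Y z \<bullet> b)"
proof -
  define V where "V = {z :: 'a \<times> 'a \<times> real. fst z \<in> U}"
  have V: "open V" unfolding V_def by (rule open_fst_U)
  have eq: "Y z \<bullet> b = T (fst (snd z)) \<bullet> b + (snd (snd z) * snd (snd z)) * (\<Sum>k\<in>Basis. DD Fp [k] (0 + fst z) * (T k \<bullet> b))" for z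
    using linT by (cases z)
      (simp add: Y_def slack_def GG_def linear_add linear_cmul linear_sum inner_add_left inner_sum_left power2_eq_square mult.assoc)
  have l1: "linear (\<lambda>z :: 'a \<times> 'a \<times> real. T (fst (snd z)) \<bullet> b)"
    using linT by (simp add: linear_iff inner_add_left)
  have l2: "linear (\<lambda>z :: 'a \<times> 'a \<times> real. snd (snd z))" by (simp add: linear_iff)
  have "smooth_on 3 V (\<lambda>z. DD Fp [k] (0 + fst z))" for k
  proof (rule smooth_on_affine[OF V open_U linear_fst'])
    show "smooth_on 3 U (DD Fp [k])" using smooth_on_DD[OF open_U, of "[k]" 3] smooth4 by simp
  qed (simp add: V_def)
  then have "smooth_on 3 V (\<lambda>z. T (fst (snd z)) \<bullet> b + (snd (snd z) * snd (snd z)) * (\<Sum>k\<in>Basis. DD Fp [k] (0 + fst z) * (T k \<bullet> b)))"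
    by (intro smooth_on_add[OF V] smooth_on_mult[OF V] smooth_on_sum[OF V] smooth_on_const[OF V]
        smooth_on_linear[OF V l1] smooth_on_linear[OF V l2] finite_Basis) auto
  then show ?thesis unfolding V_def[symmetric] eq .
qed

lemma Dpsi_eq: "Dpsi = {z \<in> {z. fst z \<in> U}. Y z \<in> U}"
  unfolding Dpsi_def by (auto simp: Y_def U_def)

lemma continuous_Y: "continuous_on {z. fst z \<in> U} Y"
  by (subst continuous_on_componentwise) (use smooth_on_continuous[OF open_fst_U smooth_Y] in auto)

lemma open_Dpsi: "open Dpsi"
  unfolding Dpsi_eq using continuous_open_preimage[OF continuous_Y open_fst_U open_U]
  by (simp add: Int_def vimage_def conj_commute)

lemma smooth_Psi: "smooth_on 3 Dpsi Psi"
proof -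
  have sY: "smooth_on 3 Dpsi (\<lambda>z. Y z \<bullet> b)" for b
    by (rule smooth_on_subset[OF open_fst_U open_Dpsi _ smooth_Y]) (auto simp: Dpsi_def)
  have "smooth_on 3 Dpsi (\<lambda>z. Fp (Y z))"
    by (rule smooth_on_compose[OF open_Dpsi open_U _ smooth_le sY]) (auto simp: Dpsi_eq)
  moreover have "smooth_on 3 Dpsi (\<lambda>z. Fp (0 + fst z))"
    by (rule smooth_on_affine[OF open_Dpsi open_U linear_fst' smooth_le]) (auto simp: Dpsi_def)
  ultimately show ?thesis unfolding Psi_def[abs_def] using smooth_on_add[OF open_Dpsi] by fastforce
qed

text \<open>\<open>Psi\<close> and its domain are invariant under this projection, so arbitrary
  points and directions reduce to those with components in \<open>E\<close>, where the facts about
  the cone hold.\<close>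

definition pr :: "'a \<times> 'a \<times> real \<Rightarrow> 'a \<times> 'a \<times> real" where
  "pr = (\<lambda>(x, s, v). (p x, p s, v))"

lemma linear_pr: "linear pr"
  using linp by (auto simp: linear_iff pr_def split: prod.splits)

lemma GG_p: "GG hs (p x) = GG hs x"
  unfolding GG_def by (simp add: DD_Fp)

lemma Y_pr: "Y (pr z) = Y z"
  using linT by (cases z) (simp add: Y_def slack_def pr_def GG_p linear_add)

lemma Dpsi_pr: "pr z \<in> Dpsi \<longleftrightarrow> z \<in> Dpsi"
  by (cases z) (simp add: Dpsi_def Y_pr, simp add: pr_def U_def)

lemma Psi_pr: "Psi (pr z) = Psi z"
  by (cases z) (simp add: Psi_def Y_pr, simp add: pr_def Fp_def)

lemma Line_pr: "Line (pr z) (pr d)"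
  by (cases z; cases d) (simp add: Line_def pr_def)

text \<open>The point is that all terms beyond \<open>F\<close> itself are controlled by the single
  number \<open>r = DD Fp [y2] y\<close>. Since \<open>- y2\<close> lies in the cone,
  \<open>r\<close> is nonnegative and \<open>lnorm_le_slope\<close> bounds the local norm of
  \<open>y2\<close> by \<open>r\<close>; since \<open>y3 - 3 * b * y2\<close> lies in the cone, the
  slope along \<open>y3\<close> is at most \<open>3 * b * r\<close>. Then
  \<open>cubic_sum_bound\<close> finishes.\<close>

lemma block_point_bounds:
  assumes x: "x \<in> I" and h: "h \<in> E" and q: "q = \<alpha> *\<^sub>R x + \<beta> *\<^sub>R h" and y: "y \<in> I"
  defines "y2 \<equiv> T (GG [q, q] x)" and "y3 \<equiv> T (GG [h, q, q] x)"
  shows "0 \<le> DD Fp [y2] y"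
    and "DD Fp [y1, y1, y1] y + 3 * DD Fp [y1, y2] y + DD Fp [y3] y + DD Fp [h, h, h] x
      \<le> 2 * (DD Fp [y1, y1] y + DD Fp [y2] y + DD Fp [h, h] x) powr (3/2)"
proof -
  note ux = U_I[OF x] and uy = U_I[OF y]
  have lin: "linear (\<lambda>h. DD Fp [h] y)" using DD1_linear[OF open_U smooth_le uy] by simp
  have k2: "- y2 \<in> K"
    using T_Ks[OF neg_GG_Ks[OF x h q]] linT by (simp add: y2_def linear_neg)
  have neg: "DD Fp [- y2] y = - DD Fp [y2] y" using linear_neg[OF lin, of y2] .
  show r0: "0 \<le> DD Fp [y2] y" using DD1_nonpos[OF y k2] neg by simp
  define a where "a = lnorm Fp y y1"
  define b where "b = lnorm Fp x h"
  define r where "r = DD Fp [y2] y"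
  have ab: "0 \<le> a" "0 \<le> b" by (simp_all add: a_def b_def lnorm_nonneg[OF sc_Fp] ux uy)
  have ab2: "a\<^sup>2 = DD Fp [y1, y1] y" "b\<^sup>2 = DD Fp [h, h] x"
    unfolding a_def b_def by (simp_all only: lnorm_square[OF sc_Fp] ux uy)
  have t1: "DD Fp [y1, y1, y1] y \<le> 2 * a^3" and t4: "DD Fp [h, h, h] x \<le> 2 * b^3"
    using sc_D3_bound[OF sc_Fp uy, of y1] sc_D3_bound[OF sc_Fp ux, of h] by (simp_all add: a_def b_def)
  have ny2: "lnorm Fp y y2 \<le> r"
    using lnorm_le_slope[OF y k2] lnorm_scale[OF sc_Fp uy, of "-1" y2] neg by (simp add: r_def)
  have "DD Fp [y1, y2] y \<le> a * lnorm Fp y y2"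
  proof -
    have "\<bar>DD Fp [y1, y2] y\<bar> \<le> sqrt ((a * lnorm Fp y y2)\<^sup>2)"
      using sc_D2_disc[OF sc_Fp uy, of y1 y2]
      by (intro real_le_rsqrt) (simp add: power_mult_distrib ab2 lnorm_square[OF sc_Fp uy] del: DD.simps)
    then show ?thesis using ab lnorm_nonneg[OF sc_Fp uy] by (simp add: real_sqrt_mult real_sqrt_abs abs_mult)
  qed
  also have "\<dots> \<le> a * r" using ny2 ab by (intro mult_left_mono)
  finally have t2: "DD Fp [y1, y2] y \<le> a * r" .
  have t3: "DD Fp [y3] y \<le> 3 * b * r"
  proof -
    have "T ((- 3 * b) *\<^sub>R GG [q, q] x + GG [h, q, q] x) \<in> K"
      unfolding b_def by (rule T_Ks[OF fourth_order_GG(2)[OF x h q]])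
    then have "(- 3 * b) *\<^sub>R y2 + y3 \<in> K" unfolding linear_add[OF linT] linear_cmul[OF linT] y2_def y3_def .
    from DD1_nonpos[OF y this] show ?thesis
      unfolding linear_add[OF lin] linear_cmul[OF lin] r_def by simp
  qed
  have "DD Fp [y1, y1, y1] y + 3 * DD Fp [y1, y2] y + DD Fp [y3] y + DD Fp [h, h, h] x
    \<le> 2 * a^3 + 3 * a * r + 3 * b * r + 2 * b^3"
    using t1 t2 t3 t4 by simp
  also have "\<dots> \<le> 2 * (sqrt (a\<^sup>2 + r + b\<^sup>2))^3"
    by (rule cubic_sum_bound) (use ab r0 in \<open>auto simp: r_def\<close>)
  also have "\<dots> = 2 * (a\<^sup>2 + r + b\<^sup>2) powr (3/2)"
    using r0 by (subst powr_three_halves) (simp_all add: r_def)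
  finally show "DD Fp [y1, y1, y1] y + 3 * DD Fp [y1, y2] y + DD Fp [y3] y + DD Fp [h, h, h] x
      \<le> 2 * (DD Fp [y1, y1] y + DD Fp [y2] y + DD Fp [h, h] x) powr (3/2)"
    by (simp add: ab2 r_def del: DD.simps)
qed

section \<open>The block potential along a line\<close>

context
  fixes x s h ds :: 'a and v \<eta> :: real
  assumes L: "Line (x, s, v) (h, ds, \<eta>)"
begin

definition lx :: "real \<Rightarrow> 'a" where "lx t = x + t *\<^sub>R h"
definition lq :: "real \<Rightarrow> 'a" where "lq t = (v + t * \<eta>) *\<^sub>R h - \<eta> *\<^sub>R lx t"
definition lsig :: "real \<Rightarrow> 'a" where "lsig t = slack ((x, s, v) + t *\<^sub>R (h, ds, \<eta>))"
definition lsig1 :: "real \<Rightarrow> 'a" where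
  "lsig1 t = ds + (2 * (v + t * \<eta>) * \<eta>) *\<^sub>R GG [] (lx t) + (v + t * \<eta>)\<^sup>2 *\<^sub>R GG [h] (lx t)"
definition ly :: "real \<Rightarrow> 'a" where "ly t = Y ((x, s, v) + t *\<^sub>R (h, ds, \<eta>))"
definition ly1 :: "real \<Rightarrow> 'a" where "ly1 t = T (lsig1 t)"
definition ly2 :: "real \<Rightarrow> 'a" where "ly2 t = T (GG [lq t, lq t] (lx t))"
definition ly3 :: "real \<Rightarrow> 'a" where "ly3 t = T (GG [h, lq t, lq t] (lx t))"

lemma xhE: "x \<in> E" "s \<in> E" "h \<in> E" "ds \<in> E"
  using L by (simp_all add: Line_def)

lemma lx_E: "lx t \<in> E" unfolding lx_def using xhE subE by (simp add: subspace_add subspace_scale)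

lemma lx_I_iff: "lx t \<in> U \<longleftrightarrow> lx t \<in> I"
  using U_E[OF _ lx_E] U_I by blast

lemma lq_eq: "lq t = (- \<eta>) *\<^sub>R lx t + (v + t * \<eta>) *\<^sub>R h"
  by (simp add: lq_def)

lemma open_lx: "open {t. lx t \<in> U}"
proof -
  have "continuous_on UNIV lx" unfolding lx_def[abs_def] by (intro continuous_intros)
  then show ?thesis using open_vimage[OF open_U] by (simp add: vimage_def)
qed

lemma lx_deriv: "(lx has_vector_derivative h) (at t)"
  unfolding lx_def[abs_def] by (auto intro!: derivative_eq_intros)

lemma lsig_derivs:
  assumes "lx t \<in> I"
  shows "(lsig has_vector_derivative lsig1 t) (at t)"
    and "(lsig1 has_vector_derivative GG [lq t, lq t] (lx t)) (at t)"
    and "((\<lambda>t. GG [lq t, lq t] (lx t)) has_vector_derivative GG [h, lq t, lq t] (lx t)) (at t)"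
proof -
  have t: "x + t *\<^sub>R h \<in> I" using assms by (simp add: lx_def)
  note d = slack_derivs[OF L t, folded lx_def, folded lq_def lsig_def lsig1_def]
  show "(lsig has_vector_derivative lsig1 t) (at t)" using d(1) by (simp add: lsig_def[abs_def])
  show "(lsig1 has_vector_derivative GG [lq t, lq t] (lx t)) (at t)"
    using d(2) by (simp add: lsig1_def[abs_def])
  show "((\<lambda>t. GG [lq t, lq t] (lx t)) has_vector_derivative GG [h, lq t, lq t] (lx t)) (at t)"
  proof (rule has_vector_derivative_transform_within_open[OF d(3) open_lx])
    show "t \<in> {t. lx t \<in> U}" using assms lx_I_iff by simp
    fix r assume "r \<in> {t. lx t \<in> U}"
    then have "lx r \<in> I" using lx_I_iff by simp
    from GG_homogeneous(1)[OF this, of \<eta> "v + r * \<eta>" h]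
    show "(2 * \<eta>\<^sup>2) *\<^sub>R GG [] (lx r) + (4 * (v + r * \<eta>) * \<eta>) *\<^sub>R GG [h] (lx r) + (v + r * \<eta>)\<^sup>2 *\<^sub>R GG [h, h] (lx r)
      = GG [lq r, lq r] (lx r)" by (simp add: lq_def)
  qed
qed

lemma ly_eq: "ly t = T (lsig t)" by (simp add: ly_def lsig_def Y_def)

lemma bounded_linear_T: "bounded_linear T" using linT by (simp add: linear_conv_bounded_linear)

lemma ly_derivs:
  assumes "lx t \<in> I"
  shows "(ly has_vector_derivative ly1 t) (at t)" "(ly1 has_vector_derivative ly2 t) (at t)"
    "(ly2 has_vector_derivative ly3 t) (at t)"
  unfolding ly_eq[abs_def] ly1_def[abs_def] ly2_def[abs_def] ly3_def[abs_def]
  by (intro bounded_linear.has_vector_derivative[OF bounded_linear_T] lsig_derivs[OF assms])+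

lemma line_Dpsi: "(x, s, v) + t *\<^sub>R (h, ds, \<eta>) \<in> Dpsi \<longleftrightarrow> lx t \<in> I \<and> ly t \<in> I"
  using lx_I_iff by (simp add: Dpsi_def ly_def lx_def)

lemma open_line_Dpsi: "open {t. (x, s, v) + t *\<^sub>R (h, ds, \<eta>) \<in> Dpsi}"
proof -
  have "continuous_on UNIV (\<lambda>t. (x, s, v) + t *\<^sub>R (h, ds, \<eta>))" by (intro continuous_intros)
  then show ?thesis using open_vimage[OF open_Dpsi] by (simp add: vimage_def)
qed

lemma Y_part_derivs:
  assumes t: "(x, s, v) + t *\<^sub>R (h, ds, \<eta>) \<in> Dpsi"
  shows "((\<lambda>t. Fp (ly t)) has_real_derivative DD Fp [ly1 t] (ly t)) (at t)"
    and "((\<lambda>t. DD Fp [ly1 t] (ly t)) has_real_derivative DD Fp [ly1 t, ly1 t] (ly t) + DD Fp [ly2 t] (ly t)) (at t)"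
    and "((\<lambda>t. DD Fp [ly1 t, ly1 t] (ly t) + DD Fp [ly2 t] (ly t)) has_real_derivative
      DD Fp [ly1 t, ly1 t, ly1 t] (ly t) + 3 * DD Fp [ly1 t, ly2 t] (ly t) + DD Fp [ly3 t] (ly t)) (at t)"
proof -
  define W where "W = {t. (x, s, v) + t *\<^sub>R (h, ds, \<eta>) \<in> Dpsi}"
  have W: "open W" "t \<in> W" using open_line_Dpsi t by (simp_all add: W_def)
  have y: "ly r \<in> U" if "r \<in> W" for r using that line_Dpsi U_I by (simp add: W_def)
  note d = ly_derivs[OF conjunct1[OF t[unfolded line_Dpsi]]]
  show "((\<lambda>t. Fp (ly t)) has_real_derivative DD Fp [ly1 t] (ly t)) (at t)"
    using DD_curve[OF open_U smooth4 _ y[OF W(2)] d(1), of "[]"] by simp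
  show "((\<lambda>t. DD Fp [ly1 t] (ly t)) has_real_derivative DD Fp [ly1 t, ly1 t] (ly t) + DD Fp [ly2 t] (ly t)) (at t)"
    by (rule DD_curve_arg[OF open_U smooth4 _ y W d(1,2)]) simp_all
  have 1: "((\<lambda>t. DD Fp [ly1 t, ly1 t] (ly t)) has_real_derivative
      DD Fp [ly1 t, ly1 t, ly1 t] (ly t) + 2 * DD Fp [ly1 t, ly2 t] (ly t)) (at t)"
    by (rule DD_curve_arg2[OF open_U smooth_le y W d(1,2)]) simp_all
  have 2: "((\<lambda>t. DD Fp [ly2 t] (ly t)) has_real_derivative DD Fp [ly1 t, ly2 t] (ly t) + DD Fp [ly3 t] (ly t)) (at t)"
    by (rule DD_curve_arg[OF open_U smooth4 _ y W d(1,3)]) simp_all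
  show "((\<lambda>t. DD Fp [ly1 t, ly1 t] (ly t) + DD Fp [ly2 t] (ly t)) has_real_derivative
      DD Fp [ly1 t, ly1 t, ly1 t] (ly t) + 3 * DD Fp [ly1 t, ly2 t] (ly t) + DD Fp [ly3 t] (ly t)) (at t)"
    using DERIV_add[OF 1 2] by (simp add: algebra_simps del: DD.simps)
qed

lemma DD_Psi_line:
  assumes z: "(x, s, v) \<in> Dpsi" and t: "(x, s, v) + t *\<^sub>R (h, ds, \<eta>) \<in> Dpsi"
  shows "DD Psi [(h, ds, \<eta>), (h, ds, \<eta>)] ((x, s, v) + t *\<^sub>R (h, ds, \<eta>))
      = DD Fp [ly1 t, ly1 t] (ly t) + DD Fp [ly2 t] (ly t) + DD Fp [h, h] (lx t)"
    and "DD Psi [(h, ds, \<eta>), (h, ds, \<eta>), (h, ds, \<eta>)] ((x, s, v) + t *\<^sub>R (h, ds, \<eta>))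
      = DD Fp [ly1 t, ly1 t, ly1 t] (ly t) + 3 * DD Fp [ly1 t, ly2 t] (ly t) + DD Fp [ly3 t] (ly t) + DD Fp [h, h, h] (lx t)"
proof -
  let ?z = "(x, s, v)" and ?d = "(h, ds, \<eta>)"
  have lx: "((\<lambda>t. DD Fp hs (lx t)) has_real_derivative DD Fp (h # hs) (lx t)) (at t)"
    if "?z + t *\<^sub>R ?d \<in> Dpsi" "length hs < 4" for t hs
    using DD_curve[OF open_U smooth4 that(2) _ lx_deriv] that(1) line_Dpsi U_I by blast
  have p0: "DD Psi [] (?z + t *\<^sub>R ?d) = Fp (ly t) + DD Fp [] (lx t)" for t
    by (simp add: Psi_def ly_def lx_def)
  have p1: "DD Psi [?d] (?z + t *\<^sub>R ?d) = DD Fp [ly1 t] (ly t) + DD Fp [h] (lx t)" if "?z + t *\<^sub>R ?d \<in> Dpsi" for t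
    by (rule DD_line_unique[OF open_Dpsi z p0 _ that]) (intro DERIV_add Y_part_derivs(1) lx; simp)
  have p2: "DD Psi [?d, ?d] (?z + t *\<^sub>R ?d) = DD Fp [ly1 t, ly1 t] (ly t) + DD Fp [ly2 t] (ly t) + DD Fp [h, h] (lx t)"
    if "?z + t *\<^sub>R ?d \<in> Dpsi" for t
    by (rule DD_line_unique[OF open_Dpsi z p1 _ that], assumption) (rule DERIV_add[OF Y_part_derivs(2) lx]; simp)
  show "DD Psi [?d, ?d] (?z + t *\<^sub>R ?d) = DD Fp [ly1 t, ly1 t] (ly t) + DD Fp [ly2 t] (ly t) + DD Fp [h, h] (lx t)"
    by (rule p2[OF t])
  show "DD Psi [?d, ?d, ?d] (?z + t *\<^sub>R ?d)
      = DD Fp [ly1 t, ly1 t, ly1 t] (ly t) + 3 * DD Fp [ly1 t, ly2 t] (ly t) + DD Fp [ly3 t] (ly t) + DD Fp [h, h, h] (lx t)"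
    by (rule DD_line_unique[OF open_Dpsi z p2 _ t], assumption) (rule DERIV_add[OF Y_part_derivs(3) lx]; simp)
qed

lemma Psi_point:
  assumes z: "(x, s, v) \<in> Dpsi"
  shows "0 \<le> DD Psi [(h, ds, \<eta>), (h, ds, \<eta>)] (x, s, v)"
    and "DD Psi [(h, ds, \<eta>), (h, ds, \<eta>), (h, ds, \<eta>)] (x, s, v)
      \<le> 2 * (DD Psi [(h, ds, \<eta>), (h, ds, \<eta>)] (x, s, v)) powr (3/2)"
proof -
  have z0: "(x, s, v) + 0 *\<^sub>R (h, ds, \<eta>) = (x, s, v)" by (simp add: zero_prod_def)
  have z': "(x, s, v) + 0 *\<^sub>R (h, ds, \<eta>) \<in> Dpsi" using z unfolding z0 .
  have m: "lx 0 \<in> I" "ly 0 \<in> I" using z' unfolding line_Dpsi by auto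
  note e = DD_Psi_line[OF z z', unfolded z0]
  note b = block_point_bounds[OF m(1) xhE(3) lq_eq m(2), folded ly2_def ly3_def]
  show "0 \<le> DD Psi [(h, ds, \<eta>), (h, ds, \<eta>)] (x, s, v)"
    unfolding e using b(1) sc_D2_nonneg[OF sc_Fp U_I[OF m(1)], of h] sc_D2_nonneg[OF sc_Fp U_I[OF m(2)], of "ly1 0"]
    by linarith
  show "DD Psi [(h, ds, \<eta>), (h, ds, \<eta>), (h, ds, \<eta>)] (x, s, v)
      \<le> 2 * (DD Psi [(h, ds, \<eta>), (h, ds, \<eta>)] (x, s, v)) powr (3/2)"
    unfolding e by (rule b(2))
qed

lemma lsig_E: "lx t \<in> U \<Longrightarrow> lsig t \<in> E"
proof -
  assume "lx t \<in> U"
  then have "GG [] (lx t) \<in> E" by (rule GG_E) simp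
  then show ?thesis using xhE subE
    by (simp add: lsig_def slack_def lx_def subspace_add subspace_scale)
qed

lemma ly_I_iff: "lx t \<in> I \<Longrightarrow> ly t \<in> I \<longleftrightarrow> lsig t \<in> Is"
  unfolding ly_eq using T_I_iff[OF lsig_E] U_I by blast

text \<open>By \<open>neg_GG_Ks\<close> the slack paired with any element of the cone is concave
  along the line. So the slack at an intermediate time is its chord, an interior point of the dual
  cone, plus an element of the dual cone.\<close>

lemma Dpsi_segment:
  assumes 0: "(x, s, v) \<in> Dpsi" and 1: "(x, s, v) + (h, ds, \<eta>) \<in> Dpsi" and t: "0 \<le> t" "t \<le> 1"
  shows "(x, s, v) + t *\<^sub>R (h, ds, \<eta>) \<in> Dpsi"
proof -
  have z0: "(x, s, v) + 0 *\<^sub>R (h, ds, \<eta>) = (x, s, v)" by (simp add: zero_prod_def)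
  have m0: "lx 0 \<in> I" "ly 0 \<in> I" using 0 line_Dpsi[of 0] unfolding z0 by auto
  have m1: "lx 1 \<in> I" "ly 1 \<in> I" using 1 line_Dpsi[of 1] by auto
  have lx: "lx r \<in> I" if "0 \<le> r" "r \<le> 1" for r
    using convex_line_mem[OF convex_I, of x h r] m0 m1 that by (simp add: lx_def)
  have "lsig t - ((1 - t) *\<^sub>R lsig 0 + t *\<^sub>R lsig 1) \<in> Ks"
    unfolding dual_cone_def
  proof (intro CollectI conjI ballI)
    show "lsig t - ((1 - t) *\<^sub>R lsig 0 + t *\<^sub>R lsig 1) \<in> E"
      using lsig_E[OF U_I[OF lx]] t subE by (simp add: subspace_add subspace_scale subspace_diff)
    fix k assume k: "k \<in> K"
    have "convex_on {0..1} (\<lambda>t. - (lsig t \<bullet> k))"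
    proof (rule f''_ge0_imp_convex)
      fix r :: real assume r: "r \<in> {0..1}"
      then have lr: "lx r \<in> I" using lx by simp
      have inn: "((\<lambda>t. g t \<bullet> k) has_real_derivative g' \<bullet> k) (at r)" if "(g has_vector_derivative g') (at r)" for g g'
        using that by (simp add: has_real_derivative_iff_has_vector_derivative bounded_linear.has_vector_derivative[OF bounded_linear_inner_left])
      show "((\<lambda>t. - (lsig t \<bullet> k)) has_real_derivative - (lsig1 r \<bullet> k)) (at r)"
        by (intro DERIV_minus inn lsig_derivs lr)
      show "((\<lambda>r. - (lsig1 r \<bullet> k)) has_real_derivative - (GG [lq r, lq r] (lx r) \<bullet> k)) (at r)"
        by (intro DERIV_minus inn lsig_derivs lr)
      have "- GG [lq r, lq r] (lx r) \<in> Ks" by (rule neg_GG_Ks[OF lr xhE(3) lq_eq])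
      then show "0 \<le> - (GG [lq r, lq r] (lx r) \<bullet> k)" using k by (simp add: dual_cone_def)
    qed simp
    from convex_onD[OF this t, of 0 1] show "0 \<le> (lsig t - ((1 - t) *\<^sub>R lsig 0 + t *\<^sub>R lsig 1)) \<bullet> k"
      by (simp add: inner_add_left inner_diff_left)
  qed
  moreover have "(1 - t) *\<^sub>R lsig 0 + t *\<^sub>R lsig 1 \<in> Is"
    using convexD[OF convex_Is, of "lsig 0" "lsig 1" "1 - t" t] m0 m1 ly_I_iff t by simp
  ultimately have "lsig t \<in> Is" using Is_add by fastforce
  then show ?thesis using line_Dpsi ly_I_iff lx[OF t] by simp
qed

text \<open>Both parts of the potential are bounded below on the segment, hence both are bounded
  above by a constant, and closedness of \<open>F\<close> handles them one after the other.\<close>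

lemma Psi_barrier:
  assumes z: "(x, s, v) \<in> Dpsi"
    and b: "\<And>t. 0 \<le> t \<Longrightarrow> t < 1 \<Longrightarrow> (x, s, v) + t *\<^sub>R (h, ds, \<eta>) \<in> Dpsi \<and> Psi ((x, s, v) + t *\<^sub>R (h, ds, \<eta>)) \<le> C"
  shows "(x, s, v) + (h, ds, \<eta>) \<in> Dpsi"
proof -
  have m: "lx t \<in> I" "ly t \<in> I" if "0 \<le> t" "t < 1" for t using b[OF that] line_Dpsi by auto
  have Psi: "Fp (ly t) + Fp (lx t) \<le> C" if "0 \<le> t" "t < 1" for t
    using b[OF that] by (simp add: Psi_def ly_def lx_def)
  define A where "A = Fp x - \<bar>DD Fp [h] x\<bar>"
  have lox: "A \<le> Fp (lx t)" if "0 \<le> t" "t < 1" for t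
    unfolding A_def lx_def using m(1)[OF that] m(1)[of 0] that
    by (intro sc_barrier_segment_lower[OF sc_Fp]) (auto simp: lx_def U_I)
  define B where "B = Fp (ly 0) - \<bar>DD Fp [ly1 0] (ly 0)\<bar>"
  \<comment> \<open>The path \<open>ly\<close> is curved, but \<open>Fp\<close> along it is still
    convex because the curvature term is nonnegative; so its tangent at time 0 bounds it
    below.\<close>
  have loy: "B \<le> Fp (ly t)" if t: "0 \<le> t" "t < 1" for t
  proof -
    have dr: "(x, s, v) + r *\<^sub>R (h, ds, \<eta>) \<in> Dpsi" if "0 \<le> r" "r \<le> t" for r using b[of r] that t by auto
    have sl: "DD Fp [ly1 0] (ly 0) \<le> DD Fp [ly1 r] (ly r)" if r: "0 \<le> r" "r \<le> t" for r
    proof (rule DERIV_nonneg_imp_le[OF r(1) Y_part_derivs(2)])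
      fix w assume w: "0 \<le> w" "w \<le> r"
      then show "(x, s, v) + w *\<^sub>R (h, ds, \<eta>) \<in> Dpsi" using dr r by simp
      have w1: "w < 1" using w r t by simp
      show "0 \<le> DD Fp [ly1 w, ly1 w] (ly w) + DD Fp [ly2 w] (ly w)"
        using block_point_bounds(1)[OF m(1)[OF w(1) w1] xhE(3) lq_eq m(2)[OF w(1) w1], folded ly2_def]
          sc_D2_nonneg[OF sc_Fp U_I[OF m(2)[OF w(1) w1]], of "ly1 w"] by linarith
    qed
    define g where "g r = Fp (ly r) - r * DD Fp [ly1 0] (ly 0)" for r
    have "g 0 \<le> g t"
    proof (rule DERIV_nonneg_imp_le[OF t(1)])
      fix r assume r: "0 \<le> r" "r \<le> t"
      show "(g has_real_derivative DD Fp [ly1 r] (ly r) - 1 * DD Fp [ly1 0] (ly 0)) (at r)"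
        unfolding g_def by (intro DERIV_diff Y_part_derivs(1) dr r DERIV_cmult_right DERIV_ident)
      show "0 \<le> DD Fp [ly1 r] (ly r) - 1 * DD Fp [ly1 0] (ly 0)" using sl[OF r] by simp
    qed
    then have "Fp (ly 0) + t * DD Fp [ly1 0] (ly 0) \<le> Fp (ly t)" by (simp add: g_def del: DD.simps)
    moreover have "\<bar>t * DD Fp [ly1 0] (ly 0)\<bar> \<le> \<bar>DD Fp [ly1 0] (ly 0)\<bar>"
      using t by (simp add: abs_mult mult_left_le_one_le del: DD.simps)
    ultimately show ?thesis unfolding B_def by linarith
  qed
  define t where "t n = 1 - inverse (real (Suc n))" for n
  have t: "0 \<le> t n" "t n < 1" for n by (simp_all add: t_def inverse_le_1_iff)
  have "t \<longlonglongrightarrow> 1 - 0" unfolding t_def[abs_def] by (intro tendsto_intros LIMSEQ_inverse_real_of_nat)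
  then have t1: "t \<longlonglongrightarrow> 1" by simp
  have lim1: "(\<lambda>n. lx (t n)) \<longlonglongrightarrow> lx 1" unfolding lx_def by (intro tendsto_intros t1)
  have up1: "F (lx (t n)) \<le> C - B" for n using Psi[OF t[of n]] loy[OF t[of n]] Fp_I[OF m(1)[OF t[of n]]] by simp
  have I1: "lx 1 \<in> I" by (rule closed_barrier(1)[OF m(1)[OF t] up1 lim1])
  \<comment> \<open>The order matters: \<open>ly\<close> is known to be continuous at 1 only after
    \<open>lx 1\<close> has been placed in the interior.\<close>
  have "isCont ly 1" using ly_derivs(1)[OF I1] has_vector_derivative_continuous by blast
  then have lim2: "(\<lambda>n. ly (t n)) \<longlonglongrightarrow> ly 1" using t1 isCont_tendsto_compose by blast
  have up2: "F (ly (t n)) \<le> C - A" for n using Psi[OF t[of n]] lox[OF t[of n]] Fp_I[OF m(2)[OF t[of n]]] by simp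
  have I2: "ly 1 \<in> I" by (rule closed_barrier(1)[OF m(2)[OF t] up2 lim2])
  show ?thesis using I1 I2 line_Dpsi[of 1] by simp
qed

end

lemma sc_Psi: "sc_barrier Dpsi Psi"
  unfolding sc_barrier_def
proof (intro conjI ballI allI impI)
  have red: "DD Psi hs z = DD Psi (map pr hs) (pr z)" for hs z
    using DD_affine[OF linear_pr, of Psi 0 hs z] by (simp add: Psi_pr)
  have addp: "pr (z + t *\<^sub>R d) = pr z + t *\<^sub>R pr d" for z d t
    using linear_pr by (simp add: linear_add linear_cmul)
  show "open Dpsi" by (rule open_Dpsi)
  show "convex Dpsi"
  proof (rule convexI)
    fix z z' and a b :: real assume h: "z \<in> Dpsi" "z' \<in> Dpsi" "0 \<le> a" "0 \<le> b" "a + b = 1"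
    have "pr z + b *\<^sub>R pr (z' - z) \<in> Dpsi"
    proof (cases "pr z", cases "pr (z' - z)")
      fix x s v k ds \<eta> assume e: "pr z = (x, s, v)" "pr (z' - z) = (k, ds, \<eta>)"
      have "Line (x, s, v) (k, ds, \<eta>)" using Line_pr[of z "z' - z"] e by simp
      moreover have "(x, s, v) \<in> Dpsi" using h(1) Dpsi_pr e by metis
      moreover have "(x, s, v) + (k, ds, \<eta>) \<in> Dpsi"
      proof -
        have "pr z + pr (z' - z) = pr z'" using linear_pr by (simp add: linear_diff)
        then show ?thesis using h(2) Dpsi_pr e by metis
      qed
      ultimately show ?thesis unfolding e using h by (intro Dpsi_segment) auto
    qed
    then have "z + b *\<^sub>R (z' - z) \<in> Dpsi" using Dpsi_pr addp by metis
    moreover have "z + b *\<^sub>R (z' - z) = (1 - b) *\<^sub>R z + b *\<^sub>R z'" by (simp add: algebra_simps)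
    moreover have "a = 1 - b" using h by simp
    ultimately show "a *\<^sub>R z + b *\<^sub>R z' \<in> Dpsi" by simp
  qed
  show "smooth_on 3 Dpsi Psi" by (rule smooth_Psi)
  fix z d assume z: "z \<in> Dpsi"
  obtain x s v where e1: "pr z = (x, s, v)" by (cases "pr z")
  obtain k ds \<eta> where e2: "pr d = (k, ds, \<eta>)" by (cases "pr d")
  have L: "Line (x, s, v) (k, ds, \<eta>)" using Line_pr[of z d] e1 e2 by simp
  have m: "(x, s, v) \<in> Dpsi" using z Dpsi_pr e1 by metis
  show "0 \<le> DD Psi [d, d] z" unfolding red[of _ z] list.map e1 e2 by (rule Psi_point(1)[OF L m])
  show "DD Psi [d, d, d] z \<le> 2 * DD Psi [d, d] z powr (3 / 2)"
    unfolding red[of _ z] list.map e1 e2 by (rule Psi_point(2)[OF L m])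
  fix C assume *: "\<forall>t\<in>{0..<1}. z + t *\<^sub>R d \<in> Dpsi \<and> Psi (z + t *\<^sub>R d) \<le> C"
  have "(x, s, v) + (k, ds, \<eta>) \<in> Dpsi"
  proof (rule Psi_barrier[OF L m])
    fix t :: real assume "0 \<le> t" "t < 1"
    then have "z + t *\<^sub>R d \<in> Dpsi \<and> Psi (z + t *\<^sub>R d) \<le> C" using * by simp
    then show "(x, s, v) + t *\<^sub>R (k, ds, \<eta>) \<in> Dpsi \<and> Psi ((x, s, v) + t *\<^sub>R (k, ds, \<eta>)) \<le> C"
      using addp[of z t d] Dpsi_pr[of "z + t *\<^sub>R d"] Psi_pr[of "z + t *\<^sub>R d"] unfolding e1 e2 by metis
  qed
  then show "z + d \<in> Dpsi" using Dpsi_pr[of "z + d"] linear_pr e1 e2 by (simp add: linear_add)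
qed

lemma slack_grad: "x \<in> I \<Longrightarrow> slack (x, s, v) = s + v\<^sup>2 *\<^sub>R grad E F x"
  using GG_grad[OF U_I] I_sub by (simp add: slack_def)

lemma Dpsi_iff:
  assumes "x \<in> E" "s \<in> E"
  shows "(x, s, v) \<in> Dpsi \<longleftrightarrow> x \<in> I \<and> s + v\<^sup>2 *\<^sub>R grad E F x \<in> Is"
proof (cases "x \<in> I")
  case True
  have "s + v\<^sup>2 *\<^sub>R grad E F x \<in> E"
    using grad_inner(1)[OF True] assms subE by (simp add: subspace_add subspace_scale)
  then show ?thesis using True U_I T_I_iff slack_grad[OF True] by (simp add: Dpsi_def Y_def)
next
  case False then show ?thesis using U_E[OF _ assms(1)] by (auto simp: Dpsi_def)
qed

lemma Psi_conj:
  assumes "x \<in> I" "s + v\<^sup>2 *\<^sub>R grad E F x \<in> Is"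
  shows "Psi (x, s, v) = conj_barrier E K F (s + v\<^sup>2 *\<^sub>R grad E F x) + F x + (2 * F w0 + \<nu>)"
proof -
  have "T (s + v\<^sup>2 *\<^sub>R grad E F x) \<in> I" using T_I_iff Is_sub(1) assms(2) by blast
  then show ?thesis using conj_eq[OF assms(2)] Fp_I assms(1) slack_grad[OF assms(1)]
    by (simp add: Psi_def Y_def)
qed

lemma slack_dual:
  assumes "x \<in> I" "s + v\<^sup>2 *\<^sub>R grad E F x \<in> Is"
  shows "s \<in> Is"
proof -
  have "v\<^sup>2 *\<^sub>R (- grad E F x) \<in> Ks"
    by (rule dual_cone_props(3)[OF subE Is_sub(2)[OF neg_grad_Is[OF assms(1)]]]) simp
  then show ?thesis using Is_add[OF assms(2)] by fastforce
qed

end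

subsection \<open>Product cones\<close>

lemma int_in_vprod:
  fixes E S :: "'n::finite \<Rightarrow> 'a::euclidean_space set"
  shows "int_in (vprod E) (vprod S) = vprod (\<lambda>i. int_in (E i) (S i))"
proof (intro set_eqI iffI)
  fix x assume "x \<in> int_in (vprod E) (vprod S)"
  then obtain e where e: "e > 0" "\<And>y. y \<in> vprod E \<Longrightarrow> dist x y < e \<Longrightarrow> y \<in> vprod S" and x: "x \<in> vprod E"
    by (auto simp: int_in_iff)
  have "y \<in> S i" if y: "y \<in> E i" "dist (x $ i) y < e" for i y
  proof -
    define z where "z = (\<chi> j. if j = i then y else x $ j)"
    have "z \<in> vprod E" using x y by (auto simp: vprod_def z_def)
    moreover have "dist x z \<le> (\<Sum>j\<in>UNIV. norm ((x - z) $ j))"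
      by (simp add: dist_norm norm_vec_def L2_set_le_sum)
    moreover have "(\<Sum>j\<in>UNIV. norm ((x - z) $ j)) = (\<Sum>j\<in>UNIV. if j = i then norm (x $ i - y) else 0)"
      by (intro sum.cong) (auto simp: z_def)
    ultimately have "z \<in> vprod S" using e(2)[of z] y by (simp add: dist_norm)
    then have "z $ i \<in> S i" by (simp add: vprod_def)
    then show ?thesis by (simp add: z_def)
  qed
  then show "x \<in> vprod (\<lambda>i. int_in (E i) (S i))"
    using x e(1) by (auto simp: vprod_def int_in_iff)
next
  fix x assume "x \<in> vprod (\<lambda>i. int_in (E i) (S i))"
  then have x: "x \<in> vprod E" and "\<forall>i. \<exists>e>0. \<forall>y\<in>E i. dist (x $ i) y < e \<longrightarrow> y \<in> S i"
    by (auto simp: vprod_def int_in_iff)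
  then obtain e where e: "\<And>i. e i > 0" "\<And>i y. y \<in> E i \<Longrightarrow> dist (x $ i) y < e i \<Longrightarrow> y \<in> S i" by metis
  define d where "d = Min (range e)"
  have d: "d > 0" "d \<le> e i" for i using e(1) by (auto simp: d_def)
  have "y \<in> vprod S" if "y \<in> vprod E" "dist x y < d" for y
    unfolding vprod_def
  proof (intro CollectI allI)
    fix i
    have "dist (x $ i) (y $ i) < e i" using dist_vec_nth_le[of x i y] that d(2)[of i] by linarith
    then show "y $ i \<in> S i" using e(2) that by (auto simp: vprod_def)
  qed
  then show "x \<in> int_in (vprod E) (vprod S)" using x d(1) by (auto simp: int_in_iff)
qed

lemma dual_cone_vprod:
  fixes E K :: "'n::finite \<Rightarrow> 'a::euclidean_space set"
  assumes "\<And>i. 0 \<in> K i"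
  shows "dual_cone (vprod E) (vprod K) = vprod (\<lambda>i. dual_cone (E i) (K i))"
proof (intro set_eqI iffI)
  fix s assume s: "s \<in> dual_cone (vprod E) (vprod K)"
  have "0 \<le> s $ i \<bullet> k" if k: "k \<in> K i" for i k
  proof -
    have "axis i k \<in> vprod K" using assms k by (auto simp: vprod_def axis_def)
    then have "0 \<le> s \<bullet> axis i k" using s by (simp add: dual_cone_def)
    then show ?thesis by (simp add: inner_axis)
  qed
  then show "s \<in> vprod (\<lambda>i. dual_cone (E i) (K i))" using s by (auto simp: dual_cone_def vprod_def)
next
  fix s assume "s \<in> vprod (\<lambda>i. dual_cone (E i) (K i))"
  then show "s \<in> dual_cone (vprod E) (vprod K)"
    by (auto simp: dual_cone_def vprod_def inner_vec_def intro!: sum_nonneg)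
qed

subsection \<open>The multiconic potential\<close>

type_synonym ('a, 'n, 'm) pdtarget = "(('a ^ 'n) \<times> (real ^ 'm)) \<times> 'n target"

locale multiconic =
  fixes P :: "('a::euclidean_space, 'n::finite, 'm::finite) multiconic"
  assumes mp: "multiconic_problem P"
begin

sublocale blk: self_scaled_block "Esp P i" "Kc P i" "nup P i" "Fb P i" for i
  using mp by unfold_locales (auto simp: multiconic_problem_def)

abbreviation "E \<equiv> Etot P"
abbreviation "A \<equiv> Atot P"
abbreviation "b \<equiv> bvec P"
abbreviation "c \<equiv> cvec P"
abbreviation "As \<equiv> Astar P"
abbreviation "N \<equiv> nu_norm2 P"

lemma E_iff: "x \<in> E \<longleftrightarrow> (\<forall>i. x $ i \<in> Esp P i)"
  by (simp add: Etot_def vprod_def)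

lemma subspace_E: "subspace E"
  using blk.subE by (auto simp: subspace_def E_iff)

lemma int_primal_iff: "x \<in> int_in E (Ktot P) \<longleftrightarrow> (\<forall>i. x $ i \<in> blk.I i)"
  unfolding Etot_def Ktot_def int_in_vprod by (simp add: vprod_def)

lemma int_dual_iff: "s \<in> int_in E (dual_cone E (Ktot P)) \<longleftrightarrow> (\<forall>i. s $ i \<in> blk.Is i)"
proof -
  have "0 \<in> Kc P i" for i using blk.K_props(5)[of i] by auto
  then show ?thesis unfolding Etot_def Ktot_def by (simp add: dual_cone_vprod int_in_vprod) (simp add: vprod_def)
qed

lemma cE: "c \<in> E" and linear_Aop: "linear (Aop P i)"
  using mp by (auto simp: multiconic_problem_def)

lemma linear_A: "linear A"
  by (rule linearI) (simp_all add: Atot_def sum.distrib scaleR_sum_right linear_add[OF linear_Aop] linear_cmul[OF linear_Aop])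

lemma As_nth:
  shows "As y $ i \<in> Esp P i" and "h \<in> Esp P i \<Longrightarrow> As y $ i \<bullet> h = y \<bullet> Aop P i h"
proof -
  have l: "linear (\<lambda>h. y \<bullet> Aop P i h)"
    using linear_Aop[of i] by (simp add: linear_iff inner_add_right)
  show "As y $ i \<in> Esp P i" "h \<in> Esp P i \<Longrightarrow> As y $ i \<bullet> h = y \<bullet> Aop P i h"
    using riesz_linear[OF blk.subE l] by (simp_all add: Astar_def)
qed

lemma As_E: "As y \<in> E" by (simp add: E_iff As_nth)

lemma As_inner: "x \<in> E \<Longrightarrow> As y \<bullet> x = y \<bullet> A x"
  by (simp add: E_iff inner_vec_def[of "As y"] As_nth Atot_def inner_sum_right)

lemma linear_As: "linear As"
proof (rule linearI)
  fix y y' :: "real ^ 'm" and t :: real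
  have "riesz (Esp P i) (\<lambda>h. (y + y') \<bullet> Aop P i h) = As y $ i + As y' $ i" for i
    by (rule riesz_eqI[OF blk.subE]) (auto simp: As_nth inner_add_left intro: subspace_add[OF blk.subE])
  then show "As (y + y') = As y + As y'" by (simp add: vec_eq_iff) (simp add: Astar_def)
  have "riesz (Esp P i) (\<lambda>h. (t *\<^sub>R y) \<bullet> Aop P i h) = t *\<^sub>R As y $ i" for i
    by (rule riesz_eqI[OF blk.subE]) (auto simp: As_nth intro: subspace_scale[OF blk.subE])
  then show "As (t *\<^sub>R y) = t *\<^sub>R As y" by (simp add: vec_eq_iff) (simp add: Astar_def)
qed

text \<open>Split off the part of \<open>r\<close> orthogonal to the range of the adjoint. It is
  annihilated by \<open>A\<close>, so it is orthogonal to \<open>r\<close> and therefore to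
  itself.\<close>

lemma range_As:
  assumes r: "r \<in> E" and orth: "\<And>e. e \<in> E \<Longrightarrow> A e = 0 \<Longrightarrow> r \<bullet> e = 0"
  obtains y where "r = As y"
proof -
  have sp: "span (range As) = range As"
    using linear_subspace_image[OF linear_As subspace_UNIV] by (simp add: span_eq_iff)
  obtain r1 r2 where d: "r1 \<in> span (range As)" "\<And>w. w \<in> span (range As) \<Longrightarrow> orthogonal r2 w" "r = r1 + r2"
    by (rule orthogonal_subspace_decomp_exists[of "range As" r]) blast
  obtain y where y: "r1 = As y" using d(1) sp by auto
  have r2E: "r2 \<in> E" using d(3) y r As_E[of y] subspace_diff[OF subspace_E, of r r1] by simp
  have "A r2 \<bullet> A r2 = As (A r2) \<bullet> r2" by (simp add: As_inner[OF r2E])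
  also have "\<dots> = 0" using d(2)[of "As (A r2)"] sp by (simp add: orthogonal_def inner_commute)
  finally have "A r2 = 0" by simp
  then have "r \<bullet> r2 = 0" using orth r2E by blast
  moreover have "r1 \<bullet> r2 = 0" using d(2)[OF d(1)] by (simp add: orthogonal_def inner_commute)
  ultimately have "r2 \<bullet> r2 = 0" using d(3) by (simp add: inner_add_left)
  then show thesis using that[of y] y d(3) by simp
qed

lemma nu_ge: "1 \<le> nup P i" by (rule blk.nu1)

lemma nu_nonneg: "0 \<le> nu P"
  unfolding nu_def using nu_ge by (intro sum_nonneg) (meson order_trans zero_le_one)

lemma N_nonneg: "0 \<le> N v"
  unfolding nu_norm2_def using nu_ge by (intro sum_nonneg mult_nonneg_nonneg) (auto intro: order_trans[OF zero_le_one])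

text \<open>Together with \<open>off\<close> this is the affine map that eliminates the dual slack
  by \<open>s = c - As y\<close> and extracts the variables of one block.\<close>

definition Lm :: "'n \<Rightarrow> ('a, 'n, 'm) pdtarget \<Rightarrow> 'a \<times> 'a \<times> real" where
  "Lm i = (\<lambda>((x, y), (v0, v)). (x $ i, - (As y $ i), v $ i))"

definition off :: "'n \<Rightarrow> 'a \<times> 'a \<times> real" where "off i = (0, c $ i, 0)"

definition xi :: "('a, 'n, 'm) pdtarget \<Rightarrow> real" where
  "xi = (\<lambda>((x, y), (v0, v)). v0 - c \<bullet> x + b \<bullet> y)"

lemma linear_Lm: "linear (Lm i)"
  using linear_As by (auto simp: linear_iff Lm_def)

lemma linear_xi: "linear xi"
  by (auto simp: linear_iff xi_def inner_add_right algebra_simps)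

text \<open>The shape \<open>0 + xi z\<close>, here and in \<open>f\<close>, matches
  \<open>sc_barrier_affine\<close> with zero offset.\<close>

definition Dom :: "('a, 'n, 'm) pdtarget set" where
  "Dom = (\<Inter>i. {z. off i + Lm i z \<in> blk.Dpsi i}) \<inter> {z. 0 + xi z \<in> {0<..}}"

definition f :: "('a, 'n, 'm) pdtarget \<Rightarrow> real" where
  "f z = (\<Sum>i\<in>UNIV. blk.Psi i (off i + Lm i z)) + - ln (0 + xi z)"

definition const :: real where "const = (\<Sum>i\<in>UNIV. 2 * Fb P i (blk.w0 i) + nup P i)"

lemma sc_f: "sc_barrier Dom f"
  unfolding Dom_def f_def[abs_def]
  by (intro sc_barrier_add sc_barrier_sum sc_barrier_affine[OF blk.sc_Psi linear_Lm] sc_barrier_affine[OF sc_barrier_ln linear_xi]) simp_all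

lemma off_Lm: "off i + Lm i ((x, y), (v0, v)) = (x $ i, (c - As y) $ i, v $ i)"
  by (simp add: off_def Lm_def)

lemma dual_E: "c - As y \<in> E"
  using subspace_diff[OF subspace_E cE As_E] .

lemma Dom_iff:
  assumes x: "x \<in> E"
  shows "((x, y), (v0, v)) \<in> Dom \<longleftrightarrow>
    (\<forall>i. x $ i \<in> blk.I i \<and> scaled_slack P i (x $ i) ((c - As y) $ i) (v $ i) \<in> blk.Is i) \<and> 0 < v0 - c \<bullet> x + b \<bullet> y"
proof -
  have "x $ i \<in> Esp P i" "(c - As y) $ i \<in> Esp P i" for i using x dual_E[of y] by (simp_all add: E_iff)
  then have "(x $ i, (c - As y) $ i, v $ i) \<in> blk.Dpsi i \<longleftrightarrow>
      x $ i \<in> blk.I i \<and> scaled_slack P i (x $ i) ((c - As y) $ i) (v $ i) \<in> blk.Is i" for i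
    using blk.Dpsi_iff[of "x $ i" i "(c - As y) $ i" "v $ i"] unfolding scaled_slack_def by blast
  then show ?thesis unfolding Dom_def by (simp only: Int_iff INT_iff mem_Collect_eq off_Lm) (simp add: xi_def)
qed

lemma dom_Fhat_iff:
  assumes x: "x \<in> E"
  shows "((x, y, c - As y), (v0, v)) \<in> dom_Fhat P \<longleftrightarrow> ((x, y), (v0, v)) \<in> Dom"
  unfolding Dom_iff[OF x] dom_Fhat_def
  using blk.slack_dual[of "x $ i" i "(c - As y) $ i" "v $ i" for i] by (auto simp: scaled_slack_def)

lemma Fhat_fin_eq:
  assumes x: "x \<in> E" and D: "((x, y), (v0, v)) \<in> Dom"
  shows "Fhat_fin P (x, y, c - As y) (v0, v) = f ((x, y), (v0, v)) - const"
proof -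
  have "blk.Psi i (x $ i, (c - As y) $ i, v $ i) = Phi P i (x $ i) ((c - As y) $ i) (v $ i) + (2 * Fb P i (blk.w0 i) + nup P i)" for i
    using D blk.Psi_conj[of "x $ i" i "(c - As y) $ i" "v $ i"] unfolding Dom_iff[OF x] Phi_def scaled_slack_def by simp
  then show ?thesis unfolding f_def off_Lm by (simp add: Fhat_fin_def const_def xi_def sum.distrib)
qed

text \<open>The explicit value of \<open>phi\<close>, identified in \<open>phi_eq\<close>.\<close>

definition ell :: "'n target \<Rightarrow> real" where
  "ell = (\<lambda>(v0, v). - (nu P + 1) * ln ((v0 - N v) / (nu P + 1)) - nu P)"

text \<open>Jensen's inequality in the form \<open>ln r \<le> ln m + r / m - 1\<close> with the mean \<open>m\<close>.\<close>

lemma f_lower_bound: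
  assumes x: "x \<in> E" "A x = b" and D: "((x, y), (v0, v)) \<in> Dom"
  shows "N v < v0" and "ell (v0, v) \<le> f ((x, y), (v0, v)) - const"
proof -
  define s where "s = c - As y"
  define \<sigma> where "\<sigma> i = scaled_slack P i (x $ i) (s $ i) (v $ i)" for i
  define a where "a i = \<sigma> i \<bullet> x $ i" for i
  define \<xi> where "\<xi> = v0 - c \<bullet> x + b \<bullet> y"
  have d: "x $ i \<in> blk.I i" "\<sigma> i \<in> blk.Is i" "0 < \<xi>" for i
    using D unfolding Dom_iff[OF x(1)] s_def[symmetric] \<sigma>_def[symmetric] \<xi>_def[symmetric] by auto
  have a: "0 < a i" for i unfolding a_def by (rule blk.inner_pos[OF d(2,1)])
  have ai: "a i = s $ i \<bullet> x $ i - nup P i * (v $ i)\<^sup>2" for i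
    unfolding a_def \<sigma>_def scaled_slack_def using blk.grad_self[OF d(1)] by (simp add: inner_add_left mult.commute)
  have "s \<bullet> x = c \<bullet> x - b \<bullet> y"
    using As_inner[OF x(1), of y] x(2) by (simp add: s_def inner_diff_left inner_commute[of b])
  \<comment> \<open>By feasibility \<open>s \<bullet> x\<close> is the duality gap, so the pairings
    of the scaled slacks with \<open>x\<close> and the last slack \<xi> add up to a number that
    depends on the target only.\<close>
  then have sum_a: "(\<Sum>i\<in>UNIV. a i) + \<xi> = v0 - N v"
    unfolding ai sum_subtractf by (simp add: \<xi>_def nu_norm2_def inner_vec_def[of s])
  have "0 \<le> (\<Sum>i\<in>UNIV. a i)" using a by (intro sum_nonneg) (auto intro: less_imp_le)
  then show Nv: "N v < v0" using sum_a d(3) by linarith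
  \<comment> \<open>The mean of the ratios \<open>a i / nup P i\<close> with weights
    \<open>nup P i\<close> and of \<xi> with weight 1.\<close>
  define m where "m = (v0 - N v) / (nu P + 1)"
  have m: "0 < m" using Nv nu_nonneg by (simp add: m_def)
  have lnm: "ln r \<le> ln m + r / m - 1" if "0 < r" for r
    using ln_le_minus_one[of "r / m"] that m by (simp add: ln_div)
  have each: "- nup P i - nup P i * ln m - a i / m + nup P i \<le> Phi P i (x $ i) (s $ i) (v $ i)" for i
  proof -
    have n: "0 < nup P i" using nu_ge[of i] by linarith
    have "nup P i * ln (a i / nup P i) \<le> nup P i * (ln m + a i / nup P i / m - 1)"
      using lnm[of "a i / nup P i"] a[of i] n by (intro mult_left_mono) auto
    also have "\<dots> = nup P i * ln m + a i / m - nup P i" using n by (simp add: algebra_simps)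
    finally show ?thesis using blk.conj_lower[OF d(2,1)[of i]]
      unfolding Phi_def \<sigma>_def[symmetric] a_def[symmetric] by linarith
  qed
  have "(\<Sum>i\<in>UNIV. - nup P i - nup P i * ln m - a i / m + nup P i) \<le> (\<Sum>i\<in>UNIV. Phi P i (x $ i) (s $ i) (v $ i))"
    by (intro sum_mono each)
  also have "(\<Sum>i\<in>UNIV. - nup P i - nup P i * ln m - a i / m + nup P i) = - nu P * ln m - (\<Sum>i\<in>UNIV. a i) / m"
    by (simp add: nu_def sum_subtractf sum.distrib sum_negf sum_distrib_right sum_divide_distrib)
  finally have "- nu P * ln m - (\<Sum>i\<in>UNIV. a i) / m - (ln m + \<xi> / m - 1) \<le> Fhat_fin P (x, y, s) (v0, v)"
    using lnm[OF d(3)] by (simp add: Fhat_fin_def \<xi>_def)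
  moreover have "(\<Sum>i\<in>UNIV. a i) / m + \<xi> / m = nu P + 1"
  proof -
    have "(\<Sum>i\<in>UNIV. a i) / m + \<xi> / m = (v0 - N v) / m" by (simp add: add_divide_distrib[symmetric] sum_a)
    then show ?thesis using Nv by (simp add: m_def)
  qed
  moreover have "ell (v0, v) = - nu P * ln m - ln m - nu P" by (simp add: ell_def m_def algebra_simps)
  ultimately show "ell (v0, v) \<le> f ((x, y), (v0, v)) - const"
    using Fhat_fin_eq[OF x(1) D] by (simp add: s_def)
qed

subsubsection \<open>Weighted central points\<close>

text \<open>Half of the linear term absorbs the logarithm by which the barrier can decrease; the
  other half is kept to bound sublevel sets.\<close>

lemma block_coercive:
  assumes s: "s \<in> blk.Is i" and t: "0 < t"
  obtains L where "\<And>x. x \<in> blk.I i \<Longrightarrow> L + (s \<bullet> x) / 2 \<le> s \<bullet> x + t * Fb P i x"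
proof -
  obtain C where C: "\<And>x. x \<in> blk.I i \<Longrightarrow> C - nup P i * ln (s \<bullet> x) \<le> Fb P i x"
    using blk.F_lower_bound[OF s] by blast
  define k where "k = t * nup P i"
  have k: "0 < k" using t nu_ge[of i] by (simp add: k_def)
  have "(t * C + k - k * ln (2 * k)) + (s \<bullet> x) / 2 \<le> s \<bullet> x + t * Fb P i x" if x: "x \<in> blk.I i" for x
  proof -
    have p: "0 < s \<bullet> x" by (rule blk.inner_pos[OF s x])
    have "ln (s \<bullet> x / (2 * k)) \<le> s \<bullet> x / (2 * k) - 1" using p k by (intro ln_le_minus_one) simp
    then have "k * ln (s \<bullet> x) \<le> k * (s \<bullet> x / (2 * k) - 1 + ln (2 * k))"
      using p k by (intro mult_left_mono) (simp_all add: ln_div)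
    also have "\<dots> = (s \<bullet> x) / 2 - k + k * ln (2 * k)" using k by (simp add: field_simps)
    finally have "k * ln (s \<bullet> x) \<le> (s \<bullet> x) / 2 - k + k * ln (2 * k)" .
    moreover have "t * (C - nup P i * ln (s \<bullet> x)) \<le> t * Fb P i x" using C[OF x] t by (intro mult_left_mono) auto
    ultimately show ?thesis by (simp add: k_def algebra_simps)
  qed
  then show thesis using that by blast
qed

text \<open>The objective whose minimiser over the primal feasible set is a weighted central point;
  \<open>Fp\<close> instead of \<open>Fb\<close> makes it smooth on an open set.\<close>

definition barrier_sum :: "('a ^ 'n) \<Rightarrow> ('n \<Rightarrow> real) \<Rightarrow> ('a ^ 'n) \<Rightarrow> real" where
  "barrier_sum s t x = (\<Sum>i\<in>UNIV. s $ i \<bullet> x $ i + t i * blk.Fp i (x $ i))"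

text \<open>A sublevel set is compact: coercivity of the blocks bounds it, and
  \<open>closed_barrier\<close> shows that limits cannot leave the interior of the cone.\<close>

lemma barrier_sum_minimizer:
  assumes s: "\<And>i. s $ i \<in> blk.Is i" and t: "\<And>i. 0 < t i"
  obtains x where "x \<in> Fprimal P" "\<forall>x'\<in>Fprimal P. barrier_sum s t x \<le> barrier_sum s t x'"
proof -
  have Fp: "x \<in> Fprimal P \<longleftrightarrow> (\<forall>i. x $ i \<in> blk.I i) \<and> A x = b" for x
    by (simp add: Fprimal_def int_primal_iff)
  obtain x0 where x0: "x0 \<in> Fprimal P" using mp by (auto simp: multiconic_problem_def)
  let ?g = "barrier_sum s t"
  define S where "S = {x \<in> Fprimal P. ?g x \<le> ?g x0}"
  have "\<forall>i. \<exists>L. \<forall>x\<in>blk.I i. L + (s $ i \<bullet> x) / 2 \<le> s $ i \<bullet> x + t i * Fb P i x"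
    using block_coercive[OF s t] by metis
  then obtain L where L: "\<And>i x. x \<in> blk.I i \<Longrightarrow> L i + (s $ i \<bullet> x) / 2 \<le> s $ i \<bullet> x + t i * Fb P i x"
    by metis
  have pos: "0 < s $ i \<bullet> x" if "x \<in> blk.I i" for i x by (rule blk.inner_pos[OF s that])
  \<comment> \<open>Since the other blocks are bounded below by their \<open>L j\<close>, a bound on
    the sum bounds each block above.\<close>
  define M where "M i = ?g x0 - (\<Sum>j\<in>UNIV - {i}. L j)" for i
  have M: "s $ i \<bullet> x $ i + t i * Fb P i (x $ i) \<le> M i" if x: "x \<in> S" for x i
  proof -
    have xI: "x $ j \<in> blk.I j" for j using x Fp by (simp add: S_def)
    have "(\<Sum>j\<in>UNIV - {i}. L j) \<le> (\<Sum>j\<in>UNIV - {i}. s $ j \<bullet> x $ j + t j * Fb P j (x $ j))"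
    proof (rule sum_mono)
      fix j show "L j \<le> s $ j \<bullet> x $ j + t j * Fb P j (x $ j)" using L[OF xI[of j]] pos[OF xI[of j]] by linarith
    qed
    moreover have "?g x = (s $ i \<bullet> x $ i + t i * Fb P i (x $ i)) + (\<Sum>j\<in>UNIV - {i}. s $ j \<bullet> x $ j + t j * Fb P j (x $ j))"
      unfolding barrier_sum_def by (subst sum.remove[of UNIV i]) (simp_all add: blk.Fp_I[OF xI])
    ultimately show ?thesis using x by (simp add: S_def M_def)
  qed
  have "\<exists>R. \<forall>x\<in>S. norm (x $ i) \<le> R" for i
  proof -
    obtain e where e: "0 < e" "\<And>x. x \<in> Kc P i \<Longrightarrow> e * norm x \<le> s $ i \<bullet> x"
      using int_dual_cone_coercive[OF blk.subE s blk.K_props(1)] by blast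
    have "norm (x $ i) \<le> 2 * (M i - L i) / e" if x: "x \<in> S" for x
    proof -
      have xI: "x $ i \<in> blk.I i" using x Fp by (simp add: S_def)
      have "L i + (s $ i \<bullet> x $ i) / 2 \<le> M i" using order_trans[OF L[OF xI] M[OF x]] .
      then have "s $ i \<bullet> x $ i \<le> 2 * (M i - L i)" by (simp add: field_simps)
      then have "e * norm (x $ i) \<le> 2 * (M i - L i)" using e(2)[OF blk.I_sub(2)[OF xI]] by simp
      then show ?thesis using e(1) by (simp add: field_simps)
    qed
    then show ?thesis by blast
  qed
  then obtain R where R: "\<And>i x. x \<in> S \<Longrightarrow> norm (x $ i) \<le> R i" by metis
  have bS: "bounded S"
  proof (rule boundedI)
    fix x assume "x \<in> S"
    then have "(\<Sum>i\<in>UNIV. norm (x $ i)) \<le> (\<Sum>i\<in>UNIV. R i)" using R by (intro sum_mono) auto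
    then show "norm x \<le> (\<Sum>i\<in>UNIV. R i)"
      using L2_set_le_sum[of UNIV "\<lambda>i. norm (x $ i)"] by (simp add: norm_vec_def)
  qed
  have cg: "continuous_on {x. \<forall>i. x $ i \<in> blk.U i} ?g"
    unfolding barrier_sum_def
    by (intro continuous_intros continuous_on_compose2[OF smooth_on_continuous[OF blk.open_U blk.smooth4]]) auto
  have SU: "S \<subseteq> {x. \<forall>i. x $ i \<in> blk.U i}" using Fp blk.U_I by (auto simp: S_def)
  have cS: "closed S"
    unfolding closed_sequential_limits
  proof (intro allI impI)
    fix X l assume X: "(\<forall>n. X n \<in> S) \<and> X \<longlonglongrightarrow> l"
    have XI: "X n $ i \<in> blk.I i" "A (X n) = b" "?g (X n) \<le> ?g x0" for n i
      using X Fp by (auto simp: S_def)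
    have lI: "l $ i \<in> blk.I i" for i
    proof (rule blk.closed_barrier(1)[OF XI(1)])
      show "(\<lambda>n. X n $ i) \<longlonglongrightarrow> l $ i" using X tendsto_vec_nth by blast
      fix n
      have "t i * Fb P i (X n $ i) \<le> M i" using M[of "X n" i] X pos[OF XI(1)[of n i]] by fastforce
      then show "Fb P i (X n $ i) \<le> M i / t i" using t[of i] by (simp add: field_simps)
    qed
    have "(\<lambda>n. A (X n)) \<longlonglongrightarrow> A l"
      using bounded_linear.tendsto[of A X l sequentially] linear_A X by (simp add: linear_conv_bounded_linear)
    then have "(\<lambda>n. b) \<longlonglongrightarrow> A l" by (simp add: XI(2))
    then have "A l = b" using LIMSEQ_unique tendsto_const by metis
    moreover have "(\<lambda>n. ?g (X n)) \<longlonglongrightarrow> ?g l"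
    proof (rule continuous_on_tendsto_compose[OF cg])
      show "X \<longlonglongrightarrow> l" using X by simp
      show "l \<in> {x. \<forall>i. x $ i \<in> blk.U i}" using blk.U_I[OF lI] by simp
      show "\<forall>\<^sub>F n in sequentially. X n \<in> {x. \<forall>i. x $ i \<in> blk.U i}" using blk.U_I[OF XI(1)] by simp
    qed
    then have "?g l \<le> ?g x0" by (rule LIMSEQ_le_const2) (use XI(3) in blast)
    ultimately show "l \<in> S" using lI Fp by (simp add: S_def)
  qed
  have "compact S" using bS cS by (simp add: compact_eq_bounded_closed)
  moreover have x0S: "x0 \<in> S" using x0 by (simp add: S_def)
  ultimately obtain x where x: "x \<in> S" "\<And>x'. x' \<in> S \<Longrightarrow> ?g x \<le> ?g x'"
    using continuous_attains_inf[of S ?g] continuous_on_subset[OF cg SU] by blast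
  show thesis
  proof (rule that)
    show "x \<in> Fprimal P" using x(1) by (simp add: S_def)
    show "\<forall>x'\<in>Fprimal P. ?g x \<le> ?g x'"
    proof
      fix x' assume x': "x' \<in> Fprimal P"
      show "?g x \<le> ?g x'"
      proof (cases "?g x' \<le> ?g x0")
        case True then show ?thesis using x(2)[of x'] x' by (simp add: S_def)
      next
        case False then show ?thesis using x(2)[OF x0S] by simp
      qed
    qed
  qed
qed

lemma barrier_sum_stationary:
  assumes x: "x \<in> Fprimal P" and min: "\<forall>x'\<in>Fprimal P. barrier_sum s t x \<le> barrier_sum s t x'"
    and e: "e \<in> E" "A e = 0"
  shows "(\<chi> i. s $ i + t i *\<^sub>R grad (Esp P i) (Fb P i) (x $ i)) \<bullet> e = 0"
proof -
  have xI: "x $ i \<in> blk.I i" "A x = b" for i using x by (auto simp: Fprimal_def int_primal_iff)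
  have xE: "x $ i \<in> Esp P i" and eE: "e $ i \<in> Esp P i" for i using blk.I_sub(1)[OF xI(1)] e(1) by (auto simp: E_iff)
  define W where "W = (\<Inter>i. {r. x $ i + r *\<^sub>R e $ i \<in> blk.U i})"
  have "open {r. x $ i + r *\<^sub>R e $ i \<in> blk.U i}" for i
  proof -
    have "continuous_on UNIV (\<lambda>r. x $ i + r *\<^sub>R e $ i)" by (intro continuous_intros)
    then show ?thesis using open_vimage[OF blk.open_U] by (simp add: vimage_def)
  qed
  then have W: "open W" "0 \<in> W" using blk.U_I[OF xI(1)] by (auto simp: W_def intro!: open_INT)
  obtain d where d: "0 < d" "\<And>r. \<bar>0 - r\<bar> < d \<Longrightarrow> r \<in> W"
    using W unfolding open_dist by (metis dist_real_def abs_minus_commute)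
  have "((\<lambda>r. barrier_sum s t (x + r *\<^sub>R e)) has_real_derivative
     (\<Sum>i\<in>UNIV. s $ i \<bullet> e $ i + t i * DD (blk.Fp i) [e $ i] (x $ i))) (at 0)"
  proof -
    have "((\<lambda>r. DD (blk.Fp i) [] (x $ i + r *\<^sub>R e $ i)) has_real_derivative DD (blk.Fp i) [e $ i] (x $ i + 0 *\<^sub>R e $ i)) (at 0)" for i
      using blk.U_I[OF xI(1)] by (intro DD_line[OF blk.open_U blk.smooth4]) auto
    then have "((\<lambda>r. blk.Fp i (x $ i + r *\<^sub>R e $ i)) has_real_derivative DD (blk.Fp i) [e $ i] (x $ i)) (at 0)" for i
      by simp
    then show ?thesis unfolding barrier_sum_def
      by (auto intro!: derivative_eq_intros simp: inner_add_right mult.commute simp del: DD.simps)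
  qed
  then have "(\<Sum>i\<in>UNIV. s $ i \<bullet> e $ i + t i * DD (blk.Fp i) [e $ i] (x $ i)) = 0"
  proof (rule DERIV_local_min[OF _ d(1)], intro allI impI)
    fix r assume "\<bar>0 - r\<bar> < d"
    then have r: "x $ i + r *\<^sub>R e $ i \<in> blk.U i" for i using d(2) by (auto simp: W_def)
    have "x $ i + r *\<^sub>R e $ i \<in> blk.I i" for i
      by (rule blk.U_E[OF r]) (intro subspace_add subspace_scale blk.subE xE eE)
    then have "x + r *\<^sub>R e \<in> Fprimal P"
      using xI(2) e(2) linear_A by (simp add: Fprimal_def int_primal_iff linear_add linear_cmul)
    then show "barrier_sum s t (x + 0 *\<^sub>R e) \<le> barrier_sum s t (x + r *\<^sub>R e)" using min by simp
  qed
  then show ?thesis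
    using blk.grad_inner(2)[OF xI(1) eE] by (simp add: inner_vec_def inner_add_left del: DD.simps)
qed

text \<open>The weights \<open>(v $ i)\<^sup>2 + \<kappa>\<close> make every scaled slack equal to
  \<open>- \<kappa>\<close> times the gradient, and \<kappa> is chosen so that the last slack equals
  \<kappa> too. All ratios averaged in \<open>f_lower_bound\<close> then coincide, which is the
  equality case of Jensen's inequality.\<close>

lemma central_point:
  assumes Nv: "N v < v0"
  obtains x y where "x \<in> E" "A x = b" "((x, y), (v0, v)) \<in> Dom" "(x, y, c - As y) \<in> feasible P"
    "f ((x, y), (v0, v)) - const = ell (v0, v)"
proof -
  define \<kappa> where "\<kappa> = (v0 - N v) / (nu P + 1)"
  have \<kappa>: "0 < \<kappa>" using Nv nu_nonneg by (simp add: \<kappa>_def)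
  define t where "t i = (v $ i)\<^sup>2 + \<kappa>" for i
  have t: "0 < t i" for i using \<kappa> by (simp add: t_def add_nonneg_pos)
  obtain y0 s0 where ys: "(y0, s0) \<in> Fdual P" using mp by (auto simp: multiconic_problem_def)
  have s0: "s0 $ i \<in> blk.Is i" "s0 + As y0 = c" for i using ys by (auto simp: Fdual_def int_dual_iff)
  obtain x where x: "x \<in> Fprimal P" "\<forall>x'\<in>Fprimal P. barrier_sum s0 t x \<le> barrier_sum s0 t x'"
    by (rule barrier_sum_minimizer[where s=s0 and t=t, OF s0(1) t])
  have xI: "x $ i \<in> blk.I i" and Ax: "A x = b" for i using x(1) by (auto simp: Fprimal_def int_primal_iff)
  have xE: "x \<in> E" using blk.I_sub(1)[OF xI] by (simp add: E_iff)
  let ?G = "\<lambda>i. grad (Esp P i) (Fb P i) (x $ i)"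
  \<comment> \<open>Stationarity makes this residual orthogonal to the kernel of \<open>A\<close>,
    so it is \<open>As y'\<close>; correcting \<open>y0\<close> by \<open>y'\<close> turns
    \<open>s0\<close> into the slack wanted at the central point.\<close>
  define r where "r = (\<chi> i. s0 $ i + t i *\<^sub>R ?G i)"
  have "r \<in> E" unfolding E_iff r_def
    using blk.Is_sub(1)[OF s0(1)] blk.grad_inner(1)[OF xI] blk.subE by (simp add: subspace_add subspace_scale)
  moreover have "r \<bullet> e = 0" if "e \<in> E" "A e = 0" for e
    unfolding r_def by (rule barrier_sum_stationary[OF x that])
  ultimately obtain y' where y': "r = As y'" using range_As by blast
  define y where "y = y0 + y'"
  have "c - As y = s0 - r" using s0(2) y' linear_As by (simp add: y_def linear_add algebra_simps)
  then have s: "(c - As y) $ i = - t i *\<^sub>R ?G i" for i by (simp add: r_def)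
  have \<sigma>: "scaled_slack P i (x $ i) ((c - As y) $ i) (v $ i) = - \<kappa> *\<^sub>R ?G i" for i
    unfolding scaled_slack_def s by (simp add: t_def algebra_simps)
  have mG: "k *\<^sub>R - ?G i \<in> blk.Is i" if "0 < k" for k i by (rule blk.Is_scale[OF blk.neg_grad_Is[OF xI] that])
  have sIs: "(c - As y) $ i \<in> blk.Is i" for i using mG[OF t[of i]] by (simp only: s) simp
  have \<sigma>Is: "scaled_slack P i (x $ i) ((c - As y) $ i) (v $ i) \<in> blk.Is i" for i using mG[OF \<kappa>, of i] by (simp only: \<sigma>) simp
  have "(c - As y) \<bullet> x = (\<Sum>i\<in>UNIV. t i * nup P i)"
    unfolding inner_vec_def by (intro sum.cong refl) (simp only: s, simp add: blk.grad_self[OF xI])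
  also have "\<dots> = N v + \<kappa> * nu P"
    by (simp add: t_def nu_norm2_def nu_def sum.distrib sum_distrib_left algebra_simps)
  finally have sx: "c \<bullet> x - b \<bullet> y = N v + \<kappa> * nu P"
    using As_inner[OF xE, of y] Ax by (simp add: inner_diff_left inner_commute[of b])
  have "v0 - N v = \<kappa> * (nu P + 1)" using nu_nonneg by (simp add: \<kappa>_def)
  then have \<xi>: "v0 - c \<bullet> x + b \<bullet> y = \<kappa>" using sx by (simp add: algebra_simps)
  have D: "((x, y), (v0, v)) \<in> Dom" unfolding Dom_iff[OF xE] using xI \<sigma>Is \<xi> \<kappa> by simp
  have feas: "(x, y, c - As y) \<in> feasible P"
    using x(1) sIs by (simp add: feasible_def Fdual_def int_dual_iff)
  have "Phi P i (x $ i) ((c - As y) $ i) (v $ i) = - nup P i - nup P i * ln \<kappa>" for i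
    unfolding Phi_def \<sigma> using blk.conj_scaled_grad[OF xI \<kappa>, of i] by simp
  then have "Fhat_fin P (x, y, c - As y) (v0, v) = (\<Sum>i\<in>UNIV. - nup P i - nup P i * ln \<kappa>) - ln \<kappa>"
    by (simp add: Fhat_fin_def \<xi>)
  also have "\<dots> = - nu P - nu P * ln \<kappa> - ln \<kappa>"
    by (simp add: nu_def sum_subtractf sum_negf sum_distrib_right)
  also have "\<dots> = ell (v0, v)" by (simp add: ell_def \<kappa>_def algebra_simps)
  finally show thesis using that[OF xE Ax D feas] Fhat_fin_eq[OF xE D] by simp
qed

lemma feasibleD:
  assumes "(x, y, s) \<in> feasible P"
  shows "x \<in> E" "A x = b" "s = c - As y"
  using assms by (auto simp: feasible_def Fprimal_def Fdual_def int_in_subset int_in_iff algebra_simps)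

lemma phi_eq:
  assumes "N v < v0"
  shows "phi P (v0, v) = ereal (ell (v0, v))"
proof (rule antisym)
  obtain x y where *: "x \<in> E" "A x = b" "((x, y), (v0, v)) \<in> Dom" "(x, y, c - As y) \<in> feasible P"
    "f ((x, y), (v0, v)) - const = ell (v0, v)" by (rule central_point[OF assms])
  have "phi P (v0, v) \<le> Fhat P (x, y, c - As y) (v0, v)" unfolding phi_def by (rule INF_lower[OF *(4)])
  also have "\<dots> = ereal (ell (v0, v))"
    using dom_Fhat_iff[OF *(1)] Fhat_fin_eq[OF *(1,3)] * by (simp add: Fhat_def)
  finally show "phi P (v0, v) \<le> ereal (ell (v0, v))" .
  show "ereal (ell (v0, v)) \<le> phi P (v0, v)"
    unfolding phi_def
  proof (rule INF_greatest)
    fix u assume u: "u \<in> feasible P"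
    obtain x y s where e: "u = (x, y, s)" by (cases u)
    note fd = feasibleD[OF u[unfolded e]]
    show "ereal (ell (v0, v)) \<le> Fhat P u (v0, v)"
    proof (cases "(u, (v0, v)) \<in> dom_Fhat P")
      case True
      then have D: "((x, y), (v0, v)) \<in> Dom" using dom_Fhat_iff[OF fd(1)] fd(3) e by simp
      show ?thesis using True f_lower_bound(2)[OF fd(1,2) D] Fhat_fin_eq[OF fd(1) D] fd(3) e by (simp add: Fhat_def)
    qed (simp add: Fhat_def)
  qed
qed

lemma dom_phiD:
  assumes "(v0, v) \<in> dom_phi P"
  shows "N v < v0"
proof -
  have "(INF u\<in>feasible P. Fhat P u (v0, v)) < \<infinity>" using assms by (simp add: dom_phi_def phi_def)
  then obtain u where u: "u \<in> feasible P" "Fhat P u (v0, v) < \<infinity>" unfolding INF_less_iff by blast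
  obtain x y s where e: "u = (x, y, s)" by (cases u)
  note fd = feasibleD[OF u(1)[unfolded e]]
  have "(u, (v0, v)) \<in> dom_Fhat P" using u(2) by (auto simp: Fhat_def split: if_splits)
  then have "((x, y), (v0, v)) \<in> Dom" using dom_Fhat_iff[OF fd(1)] fd(3) e by simp
  then show ?thesis using f_lower_bound(1)[OF fd(1,2)] by blast
qed

lemma Prox_le_iff:
  assumes x: "x \<in> E" and Nv: "N v < v0"
  shows "Prox P (x, y, c - As y) (v0, v) \<le> ereal \<beta> \<longleftrightarrow>
    ((x, y), (v0, v)) \<in> Dom \<and> f ((x, y), (v0, v)) - const - ell (v0, v) \<le> \<beta>"
proof (cases "((x, y), (v0, v)) \<in> Dom")
  case True
  then show ?thesis using dom_Fhat_iff[OF x] Fhat_fin_eq[OF x True] by (simp add: Prox_def phi_eq[OF Nv] Fhat_def)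
next
  case False
  then show ?thesis using dom_Fhat_iff[OF x] by (simp add: Prox_def phi_eq[OF Nv] Fhat_def)
qed

subsubsection \<open>The predictor direction\<close>

text \<open>\<open>Ftilde\<close> is built from notions relative to the subspaces and agrees with
  the smooth \<open>f\<close> only on them; \<open>f\<close> is constant across them, so it is
  \<open>Ftilde\<close> composed with this projection, plus \<open>const\<close>.\<close>

definition PrE :: "('a, 'n, 'm) pdtarget \<Rightarrow> ('a, 'n, 'm) pdtarget" where
  "PrE = (\<lambda>((x, y), w). ((\<chi> i. blk.p i (x $ i), y), w))"

lemma linear_PrE: "linear PrE"
proof (rule linearI)
  fix z z' :: "('a, 'n, 'm) pdtarget" and t :: real
  show "PrE (z + z') = PrE z + PrE z'"
    by (cases z; cases "fst z"; cases z'; cases "fst z'") (simp add: PrE_def vec_eq_iff linear_add[OF blk.linp])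
  show "PrE (t *\<^sub>R z) = t *\<^sub>R PrE z"
    by (cases z; cases "fst z") (simp add: PrE_def vec_eq_iff linear_cmul[OF blk.linp])
qed

lemma PrE_id: "x \<in> E \<Longrightarrow> PrE ((x, y), w) = ((x, y), w)"
  by (simp add: PrE_def E_iff vec_eq_iff)

lemma PrE_f:
  assumes "z \<in> Dom"
  shows "Ftilde P (PrE z) = f z - const"
proof -
  obtain x y v0 v where z: "z = ((x, y), (v0, v))" by (metis surj_pair)
  define x' where "x' = (\<chi> i. blk.p i (x $ i))"
  have x': "x' \<in> E" by (simp add: E_iff x'_def)
  have L: "off i + Lm i ((x', y), (v0, v)) = blk.pr i (off i + Lm i z)" for i
    using dual_E[of y] unfolding z off_Lm by (simp add: blk.pr_def x'_def E_iff)
  have "c \<bullet> x' = c \<bullet> x"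
    unfolding inner_vec_def x'_def using cE by (auto simp: E_iff inner_commute[of "c $ _"] blk.p_inner intro!: sum.cong)
  then have X: "xi ((x', y), (v0, v)) = xi z" by (simp add: xi_def z)
  have D: "((x', y), (v0, v)) \<in> Dom"
    using assms unfolding Dom_def Int_iff INT_iff mem_Collect_eq L blk.Dpsi_pr X .
  have "f ((x', y), (v0, v)) = f z" by (simp only: f_def L blk.Psi_pr X)
  then show ?thesis using Fhat_fin_eq[OF x' D] by (simp add: Ftilde_def PrE_def z x'_def)
qed

text \<open>At fixed points and in fixed directions of \<open>PrE\<close>, composing with
  \<open>PrE\<close> changes no derivative by \<open>DD_affine\<close>, and the composition is
  \<open>f\<close> up to a constant.\<close>

lemma DD_Ftilde:
  assumes z: "z \<in> Dom" "PrE z = z" and hs: "map PrE hs = hs" "hs \<noteq> []" "length hs \<le> 3"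
  shows "DD (Ftilde P) hs z = DD f hs z"
proof -
  have "DD (Ftilde P) hs z = DD (\<lambda>z. Ftilde P (0 + PrE z)) hs z"
    unfolding DD_affine[OF linear_PrE] by (simp add: z hs)
  also have "\<dots> = DD (\<lambda>z. f z + - const) hs z"
    by (rule DD_cong[OF sc_open[OF sc_f] _ z(1)]) (simp add: PrE_f)
  also have "\<dots> = DD f hs z + DD (\<lambda>z. - const) hs z"
    by (rule DD_add[OF sc_open[OF sc_f] sc_smooth_le[OF sc_f hs(3)] smooth_on_const[OF sc_open[OF sc_f]] z(1)])
  also have "DD (\<lambda>z. - const) hs z = 0" using hs(2) DD_const by (metis list.exhaust)
  finally show ?thesis by simp
qed

text \<open>The defining equation is paired with \<open>(px, py)\<close>; the multiplier drops out
  because \<open>As l \<bullet> px = l \<bullet> A px = 0\<close>. This is the optimality condition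
  of a quadratic minimisation over tangent directions.\<close>

lemma predictor_orthogonal:
  assumes D: "((x, y), w) \<in> Dom" and x: "x \<in> E"
    and pd: "predictor_direction P (x, y, s) w dw (dx, dy, ds)"
    and p: "px \<in> E" "A px = 0"
  shows "DD f [((px, py), 0), ((dx, dy), dw)] ((x, y), w) = 0"
proof -
  let ?z = "((x, y), w)"
  have dx: "dx \<in> E" using pd by (simp add: predictor_direction_def)
  obtain l where l: "hess_uu P (x, y) w (dx, dy) + hess_uw P (x, y) w dw + (As l, 0) = 0"
    using pd by (auto simp: predictor_direction_def)
  have sub: "subspace (E \<times> (UNIV :: (real ^ 'm) set))" by (rule subspace_Times[OF subspace_E subspace_UNIV])
  note sm = sc_smooth_le[OF sc_f, of 2, simplified] 
  note lin = DD2_linear[OF sc_open[OF sc_f] sm D]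
  have lin0: "linear (\<lambda>p :: ('a ^ 'n) \<times> (real ^ 'm). (p, 0 :: 'n target))"
    by (rule linearI) simp_all
  have linp: "linear (\<lambda>p. DD f [(p, 0), k] ?z)" for k
    using linear_compose[OF lin0 lin(1)[of k]] unfolding comp_def .
  have uu: "hess_uu P (x, y) w (dx, dy) \<bullet> (px, py) = DD f [((px, py), 0), ((dx, dy), 0)] ?z"
  proof -
    have e: "DD (Ftilde P) [(q, 0), ((dx, dy), 0)] ?z = DD f [(q, 0), ((dx, dy), 0)] ?z" if "q \<in> E \<times> UNIV" for q
      using that dx x by (intro DD_Ftilde[OF D]) (auto simp: PrE_id)
    show ?thesis unfolding hess_uu_def using riesz_linear(2)[OF sub linp e, of "(px, py)"] e[of "(px, py)"] p by simp
  qed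
  have uw: "hess_uw P (x, y) w dw \<bullet> (px, py) = DD f [((px, py), 0), (0, dw)] ?z"
  proof -
    have e: "DD (Ftilde P) [(q, 0), (0, dw)] ?z = DD f [(q, 0), (0, dw)] ?z" if "q \<in> E \<times> UNIV" for q
      using that x subspace_0[OF subspace_E] by (intro DD_Ftilde[OF D]) (auto simp: PrE_id zero_prod_def)
    show ?thesis unfolding hess_uw_def using riesz_linear(2)[OF sub linp e, of "(px, py)"] e[of "(px, py)"] p by simp
  qed
  have "DD f [((px, py), 0), ((dx, dy), dw)] ?z = DD f [((px, py), 0), ((dx, dy), 0) + (0, dw)] ?z" by simp
  also have "\<dots> = hess_uu P (x, y) w (dx, dy) \<bullet> (px, py) + hess_uw P (x, y) w dw \<bullet> (px, py)"
    unfolding uu uw by (rule linear_add[OF lin(2)])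
  also have "\<dots> = (hess_uu P (x, y) w (dx, dy) + hess_uw P (x, y) w dw + (As l, 0)) \<bullet> (px, py)"
    using As_inner[OF p(1), of l] p(2) by (simp add: inner_add_left)
  finally show ?thesis unfolding l by simp
qed

end

subsection \<open>The greedy predictor step\<close>

text \<open>Sharp to second order at 0, as the limit below requires.\<close>

lemma omega_quadratic_lower:
  assumes "0 \<le> (t::real)"
  shows "t\<^sup>2 / (2 * (1 + t)) \<le> omega t"
proof -
  have "omega 0 - 0\<^sup>2 / (2 * (1 + 0)) \<le> omega t - t\<^sup>2 / (2 * (1 + t))"
  proof (rule DERIV_nonneg_imp_le[OF assms])
    fix s :: real assume s: "0 \<le> s"
    show "((\<lambda>s. omega s - s\<^sup>2 / (2 * (1 + s))) has_real_derivative s / (1 + s) - (2 * s * (2 * (1 + s)) - s\<^sup>2 * 2) / (2 * (1 + s))\<^sup>2) (at s)"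
      using s by (auto intro!: derivative_eq_intros DERIV_omega simp: power2_eq_square)
    have "s / (1 + s) - (2 * s * (2 * (1 + s)) - s\<^sup>2 * 2) / (2 * (1 + s))\<^sup>2 = s\<^sup>2 / (2 * (1 + s)\<^sup>2)"
      using s by (simp add: divide_simps power2_eq_square) (simp add: algebra_simps)
    then show "0 \<le> s / (1 + s) - (2 * s * (2 * (1 + s)) - s\<^sup>2 * 2) / (2 * (1 + s))\<^sup>2" by simp
  qed
  then show ?thesis by simp
qed

text \<open>Both sides of the inequality are of second order in \<open>a\<close>; dividing by
  \<open>a\<^sup>2\<close> and letting \<open>a\<close> tend to 0 compares their
  coefficients.\<close>

lemma omega_below_imp_curvature:
  fixes psi :: "real \<Rightarrow> real"
  assumes rho: "0 \<le> \<rho>"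
    and le: "\<And>a. 0 < a \<Longrightarrow> a < r \<Longrightarrow> omega (a * \<rho>) \<le> psi a"
    and r: "0 < r" and lim: "((\<lambda>a. psi a / a\<^sup>2) \<longlongrightarrow> M / 2) (at_right 0)"
  shows "\<rho>\<^sup>2 \<le> M"
proof -
  have "((\<lambda>a. \<rho>\<^sup>2 / (2 * (1 + a * \<rho>))) \<longlongrightarrow> \<rho>\<^sup>2 / (2 * (1 + 0 * \<rho>))) (at_right 0)"
    by (intro tendsto_intros) auto
  moreover have "\<forall>\<^sub>F a in at_right 0. \<rho>\<^sup>2 / (2 * (1 + a * \<rho>)) \<le> psi a / a\<^sup>2"
  proof (rule eventually_at_rightI[of 0 r])
    fix a assume a: "a \<in> {0<..<r}"
    have "(a * \<rho>)\<^sup>2 / (2 * (1 + a * \<rho>)) \<le> psi a"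
      using omega_quadratic_lower[of "a * \<rho>"] le[of a] a rho by simp
    then have "((a * \<rho>)\<^sup>2 / (2 * (1 + a * \<rho>))) / a\<^sup>2 \<le> psi a / a\<^sup>2" by (rule divide_right_mono) simp
    moreover have "((a * \<rho>)\<^sup>2 / (2 * (1 + a * \<rho>))) / a\<^sup>2 = \<rho>\<^sup>2 / (2 * (1 + a * \<rho>))"
      using a by (simp add: power_mult_distrib)
    ultimately show "\<rho>\<^sup>2 / (2 * (1 + a * \<rho>)) \<le> psi a / a\<^sup>2" by simp
  qed (rule r)
  ultimately have "\<rho>\<^sup>2 / (2 * (1 + 0 * \<rho>)) \<le> M / 2"
    by (rule tendsto_le[OF trivial_limit_at_right_real lim])
  then show ?thesis by simp
qed

context multiconic
begin

section \<open>The value function along the ray through the target\<close>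

definition ell_deriv :: "real \<Rightarrow> real ^ 'n \<Rightarrow> real" where
  "ell_deriv v0 v = (nu P + 1) * (v0 - 2 * N v) / (v0 - N v)"

lemma N_scale: "N (t *\<^sub>R v) = t\<^sup>2 * N v"
  by (simp add: nu_norm2_def power_mult_distrib sum_distrib_left algebra_simps)

lemma N_scale_less:
  assumes "N v < v0" "0 < t" "t \<le> 1"
  shows "N (t *\<^sub>R v) < t * v0"
proof -
  have "t * N v \<le> N v" using mult_left_le_one_le[OF N_nonneg] assms by simp
  then have "t * (t * N v) < t * v0" using assms by simp
  then show ?thesis by (simp add: N_scale power2_eq_square mult.assoc)
qed

lemma ell_line:
  assumes Nv: "N v < v0" and a: "a < 1" "v0 * (1 - a) > N ((1 - a) *\<^sub>R v)"
  shows "((\<lambda>a. ell ((1 - a) * v0, (1 - a) *\<^sub>R v)) has_real_derivative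
    (nu P + 1) * (v0 - 2 * (1 - a) * N v) / ((1 - a) * v0 - (1 - a)\<^sup>2 * N v)) (at a)"
proof -
  define k where "k = nu P + 1"
  have k: "0 < k" using nu_nonneg by (simp add: k_def)
  have p: "0 < (1 - a) * v0 - (1 - a)\<^sup>2 * N v" using a by (simp add: N_scale mult.commute)
  define R where "R a = (1 - a) * v0 - (1 - a)\<^sup>2 * N v" for a
  have R: "0 < R a" "0 < R a / k" using k p by (simp_all add: R_def)
  have dR: "(R has_real_derivative - v0 + 2 * (1 - a) * N v) (at a)"
    unfolding R_def by (auto intro!: derivative_eq_intros simp: algebra_simps)
  have "((\<lambda>a. - k * ln (R a / k) - (k - 1)) has_real_derivative
     - k * ((- v0 + 2 * (1 - a) * N v) / k / (R a / k))) (at a)"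
    using R by (auto intro!: derivative_eq_intros dR simp: divide_inverse)
  also have "- k * ((- v0 + 2 * (1 - a) * N v) / k / (R a / k)) = k * (v0 - 2 * (1 - a) * N v) / R a"
    using k R by (simp add: field_simps)
  finally show ?thesis by (simp add: ell_def N_scale k_def R_def)
qed

definition ell_rem :: "real \<Rightarrow> real ^ 'n \<Rightarrow> real \<Rightarrow> real" where
  "ell_rem v0 v a = ell ((1 - a) * v0, (1 - a) *\<^sub>R v) - ell (v0, v) - a * ell_deriv v0 v"

text \<open>The limit is half of the second derivative of \<open>ell\<close> at \<open>w\<close>
  along \<open>w\<close>. One application of L'Hopital's rule reduces it to a difference quotient of
  the first derivative.\<close>

lemma ell_rem_limit:
  assumes Nv: "N v < v0"
  shows "((\<lambda>a. ell_rem v0 v a / a\<^sup>2) \<longlongrightarrow>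
    ((nu P + 1) * (v0\<^sup>2 - 2 * v0 * N v + 2 * (N v)\<^sup>2) / (v0 - N v)\<^sup>2) / 2) (at_right 0)"
proof -
  define k where "k = nu P + 1"
  define n where "n = N v"
  have k: "0 < k" using nu_nonneg by (simp add: k_def)
  have n: "0 \<le> n" "n < v0" using N_nonneg Nv by (simp_all add: n_def)
  define g1 where "g1 a = k * (v0 - 2 * (1 - a) * n) / ((1 - a) * v0 - (1 - a)\<^sup>2 * n)" for a
  have pos: "0 < (1 - a) * v0 - (1 - a)\<^sup>2 * n" if "0 \<le> a" "a < 1" for a
    using N_scale_less[OF Nv, of "1 - a"] that by (simp add: N_scale n_def)
  have d: "(ell_rem v0 v has_real_derivative g1 a - ell_deriv v0 v) (at a)" if "0 \<le> a" "a < 1" for a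
  proof -
    have "((\<lambda>a. ell ((1 - a) * v0, (1 - a) *\<^sub>R v)) has_real_derivative g1 a) (at a)"
      unfolding g1_def k_def n_def
      by (rule ell_line[OF Nv that(2)]) (use pos[OF that] in \<open>simp add: N_scale n_def mult.commute\<close>)
    then show ?thesis unfolding ell_rem_def by (auto intro!: derivative_eq_intros)
  qed
  have g10: "g1 0 = ell_deriv v0 v" by (simp add: g1_def ell_deriv_def k_def n_def)
  define M where "M = k * (v0\<^sup>2 - 2 * v0 * n + 2 * n\<^sup>2) / (v0 - n)\<^sup>2"
  have "(g1 has_real_derivative M) (at 0)"
    unfolding g1_def M_def using n
    by (auto intro!: derivative_eq_intros simp: divide_simps power2_eq_square) (simp add: algebra_simps)
  then have "((\<lambda>a. (g1 a - g1 0) / a) \<longlongrightarrow> M) (at 0)" by (simp add: DERIV_def)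
  then have lim1: "((\<lambda>a. (g1 a - ell_deriv v0 v) / (2 * a)) \<longlongrightarrow> M / 2) (at_right 0)"
    unfolding g10 using tendsto_divide[OF _ tendsto_const, of "\<lambda>a. (g1 a - ell_deriv v0 v) / a" M "at_right 0" 2]
    by (simp add: filterlim_at_split mult.commute)
  have "((\<lambda>a. ell_rem v0 v a / a\<^sup>2) \<longlongrightarrow> M / 2) (at_right 0)"
  proof (rule lhopital_right_0[OF _ _ _ _ _ _ lim1])
    have "isCont (ell_rem v0 v) 0" using d[of 0] DERIV_isCont by simp
    moreover have "ell_rem v0 v 0 = 0" by (simp add: ell_rem_def)
    ultimately show "(ell_rem v0 v \<longlongrightarrow> 0) (at_right 0)"
      unfolding isCont_def by (metis filterlim_at_split)
    show "((\<lambda>a::real. a\<^sup>2) \<longlongrightarrow> 0) (at_right 0)"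
      by (rule tendsto_eq_intros | simp)+
    show "\<forall>\<^sub>F a in at_right 0. (a::real)\<^sup>2 \<noteq> 0" by (auto simp: eventually_at_right_field intro!: exI[of _ 1])
    show "\<forall>\<^sub>F a in at_right 0. 2 * a \<noteq> (0::real)" by (auto simp: eventually_at_right_field intro!: exI[of _ 1])
    show "\<forall>\<^sub>F a in at_right 0. (ell_rem v0 v has_real_derivative g1 a - ell_deriv v0 v) (at a)"
      using d by (auto simp: eventually_at_right_field intro!: exI[of _ 1])
    show "\<forall>\<^sub>F a in at_right 0. ((\<lambda>a. a\<^sup>2) has_real_derivative 2 * a) (at (a::real))"
      by (auto intro!: always_eventually derivative_eq_intros)
  qed
  then show ?thesis by (simp add: M_def k_def n_def)
qed

text \<open>By \<open>f_lower_bound\<close>, the difference of \<open>f\<close> and \<open>ell\<close> is minimal at a central point.\<close>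

lemma central_derivative:
  assumes x: "x \<in> E" "A x = b" and D: "((x, y), (v0, v)) \<in> Dom"
    and eq: "f ((x, y), (v0, v)) - const = ell (v0, v)" and e: "ex \<in> E" "A ex = 0"
    and dl: "((\<lambda>a. ell (v0 + a * dv0, v + a *\<^sub>R dv)) has_real_derivative g) (at 0)"
  shows "DD f [((ex, ey), (dv0, dv))] ((x, y), (v0, v)) = g"
proof -
  let ?z = "((x, y), (v0, v))" and ?h = "((ex, ey), (dv0, dv))"
  have "((\<lambda>a. DD f [] (?z + a *\<^sub>R ?h)) has_real_derivative DD f [?h] (?z + 0 *\<^sub>R ?h)) (at 0)"
    using D by (intro sc_line[OF sc_f]) (auto simp: zero_prod_def[symmetric])
  then have df: "((\<lambda>a. f (?z + a *\<^sub>R ?h)) has_real_derivative DD f [?h] ?z) (at 0)"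
    by (simp add: zero_prod_def[symmetric] del: scaleR_Pair add_Pair)
  have "continuous_on UNIV (\<lambda>a. ?z + a *\<^sub>R ?h)" by (intro continuous_intros)
  then have "open {a. ?z + a *\<^sub>R ?h \<in> Dom}"
    using open_vimage[OF sc_open[OF sc_f]] by (simp add: vimage_def del: scaleR_Pair add_Pair)
  moreover have "0 \<in> {a. ?z + a *\<^sub>R ?h \<in> Dom}" using D by (simp add: zero_prod_def[symmetric])
  ultimately obtain d where d: "0 < d" "\<And>a. \<bar>0 - a\<bar> < d \<Longrightarrow> ?z + a *\<^sub>R ?h \<in> Dom"
    unfolding open_dist by (metis (no_types, lifting) mem_Collect_eq dist_real_def abs_minus_commute)
  have "((\<lambda>a. f (?z + a *\<^sub>R ?h) - ell (v0 + a * dv0, v + a *\<^sub>R dv)) has_real_derivative DD f [?h] ?z - g) (at 0)"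
    by (rule DERIV_diff[OF df dl])
  then have "DD f [?h] ?z - g = 0"
  proof (rule DERIV_local_min[OF _ d(1)], intro allI impI)
    fix a assume a: "\<bar>0 - a\<bar> < d"
    have D': "((x + a *\<^sub>R ex, y + a *\<^sub>R ey), (v0 + a * dv0, v + a *\<^sub>R dv)) \<in> Dom" using d(2)[OF a] by simp
    have "x + a *\<^sub>R ex \<in> E" "A (x + a *\<^sub>R ex) = b"
      using x e linear_A subspace_E by (simp_all add: subspace_add subspace_scale linear_add linear_cmul)
    from f_lower_bound(2)[OF this D'] eq
    show "f (?z + 0 *\<^sub>R ?h) - ell (v0 + 0 * dv0, v + 0 *\<^sub>R dv) \<le> f (?z + a *\<^sub>R ?h) - ell (v0 + a * dv0, v + a *\<^sub>R dv)"
      by simp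
  qed
  then show ?thesis by simp
qed

text \<open>
  Among the tangent directions with \<open>w\<close>-component \<open>- w\<close> the predictor direction has the smallest norm at
  \<open>u\<close>.  The competitors are the chords from the central point of \<open>w\<close> to those of \<open>(1 - a) w\<close>: by the lower
  bound of self-concordance their norms are controlled by the Taylor remainder of \<open>ell\<close>, and \<open>a \<rightarrow> 0\<close>
  gives its second derivative.
\<close>

lemma predictor_norm_bound:
  assumes Nv: "N v < v0"
    and zs: "xs \<in> E" "A xs = b" "((xs, ys), (v0, v)) \<in> Dom" "f ((xs, ys), (v0, v)) - const = ell (v0, v)"
    and z: "x \<in> E" "A x = b" "((x, y), (v0, v)) \<in> Dom"
    and near: "lnorm f ((xs, ys), (v0, v)) (((x, y), (v0, v)) - ((xs, ys), (v0, v))) \<le> \<delta>" "\<delta> < 1"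
    and pd: "predictor_direction P (x, y, s) (v0, v) (- v0, - v) (dx, dy, ds)"
  shows "((1 - \<delta>) * lnorm f ((x, y), (v0, v)) ((dx, dy), (- v0, - v)))\<^sup>2
    \<le> (nu P + 1) * (v0\<^sup>2 - 2 * v0 * N v + 2 * (N v)\<^sup>2) / (v0 - N v)\<^sup>2"
proof -
  let ?zs = "((xs, ys), (v0, v))" and ?z = "((x, y), (v0, v))" and ?d = "((dx, dy), (- v0, - v))"
  have dx: "dx \<in> E" "A dx = 0" using pd by (simp_all add: predictor_direction_def)
  define e where "e = ?z - ?zs"
  have ze: "?zs + e = ?z" by (simp add: e_def)
  have e0: "0 \<le> lnorm f ?zs e" "lnorm f ?zs e \<le> \<delta>" "lnorm f ?zs e < 1"
    using near lnorm_nonneg[OF sc_f zs(3)] by (auto simp: e_def simp del: diff_Pair)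
  have N0: "0 \<le> lnorm f ?z ?d" by (rule lnorm_nonneg[OF sc_f z(3)])
  show ?thesis
  proof (rule omega_below_imp_curvature[OF _ _ zero_less_one ell_rem_limit[OF Nv]])
    show "0 \<le> (1 - \<delta>) * lnorm f ?z ?d" using N0 near(2) by simp
    fix a :: real assume a: "0 < a" "a < 1"
    have Na: "N ((1 - a) *\<^sub>R v) < (1 - a) * v0" by (rule N_scale_less[OF Nv]) (use a in auto)
    obtain xa ya where za: "xa \<in> E" "A xa = b" "((xa, ya), ((1 - a) * v0, (1 - a) *\<^sub>R v)) \<in> Dom"
      "f ((xa, ya), ((1 - a) * v0, (1 - a) *\<^sub>R v)) - const = ell ((1 - a) * v0, (1 - a) *\<^sub>R v)"
      by (rule central_point[OF Na])
    let ?za = "((xa, ya), ((1 - a) * v0, (1 - a) *\<^sub>R v))"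
    \<comment> \<open>A difference quotient of central points, with \<open>w\<close>-component
      exactly \<open>(- v0, - v)\<close>; its convergence for small \<open>a\<close> is never asked
      for.\<close>
    define da where "da = ((inverse a *\<^sub>R (xa - xs), inverse a *\<^sub>R (ya - ys)), (- v0, - v))"
    have zda: "?zs + a *\<^sub>R da = ?za" using a by (simp add: da_def algebra_simps)
    have da: "inverse a *\<^sub>R (xa - xs) \<in> E" "A (inverse a *\<^sub>R (xa - xs)) = 0"
      using za(1,2) zs(1,2) linear_A subspace_E by (simp_all add: subspace_diff subspace_scale linear_cmul linear_diff)
    have "DD f [da] ?zs = ell_deriv v0 v"
      unfolding da_def
    proof (rule central_derivative[OF zs da])
      have "((\<lambda>a. ell ((1 - a) * v0, (1 - a) *\<^sub>R v)) has_real_derivative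
          (nu P + 1) * (v0 - 2 * (1 - 0) * N v) / ((1 - 0) * v0 - (1 - 0)\<^sup>2 * N v)) (at 0)"
        by (rule ell_line[OF Nv]) (use Nv in simp_all)
      then show "((\<lambda>a. ell (v0 + a * - v0, v + a *\<^sub>R - v)) has_real_derivative ell_deriv v0 v) (at 0)"
        by (simp add: ell_deriv_def algebra_simps)
    qed
    then have "DD f [a *\<^sub>R da] ?zs = a * ell_deriv v0 v"
      using linear_cmul[OF DD1_linear[OF sc_open[OF sc_f] sc_smooth_le[OF sc_f] zs(3)], of a da] by simp
    then have "f ?zs + a * ell_deriv v0 v + omega (lnorm f ?zs (a *\<^sub>R da)) \<le> f ?za"
      using sc_lower_bound[OF sc_f zs(3), of "a *\<^sub>R da"] za(3) unfolding zda by simp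
    then have rem: "omega (lnorm f ?zs (a *\<^sub>R da)) \<le> ell_rem v0 v a"
      using za(4) zs(4) by (simp add: ell_rem_def)
    have "(1 - lnorm f ?zs e) * lnorm f ?z ?d \<le> (1 - lnorm f ?zs e) * lnorm f ?z da"
    proof (rule mult_left_mono)
      define px where "px = inverse a *\<^sub>R (xa - xs) - dx"
      define py where "py = inverse a *\<^sub>R (ya - ys) - dy"
      \<comment> \<open>Pythagoras: chord and predictor direction have the same
        \<open>w\<close>-component, so they differ by a tangent direction, which is orthogonal to
        the predictor direction at \<open>u\<close>.\<close>
      have da_eq: "da = ((px, py), 0) + ?d" by (simp add: da_def px_def py_def zero_prod_def)
      have px: "px \<in> E" "A px = 0" using da dx linear_A subspace_E by (simp_all add: px_def subspace_diff linear_diff)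
      have o: "DD f [((px, py), 0), ?d] ?z = 0" by (rule predictor_orthogonal[OF z(3,1) pd px])
      have "DD f [da, da] ?z = DD f [1 *\<^sub>R ((px, py), 0) + 1 *\<^sub>R ?d, 1 *\<^sub>R ((px, py), 0) + 1 *\<^sub>R ?d] ?z"
        unfolding da_eq by simp
      also have "\<dots> = DD f [((px, py), 0), ((px, py), 0)] ?z + DD f [?d, ?d] ?z"
        unfolding DD2_expand[OF sc_open[OF sc_f] sc_smooth_le[OF sc_f, of 2, simplified] z(3)] o by simp
      finally have "DD f [?d, ?d] ?z \<le> DD f [da, da] ?z"
        using sc_D2_nonneg[OF sc_f z(3), of "((px, py), 0)"] by linarith
      then show "lnorm f ?z ?d \<le> lnorm f ?z da" unfolding lnorm_def by (rule real_sqrt_le_mono)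
      show "0 \<le> 1 - lnorm f ?zs e" using e0 by simp
    qed
    also have "\<dots> \<le> lnorm f ?zs da"
      using sc_lnorm_compare(1)[OF sc_f zs(3) e0(3), of da] unfolding ze .
    finally have "(1 - lnorm f ?zs e) * lnorm f ?z ?d \<le> lnorm f ?zs da" .
    moreover have "(1 - \<delta>) * lnorm f ?z ?d \<le> (1 - lnorm f ?zs e) * lnorm f ?z ?d"
      using e0 N0 by (intro mult_right_mono) auto
    ultimately have "a * ((1 - \<delta>) * lnorm f ?z ?d) \<le> a * lnorm f ?zs da" using a by (intro mult_left_mono) auto
    also have "\<dots> = lnorm f ?zs (a *\<^sub>R da)" using lnorm_scale[OF sc_f zs(3), of a da] a by simp
    finally have "omega (a * ((1 - \<delta>) * lnorm f ?z ?d)) \<le> omega (lnorm f ?zs (a *\<^sub>R da))"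
      using a N0 near(2) lnorm_nonneg[OF sc_f zs(3)] by (subst omega_le_iff) auto
    then show "omega (a * ((1 - \<delta>) * lnorm f ?z ?d)) \<le> ell_rem v0 v a" using rem by simp
  qed
qed

text \<open>Convexity of \<open>ell\<close> on the ray, read off from
  \<open>ln r \<le> r - 1\<close> for the ratio \<open>r = Q / D\<close>, since \<open>Q\<close>
  lies below its tangent in \<open>a\<close>.\<close>

lemma ell_rem_nonneg:
  assumes Nv: "N v < v0" and a: "0 \<le> a" "a < 1"
  shows "0 \<le> ell_rem v0 v a"
proof -
  define k where "k = nu P + 1"
  have k: "0 < k" using nu_nonneg by (simp add: k_def)
  define D where "D = v0 - N v"
  have D: "0 < D" using Nv by (simp add: D_def)
  define Q where "Q = (1 - a) * v0 - (1 - a)\<^sup>2 * N v"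
  have Q: "0 < Q" using N_scale_less[OF Nv, of "1 - a"] a by (simp add: Q_def N_scale)
  have QD: "Q = D - a * (v0 - 2 * N v) - a\<^sup>2 * N v" by (simp add: Q_def D_def power2_eq_square algebra_simps)
  have "ln (Q / D) \<le> Q / D - 1" using Q D by (intro ln_le_minus_one) simp
  also have "\<dots> \<le> - a * (v0 - 2 * N v) / D"
    using D N_nonneg[of v] by (simp add: QD diff_divide_distrib)
  finally have "k * ln (Q / D) \<le> k * (- a * (v0 - 2 * N v) / D)" using k by (intro mult_left_mono) auto
  moreover have "ell_rem v0 v a = - k * ln (Q / D) - a * (k * (v0 - 2 * N v) / D)"
  proof -
    have "ell ((1 - a) * v0, (1 - a) *\<^sub>R v) = - k * ln (Q / k) - nu P"
      by (simp only: ell_def prod.case N_scale Q_def k_def)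
    moreover have "ell (v0, v) = - k * ln (D / k) - nu P" by (simp only: ell_def prod.case D_def k_def)
    moreover have "ell_deriv v0 v = k * (v0 - 2 * N v) / D" by (simp only: ell_deriv_def k_def D_def)
    ultimately show ?thesis using Q D k by (simp add: ell_rem_def ln_div algebra_simps)
  qed
  ultimately show ?thesis by (simp add: mult.left_commute)
qed

lemma predictor_step_admissible:
  assumes b1: "0 < \<beta>1" "\<beta>1 < 1 - ln 2" and b2: "omega_star (omega_inv \<beta>1) < \<beta>2"
    and Nv: "N v < v0" and u: "(x, y, s) \<in> feasible P"
    and prox: "Prox P (x, y, s) (v0, v) \<le> ereal \<beta>1"
    and pd: "predictor_direction P (x, y, s) (v0, v) (- v0, - v) (dx, dy, ds)"
    and a: "0 \<le> a" "a < 1"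
    and small: "a * sqrt ((nu P + 1) * (v0\<^sup>2 - 2 * v0 * N v + 2 * (N v)\<^sup>2) / (v0 - N v)\<^sup>2)
      \<le> (1 - omega_inv \<beta>1)\<^sup>2 * (omega_star_inv \<beta>2 - omega_inv \<beta>1)"
  shows "Prox P ((x, y, s) + a *\<^sub>R (dx, dy, ds)) ((1 - a) * v0, (1 - a) *\<^sub>R v) \<le> ereal \<beta>2"
proof -
  define \<delta> where "\<delta> = omega_inv \<beta>1"
  define \<tau> where "\<tau> = omega_star_inv \<beta>2"
  note \<delta> = omega_inv_props[OF b1, folded \<delta>_def]
  have "0 \<le> omega_star \<delta>" using omega_star_le_iff[of 0 \<delta>] \<delta> by simp
  then have "0 \<le> \<beta>2" using b2 by (simp add: \<delta>_def)
  note \<tau> = omega_star_inv_props[OF this, folded \<tau>_def]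
  define M where "M = (nu P + 1) * (v0\<^sup>2 - 2 * v0 * N v + 2 * (N v)\<^sup>2) / (v0 - N v)\<^sup>2"
  note fd = feasibleD[OF u]
  let ?z = "((x, y), (v0, v))"
  have zD: "?z \<in> Dom" and fz: "f ?z - const - ell (v0, v) \<le> \<beta>1"
    using prox Prox_le_iff[OF fd(1) Nv] fd(3) by auto
  obtain xs ys where zs: "xs \<in> E" "A xs = b" "((xs, ys), (v0, v)) \<in> Dom"
    "f ((xs, ys), (v0, v)) - const = ell (v0, v)" by (rule central_point[OF Nv])
  let ?zs = "((xs, ys), (v0, v))" and ?d = "((dx, dy), (- v0, - v))"
  have dx: "dx \<in> E" "A dx = 0" and ds: "ds = - As dy" using pd by (auto simp: predictor_direction_def)
  define e where "e = ?z - ?zs"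
  have ze: "?zs + e = ?z" by (simp add: e_def)
  have eE: "x - xs \<in> E" "A (x - xs) = 0" using fd(1,2) zs(1,2) linear_A subspace_E by (simp_all add: subspace_diff linear_diff)
  have dell: "((\<lambda>a. ell (v0 + a * - v0, v + a *\<^sub>R - v)) has_real_derivative ell_deriv v0 v) (at 0)"
  proof -
    have "((\<lambda>a. ell ((1 - a) * v0, (1 - a) *\<^sub>R v)) has_real_derivative
        (nu P + 1) * (v0 - 2 * (1 - 0) * N v) / ((1 - 0) * v0 - (1 - 0)\<^sup>2 * N v)) (at 0)"
      by (rule ell_line[OF Nv]) (use Nv in simp_all)
    then show ?thesis by (simp add: ell_deriv_def algebra_simps)
  qed
  \<comment> \<open>With \<open>w\<close> fixed the slope of \<open>ell\<close> is 0, so the central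
    point is stationary in the directions of \<open>u\<close>, and \<beta>1 bounds
    \<open>omega\<close> of the distance.\<close>
  have De: "DD f [e] ?zs = 0"
  proof -
    have "e = ((x - xs, y - ys), (0, 0))" by (simp add: e_def zero_prod_def)
    then show ?thesis using central_derivative[where dv0=0 and dv=0 and g=0 and ey="y - ys", OF zs eE] by simp
  qed
  have Dd: "DD f [?d] ?zs = ell_deriv v0 v" by (rule central_derivative[OF zs dx dell])
  have "f ?zs + 0 + omega (lnorm f ?zs e) \<le> f ?z"
    using sc_lower_bound[OF sc_f zs(3), of e] zD De unfolding ze by simp
  then have "omega (lnorm f ?zs e) \<le> omega \<delta>" using fz zs(4) \<delta>(3) by simp
  then have e\<delta>: "lnorm f ?zs e \<le> \<delta>"
    using omega_le_iff[OF lnorm_nonneg[OF sc_f zs(3)], of \<delta>] \<delta>(1) by simp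
  have nb: "((1 - \<delta>) * lnorm f ?z ?d)\<^sup>2 \<le> M"
    unfolding M_def by (rule predictor_norm_bound[OF Nv zs fd(1,2) zD e\<delta>[unfolded e_def] \<delta>(2) pd])
  have "(1 - lnorm f ?zs e) * lnorm f ?zs ?d \<le> lnorm f ?z ?d"
    using sc_lnorm_compare(2)[OF sc_f zs(3), of e ?d] e\<delta> \<delta>(2) unfolding ze by simp
  moreover have "(1 - \<delta>) * lnorm f ?zs ?d \<le> (1 - lnorm f ?zs e) * lnorm f ?zs ?d"
    using e\<delta> lnorm_nonneg[OF sc_f zs(3)] by (intro mult_right_mono) auto
  ultimately have "(1 - \<delta>) * ((1 - \<delta>) * lnorm f ?zs ?d) \<le> (1 - \<delta>) * lnorm f ?z ?d"
    using \<delta>(2) by (intro mult_left_mono) auto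
  also have "\<dots> \<le> sqrt M" using nb by (rule real_le_rsqrt)
  finally have "a * ((1 - \<delta>)\<^sup>2 * lnorm f ?zs ?d) \<le> a * sqrt M"
    using a by (intro mult_left_mono) (simp_all add: power2_eq_square mult.assoc)
  also have "\<dots> \<le> (1 - \<delta>)\<^sup>2 * (\<tau> - \<delta>)" using small by (simp add: M_def \<delta>_def \<tau>_def)
  finally have "(1 - \<delta>)\<^sup>2 * (a * lnorm f ?zs ?d) \<le> (1 - \<delta>)\<^sup>2 * (\<tau> - \<delta>)" by (simp add: mult.left_commute)
  then have ad: "a * lnorm f ?zs ?d \<le> \<tau> - \<delta>" using \<delta>(2) by (simp add: mult_le_cancel_left_pos)
  \<comment> \<open>The whole displacement from the central point: at most \<delta> to reach
    \<open>u\<close>, and at most \<tau> - \<delta> for the step.\<close>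
  define h where "h = e + a *\<^sub>R ?d"
  have "lnorm f ?zs h \<le> lnorm f ?zs e + lnorm f ?zs (a *\<^sub>R ?d)"
    unfolding h_def by (rule lnorm_triangle[OF sc_f zs(3)])
  also have "lnorm f ?zs (a *\<^sub>R ?d) = a * lnorm f ?zs ?d"
    using lnorm_scale[OF sc_f zs(3), of a ?d] a by simp
  finally have h\<tau>: "lnorm f ?zs h \<le> \<tau>" using e\<delta> ad by linarith
  then have h1: "lnorm f ?zs h < 1" using \<tau>(2) by simp
  have zh: "?zs + h = ((x + a *\<^sub>R dx, y + a *\<^sub>R dy), ((1 - a) * v0, (1 - a) *\<^sub>R v))"
    unfolding h_def add.assoc[symmetric] ze by (simp add: algebra_simps)
  have D': "((x + a *\<^sub>R dx, y + a *\<^sub>R dy), ((1 - a) * v0, (1 - a) *\<^sub>R v)) \<in> Dom"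
    using sc_dikin[OF sc_f zs(3) h1] unfolding zh .
  have lin: "linear (\<lambda>h. DD f [h] ?zs)" using DD1_linear[OF sc_open[OF sc_f] sc_smooth_le[OF sc_f] zs(3)] by simp
  \<comment> \<open>The first order term is that of \<open>ell\<close>; against the value of
    \<open>ell\<close> at the new target it cancels up to \<open>ell_rem\<close>, which has the
    favourable sign.\<close>
  have "DD f [h] ?zs = a * ell_deriv v0 v"
    unfolding h_def linear_add[OF lin] linear_cmul[OF lin] De Dd by simp
  then have "f (?zs + h) \<le> f ?zs + a * ell_deriv v0 v + omega_star (lnorm f ?zs h)"
    using sc_upper_bound[OF sc_f zs(3) h1] by simp
  also have "omega_star (lnorm f ?zs h) \<le> \<beta>2"
    using h\<tau> h1 \<tau> lnorm_nonneg[OF sc_f zs(3), of h] omega_star_le_iff[of "lnorm f ?zs h" \<tau>] by simp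
  finally have "f (?zs + h) - const \<le> ell (v0, v) + a * ell_deriv v0 v + \<beta>2" using zs(4) by simp
  also have "\<dots> \<le> ell ((1 - a) * v0, (1 - a) *\<^sub>R v) + \<beta>2"
    using ell_rem_nonneg[OF Nv a] by (simp add: ell_rem_def)
  finally have le: "f (?zs + h) - const - ell ((1 - a) * v0, (1 - a) *\<^sub>R v) \<le> \<beta>2" by simp
  have Na: "N ((1 - a) *\<^sub>R v) < (1 - a) * v0" by (rule N_scale_less[OF Nv]) (use a in auto)
  have xE: "x + a *\<^sub>R dx \<in> E" using fd(1) dx(1) subspace_E by (simp add: subspace_add subspace_scale)
  have "(x, y, s) + a *\<^sub>R (dx, dy, ds) = (x + a *\<^sub>R dx, y + a *\<^sub>R dy, c - As (y + a *\<^sub>R dy))"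
    using fd(3) ds linear_As by (simp add: linear_add linear_cmul)
  then show ?thesis using Prox_le_iff[OF xE Na, of "y + a *\<^sub>R dy" \<beta>2] D' le unfolding zh by simp
qed

text \<open>The required inequality is equivalent to
  \<open>(1 - a) * (v0 + \<gamma> * (v0 - N v)) \<le> v0\<close>. The threshold for \<open>a\<close>
  is the case of equality, and longer steps only help.\<close>

lemma mu_star_scale:
  assumes Nv: "N v < v0" and \<gamma>: "0 \<le> \<gamma>" and a: "a \<le> 1"
    and low: "\<gamma> * (v0 - N v) / (v0 + \<gamma> * (v0 - N v)) \<le> a"
  shows "mu_star P ((1 - a) * v0, (1 - a) *\<^sub>R v) \<le> 1 / (1 + \<gamma>) * mu_star P (v0, v)"
proof (cases "a = 1")
  case True
  \<comment> \<open>At the full step the target is 0, and \<open>mu_star\<close> is the quotient 0 /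
    0, which is 0.\<close>
  then show ?thesis using Nv \<gamma> by (simp add: mu_star_def)
next
  case False
  define D where "D = v0 - N v"
  have D: "0 < D" and v0: "0 < v0" using Nv N_nonneg[of v] by (simp_all add: D_def)
  have a1: "0 < 1 - a" using a False by simp
  have "0 \<le> \<gamma> * D" using \<gamma> D by simp
  then have den: "0 < v0 + \<gamma> * D" using v0 by linarith
  have "0 \<le> \<gamma> * D / (v0 + \<gamma> * D)" using \<gamma> D den by simp
  then have a0: "0 \<le> a" using low by (simp add: D_def)
  have low': "\<gamma> * D \<le> a * (v0 + \<gamma> * D)" using low den by (simp add: D_def divide_le_eq)
  have X: "0 < v0 - (1 - a) * N v"
  proof -
    have "(1 - a) * N v \<le> N v" using mult_left_le_one_le[OF N_nonneg, of "1 - a"] a0 a1 by simp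
    then show ?thesis using Nv by simp
  qed
  have "mu_star P ((1 - a) * v0, (1 - a) *\<^sub>R v) = ((1 - a) * (1 - a) * v0\<^sup>2) / ((1 - a) * (v0 - (1 - a) * N v))"
    unfolding mu_star_def prod.case N_scale by (simp add: power2_eq_square algebra_simps)
  also have "\<dots> = (1 - a) * v0\<^sup>2 / (v0 - (1 - a) * N v)" using a1 by simp
  also have "\<dots> \<le> v0\<^sup>2 / ((1 + \<gamma>) * D)"
  proof -
    have "(1 - a) * ((1 + \<gamma>) * D) \<le> v0 - (1 - a) * N v"
      using low' by (simp add: D_def algebra_simps)
    then have "(1 - a) * ((1 + \<gamma>) * D) * v0\<^sup>2 \<le> (v0 - (1 - a) * N v) * v0\<^sup>2" by (rule mult_right_mono) simp
    then have "(1 - a) * v0\<^sup>2 * ((1 + \<gamma>) * D) \<le> v0\<^sup>2 * (v0 - (1 - a) * N v)" by (simp only: mult.assoc mult.commute mult.left_commute)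
    moreover have "0 < (1 + \<gamma>) * D" using D \<gamma> by simp
    ultimately show ?thesis using X by (simp add: pos_divide_le_eq pos_le_divide_eq)
  qed
  finally show ?thesis by (simp add: mu_star_def D_def)
qed

end

theorem mainTheorem3:
  fixes P :: "('a::euclidean_space, 'n::finite, 'm::finite) multiconic"
    and u u_plus :: "('a, 'n, 'm) pdpoint"
    and w w_plus :: "'n target"
    and \<beta>1 \<beta>2 \<sigma> \<gamma> :: real
  assumes "multiconic_problem P"
    and "0 < \<beta>1" and "\<beta>1 < 1 - ln 2"
    and "\<beta>2 > omega_star (omega_inv \<beta>1)"
    and "w \<in> dom_phi P"
    and "u \<in> feasible P"
    and "Prox P u w \<le> ereal \<beta>1"
    and "predictor_step P \<beta>2 u w (- w) u_plus w_plus"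
    and "\<sigma> = (1 - omega_inv \<beta>1)\<^sup>2 * (omega_star_inv \<beta>2 - omega_inv \<beta>1)"
    and "\<gamma> = \<sigma> / sqrt (nu P + 1)"
  shows "mu_star P w_plus \<le> 1 / (1 + \<gamma>) * mu_star P w
    \<and> 1 / (1 + \<gamma>) * mu_star P w \<le> exp (- \<gamma> / (1 + \<gamma>)) * mu_star P w"
proof -
  interpret multiconic P using assms(1) by unfold_locales
  obtain v0 v where w: "w = (v0, v)" by (cases w)
  obtain x y s where u: "u = (x, y, s)" by (cases u)
  have Nv: "N v < v0" using dom_phiD assms(5) w by blast
  define t where "t = N v"
  have t: "0 \<le> t" "t < v0" using N_nonneg Nv by (simp_all add: t_def)
  have k: "0 < nu P + 1" using nu_nonneg by simp
  note \<delta> = omega_inv_props[OF assms(2,3)]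
  have "0 \<le> omega_star (omega_inv \<beta>1)" using omega_star_le_iff[of 0 "omega_inv \<beta>1"] \<delta> by simp
  then have "0 \<le> \<beta>2" using assms(4) by simp
  note \<tau> = omega_star_inv_props[OF this]
  have "omega_inv \<beta>1 \<le> omega_star_inv \<beta>2"
    using omega_star_le_iff[of "omega_inv \<beta>1" "omega_star_inv \<beta>2"] \<delta> \<tau> assms(4) by simp
  then have \<sigma>: "0 \<le> \<sigma>" unfolding assms(9) by simp
  then have \<gamma>: "0 \<le> \<gamma>" using k unfolding assms(10) by simp
  obtain du where du: "predictor_direction P u w (- w) du"
    "w_plus = w + predictor_stepsize P \<beta>2 u w du (- w) *\<^sub>R (- w)"
    using assms(8) by (auto simp: predictor_step_def Let_def)
  obtain dx dy ds where d: "du = (dx, dy, ds)" by (cases du)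
  define \<alpha> where "\<alpha> = predictor_stepsize P \<beta>2 u w du (- w)"
  have wp: "w_plus = ((1 - \<alpha>) * v0, (1 - \<alpha>) *\<^sub>R v)"
    using du(2) w by (simp add: \<alpha>_def algebra_simps)
  define S where "S = {\<alpha> \<in> {0..1}. Prox P (u + \<alpha> *\<^sub>R du) (w + \<alpha> *\<^sub>R - w) \<le> ereal \<beta>2}"
  have \<alpha>S: "\<alpha> = Sup S" by (simp add: \<alpha>_def predictor_stepsize_def S_def)
  have bS: "bdd_above S" by (rule bdd_aboveI[of _ 1]) (simp add: S_def)
  define g where "g = \<gamma> * (v0 - t)"
  have g: "0 \<le> g" using \<gamma> t by (simp add: g_def)
  \<comment> \<open>The shortest step for which \<open>mu_star_scale\<close> gives the factor
    \<open>1 / (1 + \<gamma>)\<close>; it remains to show that it is admissible.\<close>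
  define a where "a = g / (v0 + g)"
  have den: "0 < v0 + g" using t g by simp
  have a: "0 \<le> a" "a < 1" using g den t by (simp_all add: a_def)
  have small: "a * sqrt ((nu P + 1) * (v0\<^sup>2 - 2 * v0 * N v + 2 * (N v)\<^sup>2) / (v0 - N v)\<^sup>2) \<le> \<sigma>"
  proof -
    \<comment> \<open>Discarding \<open>2 * t * (v0 - t)\<close> leaves
      \<open>(nu P + 1) * v0\<^sup>2 / (v0 - t)\<^sup>2\<close>, whose root times \<open>a\<close>
      is \<open>\<sigma> * v0 / (v0 + g)\<close>.\<close>
    have "v0\<^sup>2 - 2 * v0 * t + 2 * t\<^sup>2 \<le> v0\<^sup>2"
      using mult_right_mono[of t v0 t] t by (simp add: power2_eq_square)
    then have "(nu P + 1) * (v0\<^sup>2 - 2 * v0 * t + 2 * t\<^sup>2) / (v0 - t)\<^sup>2 \<le> (nu P + 1) * v0\<^sup>2 / (v0 - t)\<^sup>2"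
      using k by (intro divide_right_mono mult_left_mono) auto
    then have "sqrt ((nu P + 1) * (v0\<^sup>2 - 2 * v0 * t + 2 * t\<^sup>2) / (v0 - t)\<^sup>2) \<le> sqrt ((nu P + 1) * v0\<^sup>2 / (v0 - t)\<^sup>2)"
      by (rule real_sqrt_le_mono)
    also have "\<dots> = sqrt (nu P + 1) * v0 / (v0 - t)"
      using t by (simp add: real_sqrt_mult real_sqrt_divide)
    finally have "a * sqrt ((nu P + 1) * (v0\<^sup>2 - 2 * v0 * t + 2 * t\<^sup>2) / (v0 - t)\<^sup>2) \<le> a * (sqrt (nu P + 1) * v0 / (v0 - t))"
      using a by (intro mult_left_mono)
    also have "\<dots> = \<sigma> * (v0 / (v0 + g))"
    proof -
      have "\<sigma> = \<gamma> * sqrt (nu P + 1)" using k unfolding assms(10) by simp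
      then show ?thesis using t unfolding a_def by (simp add: g_def)
    qed
    also have "\<dots> \<le> \<sigma>" using \<sigma> g den t by (intro mult_left_le) (simp_all add: divide_le_eq)
    finally show ?thesis by (simp add: t_def)
  qed
  have "Prox P ((x, y, s) + a *\<^sub>R (dx, dy, ds)) ((1 - a) * v0, (1 - a) *\<^sub>R v) \<le> ereal \<beta>2"
    by (rule predictor_step_admissible[OF assms(2-4) Nv _ _ _ a small[unfolded assms(9)]])
       (use assms(6,7) du(1) u w d in simp_all)
  moreover have "w + a *\<^sub>R - w = ((1 - a) * v0, (1 - a) *\<^sub>R v)" using w by (simp add: algebra_simps)
  ultimately have aS: "a \<in> S" using a u d by (simp add: S_def)
  \<comment> \<open>Only these bounds on the supremum enter: \<open>mu_star_scale\<close> covers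
    every step from \<open>a\<close> up to 1, whether or not the supremum is attained.\<close>
  then have "a \<le> \<alpha>" unfolding \<alpha>S by (rule cSup_upper[OF _ bS])
  then have low: "\<gamma> * (v0 - N v) / (v0 + \<gamma> * (v0 - N v)) \<le> \<alpha>" by (simp add: a_def g_def t_def)
  have "\<alpha> \<le> 1" unfolding \<alpha>S by (rule cSup_least) (use aS in \<open>auto simp: S_def\<close>)
  from mu_star_scale[OF Nv \<gamma> this low]
  have first: "mu_star P w_plus \<le> 1 / (1 + \<gamma>) * mu_star P w" using wp w by simp
  have mu: "0 \<le> mu_star P w" using Nv w by (simp add: mu_star_def)
  \<comment> \<open>The left side is \<open>1 - \<gamma> / (1 + \<gamma>)\<close>.\<close>
  have "1 / (1 + \<gamma>) \<le> exp (- \<gamma> / (1 + \<gamma>))"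
    using exp_ge_add_one_self[of "- \<gamma> / (1 + \<gamma>)"] \<gamma> by (simp add: field_simps)
  then have "1 / (1 + \<gamma>) * mu_star P w \<le> exp (- \<gamma> / (1 + \<gamma>)) * mu_star P w" using mu by (rule mult_right_mono)
  with first show ?thesis ..
qed

end
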